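(* Let $G$ be a Carnot group with stratified Lie algebra $\mathfrak g=V_1\oplus\cdots\oplus V_s$, equipped with the left-invariant Riemannian metric $g$ induced by an inner product on $\mathfrak g$ for which $V_i\perp V_j$ whenever $i\ne j$. Let $\mathcal H$ and $\mathcal V$ be the left-invariant sub-bundles of $TG$ equal at the identity to $V_1$ and $\oplus_{i\ge2}V_i$ respectively, and let $\mathcal F$ be the foliation of $G$ with tangent bundle $\mathcal V$. Then $\mathcal F$ is a Riemannian foliation with bundle-like metric $g$, and the leaves of $\mathcal F$ are minimal submanifolds of $G$.
   Context: A Carnot group of step $s$ is a connected, simply connected nilpotent Lie group $G$ whose Lie algebra admits a decomposition $\mathfrak g=V_1\oplus\cdots\oplus V_s$ with $[V_1,V_j]=V_{j+1}$ for $1\le j<s$ and $[V_1,V_s]=\{0\}$. Since $[\mathcal V,\mathcal V]\subset\mathcal V$, $\mathcal V$ is integrable. The metric $g$ is bundle-like for $\mathcal F$ (and $\mathcal F$ is then a Riemannian foliation) if $(\mathcal L_Ug)(X,X)=0$ for all smooth sections $X$ of $\mathcal H=\mathcal V^\perp$ and $U$ of $\mathcal V$, $\mathcal L$ being the Lie derivative. The leaves are minimal if, with $D$ the Levi-Civita connection, $\sum_iD_{Z_i}Z_i$ is a section of $\mathcal V$ for any local orthonormal frame $(Z_i)$ of $\mathcal V$. *)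

theory Defs
  imports
    "HOL-Analysis.Analysis"
    "HOL-Algebra.Group"
    "HOL-Algebra.Generated_Groups"
    "HOL-Library.Function_Algebras"
    "HOL-Library.Disjoint_Sets"
begin

(* Tangent vectors are represented below as functionals on real-valued functions; the pointwise
   vector space structure makes span, subspace, independent and finite sums available for them. *)
instantiation "fun" :: (type, real_vector) real_vector
begin

definition scaleR_fun :: "real \<Rightarrow> ('a \<Rightarrow> 'b) \<Rightarrow> 'a \<Rightarrow> 'b"
  where "scaleR_fun c f = (\<lambda>x. c *\<^sub>R f x)"

instance
  by standard (simp_all add: scaleR_fun_def plus_fun_def fun_eq_iff scaleR_add_right scaleR_add_left)

end


section \<open>Smooth maps between open subsets of Euclidean spaces\<close>

(* Meant for open S. *)
fun Ck_on :: "nat \<Rightarrow> 'a::euclidean_space set \<Rightarrow> ('a \<Rightarrow> 'b::real_normed_vector) \<Rightarrow> bool" where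
  "Ck_on 0 S f \<longleftrightarrow> continuous_on S f"
| "Ck_on (Suc k) S f \<longleftrightarrow>
     (\<forall>x\<in>S. f differentiable (at x)) \<and> (\<forall>v. Ck_on k S (\<lambda>x. frechet_derivative f (at x) v))"

definition smooth_on :: "'a::euclidean_space set \<Rightarrow> ('a \<Rightarrow> 'b::real_normed_vector) \<Rightarrow> bool" where
  "smooth_on S f \<longleftrightarrow> (\<forall>k. Ck_on k S f)"


section \<open>Smooth manifolds\<close>

(* A chart is a pair of its domain and its coordinate map. Coordinate maps are total functions,
   whose values outside the domain are irrelevant. *)
type_synonym ('m, 'e) chart = "'m set \<times> ('m \<Rightarrow> 'e)"

definition is_chart :: "('m::topological_space, 'e::euclidean_space) chart \<Rightarrow> bool" where
  "is_chart c \<longleftrightarrow> (case c of (U, \<phi>) \<Rightarrow>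
     open U \<and> open (\<phi> ` U) \<and> homeomorphism U (\<phi> ` U) \<phi> (inv_into U \<phi>))"

definition compatible_charts ::
  "('m, 'e::euclidean_space) chart \<Rightarrow> ('m, 'e) chart \<Rightarrow> bool" where
  "compatible_charts c d \<longleftrightarrow> (case (c, d) of ((U, \<phi>), (V, \<psi>)) \<Rightarrow>
     smooth_on (\<phi> ` (U \<inter> V)) (\<psi> \<circ> inv_into U \<phi>) \<and> smooth_on (\<psi> ` (U \<inter> V)) (\<phi> \<circ> inv_into V \<psi>))"

(* The manifold is the whole type 'm, whose class supplies the Hausdorff property and second
   countability; its dimension is DIM('e). The atlas need not be maximal. *)
definition smooth_atlas ::
  "('m::{t2_space,second_countable_topology}, 'e::euclidean_space) chart set \<Rightarrow> bool" where
  "smooth_atlas \<A> \<longleftrightarrow> (\<forall>c\<in>\<A>. is_chart c) \<and> (\<Union>c\<in>\<A>. fst c) = UNIV \<and>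
     (\<forall>c\<in>\<A>. \<forall>d\<in>\<A>. compatible_charts c d)"

definition product_atlas ::
  "('m, 'e) chart set \<Rightarrow> ('n, 'f) chart set \<Rightarrow> ('m \<times> 'n, 'e \<times> 'f) chart set" where
  "product_atlas \<A> \<B> = {(U \<times> V, map_prod \<phi> \<psi>) | U \<phi> V \<psi>. (U, \<phi>) \<in> \<A> \<and> (V, \<psi>) \<in> \<B>}"

definition smooth_map ::
  "('m::topological_space, 'e::euclidean_space) chart set
   \<Rightarrow> ('n::topological_space, 'f::euclidean_space) chart set \<Rightarrow> ('m \<Rightarrow> 'n) \<Rightarrow> bool" where
  "smooth_map \<A> \<B> F \<longleftrightarrow> continuous_on UNIV F \<and>
     (\<forall>(U, \<phi>)\<in>\<A>. \<forall>(V, \<psi>)\<in>\<B>. smooth_on (\<phi> ` (U \<inter> F -` V)) (\<psi> \<circ> F \<circ> inv_into U \<phi>))"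

definition smooth_fun_on ::
  "('m, 'e::euclidean_space) chart set \<Rightarrow> 'm set \<Rightarrow> ('m \<Rightarrow> real) \<Rightarrow> bool" where
  "smooth_fun_on \<A> W f \<longleftrightarrow> (\<forall>(U, \<phi>)\<in>\<A>. smooth_on (\<phi> ` (U \<inter> W)) (f \<circ> inv_into U \<phi>))"

definition smooth_near ::
  "('m::topological_space, 'e::euclidean_space) chart set \<Rightarrow> 'm \<Rightarrow> ('m \<Rightarrow> real) \<Rightarrow> bool" where
  "smooth_near \<A> p f \<longleftrightarrow> (\<exists>W. open W \<and> p \<in> W \<and> smooth_fun_on \<A> W f)"


section \<open>Tangent vectors and vector fields\<close>

type_synonym 'm tangent_vector = "('m \<Rightarrow> real) \<Rightarrow> real"
type_synonym 'm vector_field = "'m \<Rightarrow> 'm tangent_vector"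
type_synonym 'm subbundle = "'m \<Rightarrow> 'm tangent_vector set"
type_synonym 'm metric_tensor = "'m \<Rightarrow> 'm tangent_vector \<Rightarrow> 'm tangent_vector \<Rightarrow> real"

(* The tangent vector at p with coordinates w in the chart (U, \<phi>), i.e. the derivation
   sum_i w_i (d/dx_i) on functions that are smooth near p. It is 0 on all other functions, so that
   equality of tangent vectors as HOL functions is equality of derivations. *)
definition coord_vector ::
  "('m::topological_space, 'e::euclidean_space) chart set \<Rightarrow> ('m, 'e) chart \<Rightarrow> 'm \<Rightarrow> 'e
   \<Rightarrow> 'm tangent_vector" where
  "coord_vector \<A> c p w = (\<lambda>f. case c of (U, \<phi>) \<Rightarrow>
     if smooth_near \<A> p f then frechet_derivative (f \<circ> inv_into U \<phi>) (at (\<phi> p)) w else 0)"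

definition tangent_space ::
  "('m::topological_space, 'e::euclidean_space) chart set \<Rightarrow> 'm subbundle" where
  "tangent_space \<A> p = {coord_vector \<A> c p w | c w. c \<in> \<A> \<and> p \<in> fst c}"

definition differential ::
  "('n::topological_space, 'f::euclidean_space) chart set \<Rightarrow> ('m \<Rightarrow> 'n) \<Rightarrow> 'm
   \<Rightarrow> 'm tangent_vector \<Rightarrow> 'n tangent_vector" where
  "differential \<B> F p v = (\<lambda>f. if smooth_near \<B> (F p) f then v (f \<circ> F) else 0)"

definition smooth_vector_field_on ::
  "('m::topological_space, 'e::euclidean_space) chart set \<Rightarrow> 'm set \<Rightarrow> 'm vector_field \<Rightarrow> bool" where
  "smooth_vector_field_on \<A> W X \<longleftrightarrow> (\<forall>p\<in>W. X p \<in> tangent_space \<A> p) \<and>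
     (\<forall>W' f. open W' \<and> W' \<subseteq> W \<and> smooth_fun_on \<A> W' f \<longrightarrow> smooth_fun_on \<A> W' (\<lambda>p. X p f))"

definition lie_bracket ::
  "('m::topological_space, 'e::euclidean_space) chart set \<Rightarrow> 'm vector_field \<Rightarrow> 'm vector_field
   \<Rightarrow> 'm vector_field" where
  "lie_bracket \<A> X Y = (\<lambda>p f.
     if smooth_near \<A> p f then X p (\<lambda>q. Y q f) - Y p (\<lambda>q. X q f) else 0)"

definition smooth_section ::
  "('m::topological_space, 'e::euclidean_space) chart set \<Rightarrow> 'm subbundle \<Rightarrow> 'm set
   \<Rightarrow> 'm vector_field \<Rightarrow> bool" where
  "smooth_section \<A> E W X \<longleftrightarrow> smooth_vector_field_on \<A> W X \<and> (\<forall>p\<in>W. X p \<in> E p)"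

definition smooth_subbundle ::
  "('m::topological_space, 'e::euclidean_space) chart set \<Rightarrow> 'm subbundle \<Rightarrow> bool" where
  "smooth_subbundle \<A> E \<longleftrightarrow> (\<exists>k::nat. \<forall>p. \<exists>W Z. open W \<and> p \<in> W \<and>
     (\<forall>i<k. smooth_section \<A> E W (Z i)) \<and>
     (\<forall>q\<in>W. inj_on (\<lambda>i. Z i q) {..<k} \<and> independent ((\<lambda>i. Z i q) ` {..<k}) \<and>
        span ((\<lambda>i. Z i q) ` {..<k}) = E q))"

definition involutive ::
  "('m::topological_space, 'e::euclidean_space) chart set \<Rightarrow> 'm subbundle \<Rightarrow> bool" where
  "involutive \<A> E \<longleftrightarrow> (\<forall>W X Y. open W \<and> smooth_section \<A> E W X \<and> smooth_section \<A> E W Y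
     \<longrightarrow> smooth_section \<A> E W (lie_bracket \<A> X Y))"


section \<open>Riemannian metrics and the Levi-Civita connection\<close>

definition inner_product_on :: "'v::real_vector set \<Rightarrow> ('v \<Rightarrow> 'v \<Rightarrow> real) \<Rightarrow> bool" where
  "inner_product_on S b \<longleftrightarrow>
     (\<forall>u\<in>S. \<forall>v\<in>S. \<forall>w\<in>S. b (u + v) w = b u w + b v w) \<and>
     (\<forall>c. \<forall>u\<in>S. \<forall>v\<in>S. b (c *\<^sub>R u) v = c * b u v) \<and>
     (\<forall>u\<in>S. \<forall>v\<in>S. b u v = b v u) \<and>
     (\<forall>u\<in>S. u \<noteq> 0 \<longrightarrow> b u u > 0)"

definition riemannian_metric ::
  "('m::topological_space, 'e::euclidean_space) chart set \<Rightarrow> 'm metric_tensor \<Rightarrow> bool" where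
  "riemannian_metric \<A> g \<longleftrightarrow> (\<forall>p. inner_product_on (tangent_space \<A> p) (g p)) \<and>
     (\<forall>W X Y. open W \<and> smooth_vector_field_on \<A> W X \<and> smooth_vector_field_on \<A> W Y
        \<longrightarrow> smooth_fun_on \<A> W (\<lambda>p. g p (X p) (Y p)))"

definition orth_complement ::
  "('m::topological_space, 'e::euclidean_space) chart set \<Rightarrow> 'm metric_tensor \<Rightarrow> 'm subbundle
   \<Rightarrow> 'm subbundle" where
  "orth_complement \<A> g E p = {v \<in> tangent_space \<A> p. \<forall>w\<in>E p. g p v w = 0}"

(* D X Y is the covariant derivative of Y along X. One operator D serves the vector fields on all
   open sets W; the axioms over a given W determine D X Y on W. *)
definition levi_civita_connection ::
  "('m::topological_space, 'e::euclidean_space) chart set \<Rightarrow> 'm metric_tensor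
   \<Rightarrow> ('m vector_field \<Rightarrow> 'm vector_field \<Rightarrow> 'm vector_field) \<Rightarrow> bool" where
  "levi_civita_connection \<A> g D \<longleftrightarrow> (\<forall>W X Y Z f. open W \<and>
       smooth_vector_field_on \<A> W X \<and> smooth_vector_field_on \<A> W Y \<and>
       smooth_vector_field_on \<A> W Z \<and> smooth_fun_on \<A> W f \<longrightarrow>
     smooth_vector_field_on \<A> W (D X Y) \<and>
     (\<forall>p\<in>W.
        D (\<lambda>q. X q + Y q) Z p = D X Z p + D Y Z p \<and>
        D (\<lambda>q. f q *\<^sub>R X q) Y p = f p *\<^sub>R D X Y p \<and>
        D X (\<lambda>q. Y q + Z q) p = D X Y p + D X Z p \<and>
        D X (\<lambda>q. f q *\<^sub>R Y q) p = X p f *\<^sub>R Y p + f p *\<^sub>R D X Y p \<and>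
        D X Y p - D Y X p = lie_bracket \<A> X Y p \<and>
        X p (\<lambda>q. g q (Y q) (Z q)) = g p (D X Y p) (Z p) + g p (Y p) (D X Z p)))"

definition lie_derivative_metric ::
  "('m::topological_space, 'e::euclidean_space) chart set \<Rightarrow> 'm metric_tensor \<Rightarrow> 'm vector_field
   \<Rightarrow> 'm vector_field \<Rightarrow> 'm vector_field \<Rightarrow> 'm \<Rightarrow> real" where
  "lie_derivative_metric \<A> g U X Y p = U p (\<lambda>q. g q (X q) (Y q))
     - g p (lie_bracket \<A> U X p) (Y p) - g p (X p) (lie_bracket \<A> U Y p)"


section \<open>Foliations\<close>

(* The velocity at time 0 of a smooth curve \<gamma>. *)
definition velocity ::
  "('m::topological_space, 'e::euclidean_space) chart set \<Rightarrow> (real \<Rightarrow> 'm) \<Rightarrow> 'm tangent_vector" where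
  "velocity \<A> \<gamma> = (\<lambda>f. if smooth_near \<A> (\<gamma> 0) f then deriv (f \<circ> \<gamma>) 0 else 0)"

definition smooth_curve ::
  "('m::topological_space, 'e::euclidean_space) chart set \<Rightarrow> real \<Rightarrow> (real \<Rightarrow> 'm) \<Rightarrow> bool" where
  "smooth_curve \<A> \<epsilon> \<gamma> \<longleftrightarrow> continuous_on {-\<epsilon><..<\<epsilon>} \<gamma> \<and>
     (\<forall>(U, \<phi>)\<in>\<A>. smooth_on ({-\<epsilon><..<\<epsilon>} \<inter> \<gamma> -` U) (\<phi> \<circ> \<gamma>))"

(* A foliation, given as its set of leaves. Each point has a foliated chart (U, \<phi>), compatible with
   the atlas: the plaques are the slices of U on which \<phi> runs through a translate of a fixed
   k-dimensional linear subspace S (they are connected, as \<phi> ` U is convex), and each leaf meets U in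
   countably many plaques. Countability ensures that a continuous path inside a leaf stays, as long
   as it is in U, in one plaque; so path-connectedness of a leaf in the topology of the manifold is
   the same as in the leaf topology. *)
definition foliation ::
  "('m::topological_space, 'e::euclidean_space) chart set \<Rightarrow> 'm set set \<Rightarrow> bool" where
  "foliation \<A> \<F> \<longleftrightarrow> partition_on UNIV \<F> \<and> (\<forall>L\<in>\<F>. path_connected L) \<and>
     (\<exists>k::nat. \<forall>p. \<exists>U \<phi> S. p \<in> U \<and> is_chart (U, \<phi>) \<and>
        (\<forall>c\<in>\<A>. compatible_charts (U, \<phi>) c) \<and> convex (\<phi> ` U) \<and> subspace S \<and> dim S = k \<and>
        (\<forall>L\<in>\<F>. \<exists>C. countable C \<and> L \<inter> U = {q \<in> U. \<exists>y\<in>C. \<phi> q - y \<in> S}))"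

(* Tangent vectors to the leaf through p: velocities of smooth curves lying in that leaf. *)
definition foliation_tangent ::
  "('m::topological_space, 'e::euclidean_space) chart set \<Rightarrow> 'm set set \<Rightarrow> 'm subbundle" where
  "foliation_tangent \<A> \<F> p = {velocity \<A> \<gamma> | \<gamma> \<epsilon> L. \<epsilon> > 0 \<and> L \<in> \<F> \<and> smooth_curve \<A> \<epsilon> \<gamma> \<and>
     \<gamma> 0 = p \<and> \<gamma> ` {-\<epsilon><..<\<epsilon>} \<subseteq> L}"

(* The next two notions depend on a foliation only through its tangent bundle E. *)
definition bundle_like_metric ::
  "('m::topological_space, 'e::euclidean_space) chart set \<Rightarrow> 'm metric_tensor \<Rightarrow> 'm subbundle
   \<Rightarrow> bool" where
  "bundle_like_metric \<A> g E \<longleftrightarrow> riemannian_metric \<A> g \<and>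
     (\<forall>W X U. open W \<and> smooth_section \<A> (orth_complement \<A> g E) W X \<and> smooth_section \<A> E W U
        \<longrightarrow> (\<forall>p\<in>W. lie_derivative_metric \<A> g U X X p = 0))"

definition local_orthonormal_frame ::
  "('m::topological_space, 'e::euclidean_space) chart set \<Rightarrow> 'm metric_tensor \<Rightarrow> 'm subbundle
   \<Rightarrow> 'm set \<Rightarrow> nat \<Rightarrow> (nat \<Rightarrow> 'm vector_field) \<Rightarrow> bool" where
  "local_orthonormal_frame \<A> g E W m Z \<longleftrightarrow>
     (\<forall>i<m. smooth_section \<A> E W (Z i)) \<and>
     (\<forall>p\<in>W. (\<forall>i<m. \<forall>j<m. g p (Z i p) (Z j p) = (if i = j then 1 else 0)) \<and>
        span ((\<lambda>i. Z i p) ` {..<m}) = E p)"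

definition minimal_leaves ::
  "('m::topological_space, 'e::euclidean_space) chart set \<Rightarrow> 'm metric_tensor \<Rightarrow> 'm subbundle
   \<Rightarrow> bool" where
  "minimal_leaves \<A> g E \<longleftrightarrow> (\<forall>D. levi_civita_connection \<A> g D \<longrightarrow>
     (\<forall>W m Z. open W \<and> local_orthonormal_frame \<A> g E W m Z
        \<longrightarrow> smooth_section \<A> E W (\<lambda>p. \<Sum>i<m. D (Z i) (Z i) p)))"

definition riemannian_foliation ::
  "('m::topological_space, 'e::euclidean_space) chart set \<Rightarrow> 'm metric_tensor \<Rightarrow> 'm set set
   \<Rightarrow> bool" where
  "riemannian_foliation \<A> g \<F> \<longleftrightarrow> foliation \<A> \<F> \<and> bundle_like_metric \<A> g (foliation_tangent \<A> \<F>)"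


section \<open>Lie groups and Carnot groups\<close>

definition lie_group ::
  "('g::{t2_space,second_countable_topology}, 'r) monoid_scheme
   \<Rightarrow> ('g, 'e::euclidean_space) chart set \<Rightarrow> bool" where
  "lie_group G \<A> \<longleftrightarrow> group G \<and> carrier G = UNIV \<and> smooth_atlas \<A> \<and>
     smooth_map (product_atlas \<A> \<A>) \<A> (\<lambda>(x, y). x \<otimes>\<^bsub>G\<^esub> y) \<and>
     smooth_map \<A> \<A> (\<lambda>x. inv\<^bsub>G\<^esub> x)"

fun lower_central_series :: "('g, 'r) monoid_scheme \<Rightarrow> nat \<Rightarrow> 'g set" where
  "lower_central_series G 0 = carrier G"
| "lower_central_series G (Suc n) = generate G
     {x \<otimes>\<^bsub>G\<^esub> y \<otimes>\<^bsub>G\<^esub> inv\<^bsub>G\<^esub> x \<otimes>\<^bsub>G\<^esub> inv\<^bsub>G\<^esub> y | x y. x \<in> carrier G \<and> y \<in> lower_central_series G n}"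

definition nilpotent_group :: "('g, 'r) monoid_scheme \<Rightarrow> bool" where
  "nilpotent_group G \<longleftrightarrow> (\<exists>n. lower_central_series G n = {\<one>\<^bsub>G\<^esub>})"

(* The Lie algebra of G is its tangent space at the identity; a vector v there corresponds to the
   left-invariant vector field p \<mapsto> d(L_p) v, where L_p is left translation by p. *)
definition lie_algebra ::
  "('g::topological_space, 'r) monoid_scheme \<Rightarrow> ('g, 'e::euclidean_space) chart set
   \<Rightarrow> 'g tangent_vector set" where
  "lie_algebra G \<A> = tangent_space \<A> \<one>\<^bsub>G\<^esub>"

definition left_invariant_field ::
  "('g::topological_space, 'r) monoid_scheme \<Rightarrow> ('g, 'e::euclidean_space) chart set
   \<Rightarrow> 'g tangent_vector \<Rightarrow> 'g vector_field" where
  "left_invariant_field G \<A> v = (\<lambda>p. differential \<A> (\<lambda>x. p \<otimes>\<^bsub>G\<^esub> x) \<one>\<^bsub>G\<^esub> v)"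

definition lie_algebra_bracket ::
  "('g::topological_space, 'r) monoid_scheme \<Rightarrow> ('g, 'e::euclidean_space) chart set
   \<Rightarrow> 'g tangent_vector \<Rightarrow> 'g tangent_vector \<Rightarrow> 'g tangent_vector" where
  "lie_algebra_bracket G \<A> u v =
     lie_bracket \<A> (left_invariant_field G \<A> u) (left_invariant_field G \<A> v) \<one>\<^bsub>G\<^esub>"

definition left_invariant_bundle ::
  "('g::topological_space, 'r) monoid_scheme \<Rightarrow> ('g, 'e::euclidean_space) chart set
   \<Rightarrow> 'g tangent_vector set \<Rightarrow> 'g subbundle" where
  "left_invariant_bundle G \<A> S p = (\<lambda>v. left_invariant_field G \<A> v p) ` S"

definition left_invariant_metric ::
  "('g::topological_space, 'r) monoid_scheme \<Rightarrow> ('g, 'e::euclidean_space) chart set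
   \<Rightarrow> ('g tangent_vector \<Rightarrow> 'g tangent_vector \<Rightarrow> real) \<Rightarrow> 'g metric_tensor" where
  "left_invariant_metric G \<A> b p u v =
     b (differential \<A> (\<lambda>x. inv\<^bsub>G\<^esub> p \<otimes>\<^bsub>G\<^esub> x) p u) (differential \<A> (\<lambda>x. inv\<^bsub>G\<^esub> p \<otimes>\<^bsub>G\<^esub> x) p v)"

(* V 1, ..., V s are the layers of the stratification; other values of V are irrelevant.
   The bracket of two sets of vectors is, as usual, the span of the pairwise brackets. *)
definition stratification ::
  "('g::topological_space, 'r) monoid_scheme \<Rightarrow> ('g, 'e::euclidean_space) chart set
   \<Rightarrow> nat \<Rightarrow> (nat \<Rightarrow> 'g tangent_vector set) \<Rightarrow> bool" where
  "stratification G \<A> s V \<longleftrightarrow>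
     (\<forall>i\<in>{1..s}. subspace (V i)) \<and>
     span (\<Union>i\<in>{1..s}. V i) = lie_algebra G \<A> \<and>
     (\<forall>x. (\<forall>i\<in>{1..s}. x i \<in> V i) \<and> (\<Sum>i=1..s. x i) = 0 \<longrightarrow> (\<forall>i\<in>{1..s}. x i = 0)) \<and>
     (\<forall>j\<in>{1..<s}. span {lie_algebra_bracket G \<A> u v | u v. u \<in> V 1 \<and> v \<in> V j} = V (Suc j)) \<and>
     span {lie_algebra_bracket G \<A> u v | u v. u \<in> V 1 \<and> v \<in> V s} = {0}"

definition carnot_group ::
  "('g::{t2_space,second_countable_topology}, 'r) monoid_scheme
   \<Rightarrow> ('g, 'e::euclidean_space) chart set \<Rightarrow> nat \<Rightarrow> (nat \<Rightarrow> 'g tangent_vector set) \<Rightarrow> bool" where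
  "carnot_group G \<A> s V \<longleftrightarrow> lie_group G \<A> \<and> connected (UNIV :: 'g set) \<and>
     simply_connected (UNIV :: 'g set) \<and> nilpotent_group G \<and> s \<ge> 1 \<and> stratification G \<A> s V"

end

theory Submission
  imports Defs
begin

text \<open>Choose an orthonormal basis of each layer of the Lie algebra with respect to \<open>b\<close> and let
  \<open>B = BH \<union> BV\<close> be their union, \<open>BH\<close> from the first layer and \<open>BV\<close> from the higher ones. The
  left-invariant fields \<open>\<E> e\<close>, \<open>e \<in> B\<close>, form a global orthonormal frame, and a smooth field \<open>X\<close> is
  described by its components \<open>\<theta> e X = g(X, \<E> e)\<close>, which are smooth functions
  (\<open>component_smooth\<close>). The Leibniz rule gives the components of a bracket
  (\<open>component_lie_bracket\<close>):
  \<open>\<theta> d [X, Y] = X (\<theta> d Y) - Y (\<theta> d X) + (\<Sum>e f. \<theta> e X * \<theta> f Y * b [e, f] d)\<close>.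

  The stratification enters through the grading \<open>[V i, V j] \<subseteq> V (i + j)\<close> (\<open>bracket_layer\<close>), and
  from there only through two facts about the structure constants, which are the assumptions of
  \<open>split_frame\<close> and follow from the orthogonality of the layers: all brackets are orthogonal to
  the first layer, and \<open>b [d, h] d = 0\<close> for \<open>d \<in> BV\<close> and \<open>h \<in> BH\<close>, because the bracket with \<open>h\<close>
  raises the degree by one.

  By the first fact, the sum in the formula is absent when \<open>d \<in> BH\<close>. If \<open>X\<close> and \<open>Y\<close> are
  vertical, the two derivatives vanish as well, so the vertical bundle is involutive. If
  \<open>U\<close> is vertical and \<open>X\<close> is horizontal, what remains is \<open>\<theta> d [U, X] = U (\<theta> d X)\<close>, whence
  \<open>g([U, X], X)\<close> is half of \<open>U (g(X, X))\<close> and \<open>(L\<^sub>U g)(X, X) = 0\<close> (\<open>bundle_like_vertical\<close>).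

  For minimality, compatibility with the metric and absence of torsion give
  \<open>g(D\<^sub>Z Z, \<E> h) = - g(Z, [Z, \<E> h])\<close> for a vertical unit field \<open>Z\<close> and \<open>h \<in> BH\<close>
  (\<open>levi_civita_horizontal_component\<close>). Summed over an orthonormal frame of the vertical bundle,
  the right-hand side is, up to sign, the trace on the vertical part of the bracket with \<open>h\<close>, all
  of whose diagonal entries vanish by the second fact (\<open>mean_curvature_vertical\<close>).

  Two choices shape the preliminaries. Smoothness is handled as a property of germs, which is local
  and can be tested in one chart. That brackets of left-invariant fields are again tangent to the
  group is read off from the stratification.\<close>

section \<open>Calculus of smooth functions on Euclidean spaces\<close>

lemma Ck_on_subset: "Ck_on k S f \<Longrightarrow> T \<subseteq> S \<Longrightarrow> Ck_on k T f"
  by (induction k arbitrary: f) (auto intro: continuous_on_subset)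

lemma Ck_on_cong:
  assumes "open S" "\<And>x. x \<in> S \<Longrightarrow> f x = g x" "Ck_on k S f"
  shows "Ck_on k S g"
  using assms(2,3)
proof (induction k arbitrary: f g)
  case 0
  then show ?case by (simp cong: continuous_on_cong)
next
  case (Suc k)
  have der: "(g has_derivative frechet_derivative f (at x)) (at x)" if "x \<in> S" for x
  proof (rule has_derivative_transform_within_open[OF _ \<open>open S\<close> that])
    show "(f has_derivative frechet_derivative f (at x)) (at x)"
      using Suc.prems(2) that by (simp add: frechet_derivative_works[symmetric])
  qed (simp add: Suc.prems(1))
  have eq: "frechet_derivative f (at x) = frechet_derivative g (at x)" if "x \<in> S" for x
    using frechet_derivative_at[OF der[OF that]] .
  have "Ck_on k S (\<lambda>x. frechet_derivative g (at x) v)" for v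
    using Suc.IH[of "\<lambda>x. frechet_derivative f (at x) v" "\<lambda>x. frechet_derivative g (at x) v"]
      Suc.prems(2) eq by simp
  moreover have "g differentiable (at x)" if "x \<in> S" for x
    using der[OF that] by (rule differentiableI)
  ultimately show ?case by simp
qed

text \<open>Gluing: the neighbourhoods may depend on the point, since the derivatives at a point depend
  only on the germ there.\<close>

lemma Ck_on_local:
  assumes "\<And>x. x \<in> S \<Longrightarrow> \<exists>T. open T \<and> x \<in> T \<and> Ck_on k T f"
  shows "Ck_on k S f"
  using assms
proof (induction k arbitrary: f)
  case 0
  have "continuous (at x within S) f" if x: "x \<in> S" for x
  proof -
    obtain T where "open T" "x \<in> T" "continuous_on T f" using 0[OF x] by auto
    then show ?thesis
      by (simp add: continuous_on_eq_continuous_at continuous_at_imp_continuous_within)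
  qed
  then show ?case by (simp add: continuous_on_eq_continuous_within)
next
  case (Suc k)
  have "f differentiable (at x)" if "x \<in> S" for x
    using Suc.prems[OF that] by auto
  moreover have "Ck_on k S (\<lambda>x. frechet_derivative f (at x) v)" for v
    by (rule Suc.IH) (use Suc.prems in fastforce)
  ultimately show ?case by simp
qed

lemma Ck_on_Suc_imp: "Ck_on (Suc k) S f \<Longrightarrow> Ck_on k S f"
proof (induction k arbitrary: f)
  case 0
  then show ?case
    by (simp add: continuous_on_eq_continuous_within continuous_at_imp_continuous_within
        differentiable_imp_continuous_within)
next
  case (Suc k)
  have "Ck_on k S (\<lambda>x. frechet_derivative f (at x) v)" for v
    using Suc.prems by (intro Suc.IH) simp
  with Suc.prems show ?case by simp
qed

lemma Ck_on_const: "Ck_on k S (\<lambda>x. c)"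
  by (induction k arbitrary: c) auto

lemma Ck_on_bounded_linear: "bounded_linear f \<Longrightarrow> Ck_on k S f"
proof (induction k)
  case 0
  then show ?case by (simp add: linear_continuous_on)
next
  case (Suc k)
  have "frechet_derivative f (at x) = f" for x
    using Suc.prems bounded_linear_imp_has_derivative frechet_derivative_at by metis
  then show ?case
    using Suc.prems by (simp add: bounded_linear_imp_differentiable Ck_on_const)
qed

text \<open>The general step of the calculus: a differentiation rule expressing the derivative of
  \<open>f\<close> by \<open>C\<^sup>k\<close> functions raises the order by one.\<close>

lemma Ck_on_SucI:
  assumes "open S" and "\<And>x. x \<in> S \<Longrightarrow> (f has_derivative f' x) (at x)"
    and "\<And>v. Ck_on k S (\<lambda>x. f' x v)"
  shows "Ck_on (Suc k) S f"
proof -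
  have eq: "f' x = frechet_derivative f (at x)" if "x \<in> S" for x
    using assms(2) that frechet_derivative_at by blast
  have "Ck_on k S (\<lambda>x. frechet_derivative f (at x) v)" for v
    by (rule Ck_on_cong[OF assms(1) _ assms(3)]) (simp add: eq)
  with assms(2) show ?thesis by (auto intro: differentiableI)
qed

lemma Ck_on_SucD:
  assumes "Ck_on (Suc k) S f"
  shows "x \<in> S \<Longrightarrow> (f has_derivative frechet_derivative f (at x)) (at x)"
    and "Ck_on k S (\<lambda>x. frechet_derivative f (at x) v)"
  using assms by (simp_all add: frechet_derivative_works[symmetric])

lemma Ck_on_add:
  assumes "open S" "Ck_on k S f" "Ck_on k S g"
  shows "Ck_on k S (\<lambda>x. f x + g x)"
  using assms(2,3)
proof (induction k arbitrary: f g)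
  case 0
  then show ?case by (simp add: continuous_on_add)
next
  case (Suc k)
  show ?case
    by (rule Ck_on_SucI[OF \<open>open S\<close> has_derivative_add[OF Ck_on_SucD(1)[OF Suc.prems(1)]
            Ck_on_SucD(1)[OF Suc.prems(2)]]])
      (use Suc.prems Suc.IH in \<open>simp_all\<close>)
qed

lemma Ck_on_bounded_bilinear:
  assumes "bounded_bilinear m" "open S" "Ck_on k S f" "Ck_on k S g"
  shows "Ck_on k S (\<lambda>x. m (f x) (g x))"
  using assms(3,4)
proof (induction k arbitrary: f g)
  case 0
  then show ?case by (simp add: bounded_bilinear.continuous_on[OF assms(1)])
next
  case (Suc k)
  show ?case
  proof (rule Ck_on_SucI[OF \<open>open S\<close> bounded_bilinear.FDERIV[OF assms(1)
          Ck_on_SucD(1)[OF Suc.prems(1)] Ck_on_SucD(1)[OF Suc.prems(2)]]])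
    fix v
    show "Ck_on k S (\<lambda>x. m (f x) (frechet_derivative g (at x) v)
            + m (frechet_derivative f (at x) v) (g x))"
      using Suc.prems by (intro Ck_on_add \<open>open S\<close> Suc.IH Ck_on_Suc_imp[of k S f]
          Ck_on_Suc_imp[of k S g] Ck_on_SucD(2))
  qed
qed

lemma Ck_on_sum:
  assumes "open S" "\<And>i. i \<in> I \<Longrightarrow> Ck_on k S (f i)"
  shows "Ck_on k S (\<lambda>x. \<Sum>i\<in>I. f i x)"
  using assms(2)
  by (induction I rule: infinite_finite_induct) (auto intro: Ck_on_const Ck_on_add assms(1))

lemma Ck_on_compose_bounded_linear:
  assumes "bounded_linear h" "open S" "Ck_on k S f"
  shows "Ck_on k S (\<lambda>x. h (f x))"
  using assms(3)
proof (induction k arbitrary: f)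
  case 0
  then show ?case by (simp add: bounded_linear.continuous_on[OF assms(1)])
next
  case (Suc k)
  show ?case
    by (rule Ck_on_SucI[OF \<open>open S\<close> bounded_linear.has_derivative[OF assms(1)
            Ck_on_SucD(1)[OF Suc.prems]]])
      (use Suc.prems Suc.IH in \<open>simp_all\<close>)
qed

lemma linear_eq_sum_Basis:
  fixes h :: "'a::euclidean_space \<Rightarrow> 'b::real_vector"
  assumes "linear h"
  shows "h v = (\<Sum>i\<in>Basis. (v \<bullet> i) *\<^sub>R h i)"
proof -
  have "h v = h (\<Sum>i\<in>Basis. (v \<bullet> i) *\<^sub>R i)" by (simp add: euclidean_representation)
  also have "\<dots> = (\<Sum>i\<in>Basis. (v \<bullet> i) *\<^sub>R h i)"
    by (simp add: linear_sum[OF assms] linear_scale[OF assms])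
  finally show ?thesis .
qed

text \<open>The chain rule gives the derivative of \<open>f \<circ> g\<close> in a fixed direction as a sum over a
  basis of products of components of the derivative of \<open>g\<close> with partial derivatives of \<open>f\<close> along
  \<open>g\<close>, so that induction on the order applies to the latter.\<close>

lemma Ck_on_compose:
  fixes g :: "'a::euclidean_space \<Rightarrow> 'c::euclidean_space" and f :: "'c \<Rightarrow> 'b::real_normed_vector"
  assumes "open S" "Ck_on k T f" "Ck_on k S g" "g ` S \<subseteq> T"
  shows "Ck_on k S (\<lambda>x. f (g x))"
  using assms(2,3)
proof (induction k arbitrary: f)
  case 0
  then show ?case using assms(4) continuous_on_compose2 by auto
next
  case (Suc k)
  have f: "f differentiable (at (g x))" if "x \<in> S" for x
    using Suc.prems(1) that assms(4) by auto
  show ?case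
  proof (rule Ck_on_SucI[OF \<open>open S\<close>])
    show "((\<lambda>x. f (g x)) has_derivative
        (\<lambda>v. \<Sum>i\<in>Basis. (frechet_derivative g (at x) v \<bullet> i) *\<^sub>R frechet_derivative f (at (g x)) i))
        (at x)" if "x \<in> S" for x
    proof -
      have "((\<lambda>x. f (g x)) has_derivative
          (\<lambda>v. frechet_derivative f (at (g x)) (frechet_derivative g (at x) v))) (at x)"
        by (rule has_derivative_compose[OF Ck_on_SucD(1)[OF Suc.prems(2) that]])
          (use f[OF that] in \<open>simp only: frechet_derivative_works\<close>)
      then show ?thesis
        by (rule has_derivative_eq_rhs)
          (rule ext, rule linear_eq_sum_Basis[OF linear_frechet_derivative[OF f[OF that]]])
    qed
    show "Ck_on k S (\<lambda>x. \<Sum>i\<in>Basis. (frechet_derivative g (at x) v \<bullet> i) *\<^sub>R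
        frechet_derivative f (at (g x)) i)" for v
    proof (intro Ck_on_sum Ck_on_bounded_bilinear[OF bounded_bilinear_scaleR] \<open>open S\<close>)
      fix i :: 'c
      show "Ck_on k S (\<lambda>x. frechet_derivative g (at x) v \<bullet> i)"
        using Suc.prems(2)
        by (intro Ck_on_compose_bounded_linear[OF bounded_linear_inner_left \<open>open S\<close>] Ck_on_SucD(2))
      show "Ck_on k S (\<lambda>x. frechet_derivative f (at (g x)) i)"
        by (rule Suc.IH[OF Ck_on_SucD(2)[OF Suc.prems(1)] Ck_on_Suc_imp[OF Suc.prems(2)]])
    qed
  qed
qed

text \<open>Smoothness of a germ: the closure properties below then carry no side conditions on
  domains.\<close>

definition smooth_at :: "'a::euclidean_space \<Rightarrow> ('a \<Rightarrow> 'b::real_normed_vector) \<Rightarrow> bool" where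
  "smooth_at x f \<longleftrightarrow> (\<exists>S. open S \<and> x \<in> S \<and> smooth_on S f)"

lemma smooth_on_iff_smooth_at: "open S \<Longrightarrow> smooth_on S f \<longleftrightarrow> (\<forall>x\<in>S. smooth_at x f)"
  unfolding smooth_on_def smooth_at_def by (meson Ck_on_local)

lemma smooth_at_cong:
  assumes "smooth_at x f" "\<forall>\<^sub>F y in nhds x. f y = g y"
  shows "smooth_at x g"
proof -
  obtain S where S: "open S" "x \<in> S" "smooth_on S f" using assms(1) unfolding smooth_at_def by blast
  obtain T where T: "open T" "x \<in> T" "\<forall>y\<in>T. f y = g y"
    using assms(2) unfolding eventually_nhds by blast
  have "smooth_on (S \<inter> T) g"
    unfolding smooth_on_def
  proof
    fix k
    show "Ck_on k (S \<inter> T) g"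
      by (rule Ck_on_cong[of _ f]) (use S T in \<open>auto simp: smooth_on_def intro: Ck_on_subset\<close>)
  qed
  with S T show ?thesis unfolding smooth_at_def by blast
qed

lemma smooth_at_eventually: "smooth_at x f \<Longrightarrow> \<forall>\<^sub>F y in nhds x. smooth_at y f"
  unfolding smooth_at_def eventually_nhds by blast

lemma smooth_at_differentiable: "smooth_at x f \<Longrightarrow> f differentiable (at x)"
  unfolding smooth_at_def smooth_on_def using Ck_on.simps(2) by blast

lemma smooth_at_has_derivative:
  "smooth_at x f \<Longrightarrow> (f has_derivative frechet_derivative f (at x)) (at x)"
  using smooth_at_differentiable frechet_derivative_works by blast

lemma smooth_at_isCont: "smooth_at x f \<Longrightarrow> isCont f x"
  using smooth_at_differentiable differentiable_imp_continuous_within by blast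

lemma smooth_at_bounded_linear: "bounded_linear f \<Longrightarrow> smooth_at x f"
  unfolding smooth_at_def smooth_on_def using Ck_on_bounded_linear by blast

lemma smooth_at_const: "smooth_at x (\<lambda>y. c)"
  unfolding smooth_at_def smooth_on_def using Ck_on_const by blast

lemma smooth_at_frechet_derivative:
  assumes "smooth_at x f" shows "smooth_at x (\<lambda>y. frechet_derivative f (at y) v)"
  using assms unfolding smooth_at_def smooth_on_def using Ck_on.simps(2) by blast

lemma smooth_at_common_nhd:
  assumes "smooth_at x f" "smooth_at x g"
  obtains S where "open S" "x \<in> S" "smooth_on S f" "smooth_on S g"
proof -
  obtain S where S: "open S" "x \<in> S" "smooth_on S f" using assms(1) unfolding smooth_at_def by blast
  obtain T where T: "open T" "x \<in> T" "smooth_on T g" using assms(2) unfolding smooth_at_def by blast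
  show ?thesis
    by (rule that[of "S \<inter> T"]) (use S T in \<open>auto simp: smooth_on_def intro: Ck_on_subset\<close>)
qed

lemma smooth_at_add:
  assumes "smooth_at x f" "smooth_at x g" shows "smooth_at x (\<lambda>y. f y + g y)"
proof -
  obtain S where "open S" "x \<in> S" "smooth_on S f" "smooth_on S g"
    using smooth_at_common_nhd[OF assms] .
  then have "smooth_on S (\<lambda>y. f y + g y)"
    using Ck_on_add unfolding smooth_on_def by blast
  with \<open>open S\<close> \<open>x \<in> S\<close> show ?thesis unfolding smooth_at_def by blast
qed

lemma smooth_at_bounded_bilinear:
  assumes "bounded_bilinear m" "smooth_at x f" "smooth_at x g"
  shows "smooth_at x (\<lambda>y. m (f y) (g y))"
proof -
  obtain S where "open S" "x \<in> S" "smooth_on S f" "smooth_on S g"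
    using smooth_at_common_nhd[OF assms(2,3)] .
  then have "smooth_on S (\<lambda>y. m (f y) (g y))"
    using Ck_on_bounded_bilinear[OF assms(1)] unfolding smooth_on_def by blast
  with \<open>open S\<close> \<open>x \<in> S\<close> show ?thesis unfolding smooth_at_def by blast
qed

lemma smooth_at_sum:
  "(\<And>i. i \<in> I \<Longrightarrow> smooth_at x (f i)) \<Longrightarrow> smooth_at x (\<lambda>y. \<Sum>i\<in>I. f i y)"
  by (induction I rule: infinite_finite_induct) (auto intro: smooth_at_const smooth_at_add)

lemma smooth_at_compose:
  fixes g :: "'a::euclidean_space \<Rightarrow> 'c::euclidean_space" and f :: "'c \<Rightarrow> 'b::real_normed_vector"
  assumes "smooth_at (g x) f" "smooth_at x g"
  shows "smooth_at x (\<lambda>y. f (g y))"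
proof -
  obtain T where T: "open T" "g x \<in> T" "smooth_on T f"
    using assms(1) unfolding smooth_at_def by blast
  obtain S where S: "open S" "x \<in> S" "smooth_on S g"
    using assms(2) unfolding smooth_at_def by blast
  have "continuous_on S g" using S(3) Ck_on.simps(1) unfolding smooth_on_def by blast
  then have op: "open (S \<inter> g -` T)"
    using S(1) T(1) by (simp add: continuous_on_open_vimage Int_commute)
  have "smooth_on (S \<inter> g -` T) (\<lambda>y. f (g y))"
    unfolding smooth_on_def
  proof
    fix k
    show "Ck_on k (S \<inter> g -` T) (\<lambda>y. f (g y))"
      by (rule Ck_on_compose[where T = T]) (use S T op in \<open>auto simp: smooth_on_def intro: Ck_on_subset\<close>)
  qed
  with op S T show ?thesis unfolding smooth_at_def by blast
qed

lemma smooth_at_componentwise: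
  fixes f :: "'a::euclidean_space \<Rightarrow> 'b::euclidean_space"
  assumes "\<And>i. i \<in> Basis \<Longrightarrow> smooth_at x (\<lambda>y. f y \<bullet> i)"
  shows "smooth_at x f"
proof -
  have "smooth_at x (\<lambda>y. \<Sum>i\<in>Basis. (f y \<bullet> i) *\<^sub>R i)"
    by (intro smooth_at_sum smooth_at_bounded_bilinear[OF bounded_bilinear_scaleR]
        assms smooth_at_const)
  then show ?thesis by (simp add: euclidean_representation)
qed

lemma smooth_at_Pair:
  fixes f :: "'a::euclidean_space \<Rightarrow> 'b::euclidean_space" and g :: "'a \<Rightarrow> 'c::euclidean_space"
  assumes "smooth_at x f" "smooth_at x g"
  shows "smooth_at x (\<lambda>y. (f y, g y))"
proof -
  have 1: "smooth_at x (\<lambda>y. (f y, 0 :: 'c))"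
    by (rule smooth_at_compose[OF _ assms(1)])
      (auto intro!: smooth_at_bounded_linear bounded_linear_Pair bounded_linear_ident bounded_linear_zero)
  have 2: "smooth_at x (\<lambda>y. (0 :: 'b, g y))"
    by (rule smooth_at_compose[OF _ assms(2)])
      (auto intro!: smooth_at_bounded_linear bounded_linear_Pair bounded_linear_ident bounded_linear_zero)
  show ?thesis using smooth_at_add[OF 1 2] by simp
qed

text \<open>Both the base point and the direction of the derivative may vary. The directional derivative is
  expanded in a basis, because smoothness is defined through derivatives in fixed directions.\<close>

lemma smooth_at_derivative_along:
  fixes f :: "'a::euclidean_space \<Rightarrow> 'b::real_normed_vector"
    and h w :: "'c::euclidean_space \<Rightarrow> 'a"
  assumes "smooth_at (h x) f" "smooth_at x h" "smooth_at x w"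
  shows "smooth_at x (\<lambda>y. frechet_derivative f (at (h y)) (w y))"
proof (rule smooth_at_cong)
  show "smooth_at x (\<lambda>y. \<Sum>i\<in>Basis. (w y \<bullet> i) *\<^sub>R frechet_derivative f (at (h y)) i)"
    by (intro smooth_at_sum smooth_at_bounded_bilinear[OF bounded_bilinear_scaleR]
        smooth_at_compose[of h x "\<lambda>z. frechet_derivative f (at z) _"]
        smooth_at_compose[of w x "\<lambda>z. z \<bullet> _"] smooth_at_frechet_derivative assms
        smooth_at_bounded_linear bounded_linear_inner_left)
  have "\<forall>\<^sub>F y in nhds x. smooth_at (h y) f"
    using smooth_at_eventually[OF assms(1)] smooth_at_isCont[OF assms(2)]
    by (auto intro: eventually_compose_filterlim simp: isCont_def tendsto_at_iff_tendsto_nhds)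
  then show "\<forall>\<^sub>F y in nhds x. (\<Sum>i\<in>Basis. (w y \<bullet> i) *\<^sub>R frechet_derivative f (at (h y)) i)
      = frechet_derivative f (at (h y)) (w y)"
    by (rule eventually_mono)
      (metis linear_eq_sum_Basis linear_frechet_derivative smooth_at_differentiable)
qed

section \<open>Germs of smooth functions on a manifold\<close>

lemma is_chartD:
  assumes "is_chart (U, \<phi>)"
  shows "open U" "open (\<phi> ` U)" "inj_on \<phi> U" "continuous_on U \<phi>"
    "p \<in> U \<Longrightarrow> inv_into U \<phi> (\<phi> p) = p"
proof -
  have h: "homeomorphism U (\<phi> ` U) \<phi> (inv_into U \<phi>)" and o: "open U" "open (\<phi> ` U)"
    using assms by (auto simp: is_chart_def)
  show "open U" "open (\<phi> ` U)" by (fact o)+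
  show "continuous_on U \<phi>" using h by (rule homeomorphism_cont1)
  show inj: "inj_on \<phi> U" using h by (metis homeomorphism_def inj_on_inverseI)
  show "p \<in> U \<Longrightarrow> inv_into U \<phi> (\<phi> p) = p" using inj by simp
qed

lemma open_chart_image:
  assumes "is_chart (U, \<phi>)" "open W" shows "open (\<phi> ` (U \<inter> W))"
proof -
  have h: "homeomorphism U (\<phi> ` U) \<phi> (inv_into U \<phi>)" and o: "open U" "open (\<phi> ` U)"
    using assms(1) by (auto simp: is_chart_def)
  have "openin (top_of_set U) (U \<inter> W)" using assms(2) by (simp add: openin_open_Int)
  then have "openin (top_of_set (\<phi> ` U)) (\<phi> ` (U \<inter> W))"
    by (rule homeomorphism_imp_open_map[OF h])
  then show ?thesis using o(2) openin_open_trans by blast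
qed

lemma eventually_in_chart: "is_chart (U, \<phi>) \<Longrightarrow> p \<in> U \<Longrightarrow> \<forall>\<^sub>F q in nhds p. q \<in> U"
  using is_chartD(1) eventually_nhds_in_open by blast

text \<open>A chart is a homeomorphism onto an open set, so it identifies neighbourhoods of a point
  with neighbourhoods of its coordinates.\<close>

lemma eventually_nhds_chart:
  assumes c: "is_chart (U, \<phi>)" and p: "p \<in> U" and ev: "\<forall>\<^sub>F q in nhds p. q \<in> U \<longrightarrow> P (\<phi> q)"
  shows "\<forall>\<^sub>F y in nhds (\<phi> p). P y"
proof -
  obtain W where "open W" "p \<in> W" "\<forall>q\<in>W. q \<in> U \<longrightarrow> P (\<phi> q)"
    using ev unfolding eventually_nhds by blast
  with open_chart_image[OF c] p show ?thesis
    unfolding eventually_nhds by (intro exI[of _ "\<phi> ` (U \<inter> W)"]) auto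
qed

lemma chart_eventually_nhds:
  fixes \<phi> :: "'m::t2_space \<Rightarrow> 'e::euclidean_space"
  assumes c: "is_chart (U, \<phi>)" and p: "p \<in> U" and ev: "\<forall>\<^sub>F y in nhds (\<phi> p). P y"
  shows "\<forall>\<^sub>F q in nhds p. P (\<phi> q)"
proof -
  have "isCont \<phi> p"
    using is_chartD(1,4)[OF c] p continuous_on_eq_continuous_at by blast
  then have "filterlim \<phi> (nhds (\<phi> p)) (nhds p)" by (simp add: isCont_def tendsto_at_iff_tendsto_nhds)
  then show ?thesis by (rule eventually_compose_filterlim[OF ev])
qed

lemma chart_at:
  assumes "smooth_atlas \<A>" obtains U \<phi> where "(U, \<phi>) \<in> \<A>" "p \<in> U"
proof -
  have "p \<in> (\<Union>c\<in>\<A>. fst c)" using assms unfolding smooth_atlas_def by blast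
  then show ?thesis using that by (metis UN_E prod.collapse)
qed

lemma atlas_is_chart: "smooth_atlas \<A> \<Longrightarrow> (U, \<phi>) \<in> \<A> \<Longrightarrow> is_chart (U, \<phi>)"
  by (auto simp: smooth_atlas_def)

lemma smooth_transition:
  assumes A: "smooth_atlas \<A>" and c: "(U, \<phi>) \<in> \<A>" "p \<in> U" and d: "(V, \<psi>) \<in> \<A>" "p \<in> V"
  shows "smooth_at (\<phi> p) (\<psi> \<circ> inv_into U \<phi>)"
proof -
  have "compatible_charts (U, \<phi>) (V, \<psi>)"
    using A c(1) d(1) unfolding smooth_atlas_def by blast
  then have "smooth_on (\<phi> ` (U \<inter> V)) (\<psi> \<circ> inv_into U \<phi>)" by (simp add: compatible_charts_def)
  moreover have "open (\<phi> ` (U \<inter> V))"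
    using open_chart_image atlas_is_chart[OF A] is_chartD(1) c(1) d(1) by blast
  ultimately show ?thesis
    using c(2) d(2) unfolding smooth_at_def by blast
qed

text \<open>This reduces statements about functions on open sets to statements about germs, in which the
  open set no longer occurs.\<close>

lemma smooth_fun_on_iff_smooth_near:
  assumes A: "smooth_atlas \<A>" and W: "open W"
  shows "smooth_fun_on \<A> W f \<longleftrightarrow> (\<forall>p\<in>W. smooth_near \<A> p f)"
proof
  show "smooth_fun_on \<A> W f \<Longrightarrow> \<forall>p\<in>W. smooth_near \<A> p f"
    using W by (auto simp: smooth_near_def)
next
  assume near: "\<forall>p\<in>W. smooth_near \<A> p f"
  show "smooth_fun_on \<A> W f"
    unfolding smooth_fun_on_def
  proof (clarify)
    fix U \<phi> assume c: "(U, \<phi>) \<in> \<A>"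
    note ch = atlas_is_chart[OF A c]
    have "smooth_at (\<phi> p) (f \<circ> inv_into U \<phi>)" if p: "p \<in> U \<inter> W" for p
    proof -
      obtain W' where "open W'" "p \<in> W'" "smooth_on (\<phi> ` (U \<inter> W')) (f \<circ> inv_into U \<phi>)"
        using near p c unfolding smooth_near_def smooth_fun_on_def by blast
      then show ?thesis
        using open_chart_image[OF ch] p unfolding smooth_at_def by blast
    qed
    then show "smooth_on (\<phi> ` (U \<inter> W)) (f \<circ> inv_into U \<phi>)"
      by (simp add: smooth_on_iff_smooth_at open_chart_image[OF ch W])
  qed
qed

text \<open>Smoothness near a point may be tested in a single chart, because the transition maps to all
  other charts are smooth.\<close>

lemma smooth_near_iff_chart:
  assumes A: "smooth_atlas \<A>" and c: "(U, \<phi>) \<in> \<A>" "p \<in> U"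
  shows "smooth_near \<A> p f \<longleftrightarrow> smooth_at (\<phi> p) (f \<circ> inv_into U \<phi>)"
proof
  assume "smooth_near \<A> p f"
  then obtain W where "open W" "p \<in> W" "smooth_on (\<phi> ` (U \<inter> W)) (f \<circ> inv_into U \<phi>)"
    using c(1) unfolding smooth_near_def smooth_fun_on_def by blast
  then show "smooth_at (\<phi> p) (f \<circ> inv_into U \<phi>)"
    using open_chart_image[OF atlas_is_chart[OF A c(1)]] c(2) unfolding smooth_at_def by blast
next
  assume sm: "smooth_at (\<phi> p) (f \<circ> inv_into U \<phi>)"
  note ch = atlas_is_chart[OF A c(1)]
  have "\<forall>\<^sub>F q in nhds p. q \<in> U \<and> smooth_at (\<phi> q) (f \<circ> inv_into U \<phi>)"
    using chart_eventually_nhds[OF ch c(2) smooth_at_eventually[OF sm]]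
      eventually_in_chart[OF ch c(2)] by eventually_elim simp
  then obtain W where W: "open W" "p \<in> W"
      "\<And>q. q \<in> W \<Longrightarrow> q \<in> U \<and> smooth_at (\<phi> q) (f \<circ> inv_into U \<phi>)"
    unfolding eventually_nhds by blast
  have "smooth_on (\<psi> ` (V \<inter> W)) (f \<circ> inv_into V \<psi>)" if d: "(V, \<psi>) \<in> \<A>" for V \<psi>
  proof -
    note dh = atlas_is_chart[OF A d]
    have "smooth_at (\<psi> q) (f \<circ> inv_into V \<psi>)" if q: "q \<in> V \<inter> W" for q
    proof (rule smooth_at_cong)
      show "smooth_at (\<psi> q) (\<lambda>y. (f \<circ> inv_into U \<phi>) ((\<phi> \<circ> inv_into V \<psi>) y))"
      proof (rule smooth_at_compose[of "\<phi> \<circ> inv_into V \<psi>" _ "f \<circ> inv_into U \<phi>"])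
        show "smooth_at (\<psi> q) (\<phi> \<circ> inv_into V \<psi>)"
          using smooth_transition[OF A d _ c(1)] q W(3) by blast
        show "smooth_at ((\<phi> \<circ> inv_into V \<psi>) (\<psi> q)) (f \<circ> inv_into U \<phi>)"
          using q W(3) is_chartD(5)[OF dh] by simp
      qed
      have "\<forall>\<^sub>F r in nhds q. r \<in> W" using q W(1) by (simp add: eventually_nhds_in_open)
      then show "\<forall>\<^sub>F y in nhds (\<psi> q).
          (f \<circ> inv_into U \<phi>) ((\<phi> \<circ> inv_into V \<psi>) y) = (f \<circ> inv_into V \<psi>) y"
        using q W(3) is_chartD(5)[OF dh] is_chartD(5)[OF ch]
        by (intro eventually_nhds_chart[OF dh]) (auto elim: eventually_mono)
    qed
    then show ?thesis by (simp add: smooth_on_iff_smooth_at open_chart_image[OF dh W(1)])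
  qed
  then have "smooth_fun_on \<A> W f" unfolding smooth_fun_on_def by blast
  with W show "smooth_near \<A> p f" unfolding smooth_near_def by blast
qed

lemma smooth_near_eventually: "smooth_near \<A> p f \<Longrightarrow> \<forall>\<^sub>F q in nhds p. smooth_near \<A> q f"
  unfolding smooth_near_def eventually_nhds by blast

lemma smooth_near_cong:
  assumes A: "smooth_atlas \<A>" and f: "smooth_near \<A> p f" and eq: "\<forall>\<^sub>F q in nhds p. f q = g q"
  shows "smooth_near \<A> p g"
proof -
  obtain U \<phi> where c: "(U, \<phi>) \<in> \<A>" "p \<in> U" using chart_at[OF A] .
  note ch = atlas_is_chart[OF A c(1)]
  have "\<forall>\<^sub>F y in nhds (\<phi> p). (f \<circ> inv_into U \<phi>) y = (g \<circ> inv_into U \<phi>) y"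
    by (rule eventually_nhds_chart[OF ch c(2)])
      (use eq is_chartD(5)[OF ch] in \<open>auto elim: eventually_mono\<close>)
  with f show ?thesis
    unfolding smooth_near_iff_chart[OF A c] using smooth_at_cong by blast
qed

lemma smooth_near_const:
  assumes A: "smooth_atlas \<A>" shows "smooth_near \<A> p (\<lambda>q. k)"
proof -
  obtain U \<phi> where c: "(U, \<phi>) \<in> \<A>" "p \<in> U" using chart_at[OF A] .
  show ?thesis by (simp add: smooth_near_iff_chart[OF A c] smooth_at_const o_def)
qed

lemma smooth_near_add:
  assumes A: "smooth_atlas \<A>" and f: "smooth_near \<A> p f" "smooth_near \<A> p g"
  shows "smooth_near \<A> p (\<lambda>q. f q + g q)"
proof -
  obtain U \<phi> where c: "(U, \<phi>) \<in> \<A>" "p \<in> U" using chart_at[OF A] .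
  show ?thesis using f by (simp add: smooth_near_iff_chart[OF A c] smooth_at_add o_def)
qed

lemma smooth_near_mult:
  assumes A: "smooth_atlas \<A>" and f: "smooth_near \<A> p f" "smooth_near \<A> p g"
  shows "smooth_near \<A> p (\<lambda>q. f q * g q)"
proof -
  obtain U \<phi> where c: "(U, \<phi>) \<in> \<A>" "p \<in> U" using chart_at[OF A] .
  show ?thesis using f
    by (simp add: smooth_near_iff_chart[OF A c] o_def
        smooth_at_bounded_bilinear[OF bounded_bilinear_mult])
qed

lemma smooth_near_cmult:
  "smooth_atlas \<A> \<Longrightarrow> smooth_near \<A> p f \<Longrightarrow> smooth_near \<A> p (\<lambda>q. k * f q)"
  by (rule smooth_near_mult[OF _ smooth_near_const])

lemma smooth_near_diff:
  assumes "smooth_atlas \<A>" "smooth_near \<A> p f" "smooth_near \<A> p g"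
  shows "smooth_near \<A> p (\<lambda>q. f q - g q)"
  using smooth_near_add[OF assms(1,2) smooth_near_cmult[OF assms(1,3), of "-1"]] by simp

lemma smooth_near_sum:
  assumes A: "smooth_atlas \<A>" and f: "\<And>i. i \<in> I \<Longrightarrow> smooth_near \<A> p (f i)"
  shows "smooth_near \<A> p (\<lambda>q. \<Sum>i\<in>I. f i q)"
  using f
  by (induction I rule: infinite_finite_induct) (auto intro: smooth_near_const smooth_near_add A)

lemma smooth_near_coordinate:
  assumes A: "smooth_atlas \<A>" and c: "(U, \<phi>) \<in> \<A>" "p \<in> U"
  shows "smooth_near \<A> p (\<lambda>q. \<phi> q \<bullet> e)"
proof -
  note ch = atlas_is_chart[OF A c(1)]
  have "smooth_at (\<phi> p) (\<lambda>y. y \<bullet> e)"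
    by (intro smooth_at_bounded_linear bounded_linear_inner_left)
  moreover have "\<forall>\<^sub>F y in nhds (\<phi> p). y \<bullet> e = ((\<lambda>q. \<phi> q \<bullet> e) \<circ> inv_into U \<phi>) y"
    by (rule eventually_nhds_chart[OF ch c(2)]) (simp add: is_chartD(5)[OF ch])
  ultimately show ?thesis
    unfolding smooth_near_iff_chart[OF A c] by (rule smooth_at_cong)
qed


section \<open>Tangent vectors as derivations\<close>

lemma frechet_derivative_cong:
  fixes f g :: "'a::euclidean_space \<Rightarrow> 'b::real_normed_vector"
  assumes f: "f differentiable (at x)" and eq: "\<forall>\<^sub>F y in nhds x. f y = g y"
  shows "frechet_derivative g (at x) = frechet_derivative f (at x)"
proof -
  obtain T where T: "open T" "x \<in> T" "\<And>y. y \<in> T \<Longrightarrow> f y = g y"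
    using eq unfolding eventually_nhds by blast
  have "(g has_derivative frechet_derivative f (at x)) (at x)"
    using f[unfolded frechet_derivative_works] T
    by (rule has_derivative_transform_within_open)
  then show ?thesis by (rule frechet_derivative_at[symmetric])
qed

lemma coord_vector_apply:
  "smooth_near \<A> p f \<Longrightarrow>
     coord_vector \<A> (U, \<phi>) p w f = frechet_derivative (f \<circ> inv_into U \<phi>) (at (\<phi> p)) w"
  by (simp add: coord_vector_def)

text \<open>The pushforward of a coordinate vector, in charts of the source and of the target; the change
  of charts on a single manifold is the case of the identity map.\<close>

lemma coord_vector_compose:
  assumes A: "smooth_atlas \<A>" and B: "smooth_atlas \<B>"
    and c: "(U, \<phi>) \<in> \<A>" "p \<in> U" and d: "(V, \<psi>) \<in> \<B>" "F p \<in> V"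
    and F: "isCont F p" "smooth_at (\<phi> p) (\<psi> \<circ> F \<circ> inv_into U \<phi>)"
    and f: "smooth_near \<B> (F p) f"
  shows "smooth_near \<A> p (f \<circ> F)"
    and "coord_vector \<A> (U, \<phi>) p w (f \<circ> F) =
      coord_vector \<B> (V, \<psi>) (F p) (frechet_derivative (\<psi> \<circ> F \<circ> inv_into U \<phi>) (at (\<phi> p)) w) f"
proof -
  note ch = atlas_is_chart[OF A c(1)] and dh = atlas_is_chart[OF B d(1)]
  let ?T = "\<psi> \<circ> F \<circ> inv_into U \<phi>" and ?f = "f \<circ> inv_into V \<psi>"
  have T: "?T (\<phi> p) = \<psi> (F p)" using is_chartD(5)[OF ch c(2)] by simp
  have f': "smooth_at (?T (\<phi> p)) ?f"
    using f T smooth_near_iff_chart[OF B d] by simp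
  have "filterlim F (nhds (F p)) (nhds p)"
    using F(1) by (simp add: isCont_def tendsto_at_iff_tendsto_nhds)
  then have "\<forall>\<^sub>F q in nhds p. F q \<in> V"
    by (rule eventually_compose_filterlim[OF eventually_in_chart[OF dh d(2)]])
  then have "\<forall>\<^sub>F q in nhds p. q \<in> U \<longrightarrow> ?f (?T (\<phi> q)) = (f \<circ> F \<circ> inv_into U \<phi>) (\<phi> q)"
    using is_chartD(5)[OF ch] is_chartD(5)[OF dh] by (auto elim!: eventually_mono)
  then have eq: "\<forall>\<^sub>F y in nhds (\<phi> p). ?f (?T y) = (f \<circ> F \<circ> inv_into U \<phi>) y"
    by (rule eventually_nhds_chart[OF ch c(2)])
  have comp: "smooth_at (\<phi> p) (\<lambda>y. ?f (?T y))"
    by (rule smooth_at_compose[of ?T _ ?f, OF f' F(2)])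
  then show sm: "smooth_near \<A> p (f \<circ> F)"
    unfolding smooth_near_iff_chart[OF A c] using eq by (rule smooth_at_cong)
  have "((\<lambda>y. ?f (?T y)) has_derivative
      (\<lambda>w. frechet_derivative ?f (at (?T (\<phi> p))) (frechet_derivative ?T (at (\<phi> p)) w))) (at (\<phi> p))"
    by (rule has_derivative_compose[OF smooth_at_has_derivative[OF F(2)]
          smooth_at_has_derivative[OF f']])
  from frechet_derivative_at[OF this]
  have "frechet_derivative (f \<circ> F \<circ> inv_into U \<phi>) (at (\<phi> p)) w
      = frechet_derivative ?f (at (?T (\<phi> p))) (frechet_derivative ?T (at (\<phi> p)) w)"
    using frechet_derivative_cong[OF smooth_at_differentiable[OF comp] eq] by metis
  then show "coord_vector \<A> (U, \<phi>) p w (f \<circ> F)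
      = coord_vector \<B> (V, \<psi>) (F p) (frechet_derivative ?T (at (\<phi> p)) w) f"
    using f sm T by (simp add: coord_vector_apply)
qed

lemma coord_vector_change_chart:
  assumes A: "smooth_atlas \<A>" and c: "(U, \<phi>) \<in> \<A>" "p \<in> U" and d: "(V, \<psi>) \<in> \<A>" "p \<in> V"
  shows "coord_vector \<A> (U, \<phi>) p w =
    coord_vector \<A> (V, \<psi>) p (frechet_derivative (\<psi> \<circ> inv_into U \<phi>) (at (\<phi> p)) w)"
proof
  fix f
  show "coord_vector \<A> (U, \<phi>) p w f =
    coord_vector \<A> (V, \<psi>) p (frechet_derivative (\<psi> \<circ> inv_into U \<phi>) (at (\<phi> p)) w) f"
  proof (cases "smooth_near \<A> p f")
    case True
    then show ?thesis
      using coord_vector_compose(2)[OF A A c d(1), of "\<lambda>x. x" f w] d(2)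
        smooth_transition[OF A c d] by (simp add: o_def)
  qed (simp add: coord_vector_def)
qed

lemma tangent_space_eq_range:
  assumes A: "smooth_atlas \<A>" and c: "(U, \<phi>) \<in> \<A>" "p \<in> U"
  shows "tangent_space \<A> p = range (coord_vector \<A> (U, \<phi>) p)"
proof (intro equalityI subsetI)
  fix v assume "v \<in> tangent_space \<A> p"
  then obtain V \<psi> w where "(V, \<psi>) \<in> \<A>" "p \<in> V" "v = coord_vector \<A> (V, \<psi>) p w"
    by (auto simp: tangent_space_def)
  then show "v \<in> range (coord_vector \<A> (U, \<phi>) p)"
    using coord_vector_change_chart[OF A _ _ c] by blast
qed (use c in \<open>force simp: tangent_space_def\<close>)

lemma linear_coord_vector:
  assumes A: "smooth_atlas \<A>" and c: "(U, \<phi>) \<in> \<A>" "p \<in> U"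
  shows "linear (coord_vector \<A> (U, \<phi>) p)"
proof -
  have "linear (frechet_derivative (f \<circ> inv_into U \<phi>) (at (\<phi> p)))" if "smooth_near \<A> p f" for f
    using that smooth_near_iff_chart[OF A c] smooth_at_differentiable linear_frechet_derivative
    by blast
  then show ?thesis
    by (intro linearI ext)
      (auto simp: coord_vector_def plus_fun_def scaleR_fun_def linear_add linear_scale)
qed

lemma subspace_tangent_space:
  assumes A: "smooth_atlas \<A>" shows "subspace (tangent_space \<A> p)"
proof -
  obtain U \<phi> where c: "(U, \<phi>) \<in> \<A>" "p \<in> U" using chart_at[OF A] .
  show ?thesis unfolding tangent_space_eq_range[OF A c]
    by (rule linear_subspace_image[OF linear_coord_vector[OF A c] subspace_UNIV])
qed

text \<open>Explicit coordinates of a tangent vector, used to differentiate along vectors that depend on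
  a parameter: the coordinates of \<open>X p\<close> are values of \<open>X p\<close> on functions and so vary smoothly
  when \<open>X\<close> is a smooth field.\<close>

lemma tangent_vector_coordinates:
  assumes A: "smooth_atlas \<A>" and c: "(U, \<phi>) \<in> \<A>" "p \<in> U" and v: "v \<in> tangent_space \<A> p"
  shows "v = coord_vector \<A> (U, \<phi>) p (\<Sum>e\<in>Basis. v (\<lambda>q. \<phi> q \<bullet> e) *\<^sub>R e)"
proof -
  note ch = atlas_is_chart[OF A c(1)]
  obtain w where w: "v = coord_vector \<A> (U, \<phi>) p w"
    using v unfolding tangent_space_eq_range[OF A c] by blast
  have "v (\<lambda>q. \<phi> q \<bullet> e) = w \<bullet> e" for e
  proof -
    have lin: "bounded_linear (\<lambda>y::'b. y \<bullet> e)" by (rule bounded_linear_inner_left)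
    have "\<forall>\<^sub>F y in nhds (\<phi> p). y \<bullet> e = ((\<lambda>q. \<phi> q \<bullet> e) \<circ> inv_into U \<phi>) y"
      by (rule eventually_nhds_chart[OF ch c(2)]) (simp add: is_chartD(5)[OF ch])
    from frechet_derivative_cong[OF bounded_linear_imp_differentiable[OF lin] this]
    have "frechet_derivative ((\<lambda>q. \<phi> q \<bullet> e) \<circ> inv_into U \<phi>) (at (\<phi> p)) = (\<lambda>y. y \<bullet> e)"
      using frechet_derivative_at[OF bounded_linear_imp_has_derivative[OF lin]] by metis
    then show ?thesis
      unfolding w by (simp add: coord_vector_apply[OF smooth_near_coordinate[OF A c]])
  qed
  then show ?thesis by (simp add: w euclidean_representation)
qed

text \<open>Tangent vectors act as derivations of germs. As a vector vanishes on functions that are not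
  smooth near its base point, \<open>tangent_vector_cong\<close> holds for arbitrary functions.\<close>

context
  fixes \<A> :: "('m::{t2_space,second_countable_topology}, 'e::euclidean_space) chart set" and p v
  assumes A: "smooth_atlas \<A>" and v: "v \<in> tangent_space \<A> p"
begin

lemma tangent_vector_not_smooth: "\<not> smooth_near \<A> p f \<Longrightarrow> v f = 0"
  using v by (auto simp: tangent_space_def coord_vector_def)

lemma tangent_vector_chart:
  obtains U \<phi> w where "(U, \<phi>) \<in> \<A>" "p \<in> U"
    "\<And>f. smooth_near \<A> p f \<Longrightarrow> v f = frechet_derivative (f \<circ> inv_into U \<phi>) (at (\<phi> p)) w"
    "\<And>f. smooth_near \<A> p f \<Longrightarrow> (f \<circ> inv_into U \<phi>) differentiable (at (\<phi> p))"
proof -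
  obtain U \<phi> w where c: "(U, \<phi>) \<in> \<A>" "p \<in> U" "v = coord_vector \<A> (U, \<phi>) p w"
    using v by (auto simp: tangent_space_def)
  show ?thesis
    by (rule that[OF c(1,2), of w])
      (auto simp: c(3) coord_vector_apply smooth_near_iff_chart[OF A c(1,2)] smooth_at_differentiable)
qed

lemma tangent_vector_cong:
  assumes eq: "\<forall>\<^sub>F q in nhds p. f q = g q"
  shows "v f = v g"
proof (cases "smooth_near \<A> p f")
  case True
  obtain U \<phi> w where c: "(U, \<phi>) \<in> \<A>" "p \<in> U"
    and vf: "\<And>f. smooth_near \<A> p f \<Longrightarrow> v f = frechet_derivative (f \<circ> inv_into U \<phi>) (at (\<phi> p)) w"
    and df: "\<And>f. smooth_near \<A> p f \<Longrightarrow> (f \<circ> inv_into U \<phi>) differentiable (at (\<phi> p))"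
    using tangent_vector_chart by blast
  note ch = atlas_is_chart[OF A c(1)]
  have "\<forall>\<^sub>F y in nhds (\<phi> p). (f \<circ> inv_into U \<phi>) y = (g \<circ> inv_into U \<phi>) y"
    by (rule eventually_nhds_chart[OF ch c(2)])
      (use eq is_chartD(5)[OF ch] in \<open>auto elim: eventually_mono\<close>)
  then show ?thesis
    using frechet_derivative_cong df[OF True] vf[OF True] vf[OF smooth_near_cong[OF A True eq]]
    by metis
next
  case False
  have "\<forall>\<^sub>F q in nhds p. g q = f q" using eq by (auto elim: eventually_mono)
  then have "\<not> smooth_near \<A> p g" using False smooth_near_cong[OF A] by blast
  with False show ?thesis by (simp add: tangent_vector_not_smooth)
qed

lemma tangent_vector_add:
  assumes "smooth_near \<A> p f" "smooth_near \<A> p g"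
  shows "v (\<lambda>q. f q + g q) = v f + v g"
proof -
  obtain U \<phi> w where c: "(U, \<phi>) \<in> \<A>" "p \<in> U"
    and vf: "\<And>f. smooth_near \<A> p f \<Longrightarrow> v f = frechet_derivative (f \<circ> inv_into U \<phi>) (at (\<phi> p)) w"
    and df: "\<And>f. smooth_near \<A> p f \<Longrightarrow> (f \<circ> inv_into U \<phi>) differentiable (at (\<phi> p))"
    using tangent_vector_chart by blast
  have "((\<lambda>q. f q + g q) \<circ> inv_into U \<phi> has_derivative
      (\<lambda>w. frechet_derivative (f \<circ> inv_into U \<phi>) (at (\<phi> p)) w
         + frechet_derivative (g \<circ> inv_into U \<phi>) (at (\<phi> p)) w)) (at (\<phi> p))"
    using has_derivative_add[OF df[OF assms(1), unfolded frechet_derivative_works]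
        df[OF assms(2), unfolded frechet_derivative_works]] by (simp only: o_def)
  from frechet_derivative_at[OF this, symmetric] show ?thesis
    by (simp add: vf assms smooth_near_add[OF A])
qed

lemma tangent_vector_mult:
  assumes "smooth_near \<A> p f" "smooth_near \<A> p g"
  shows "v (\<lambda>q. f q * g q) = f p * v g + v f * g p"
proof -
  obtain U \<phi> w where c: "(U, \<phi>) \<in> \<A>" "p \<in> U"
    and vf: "\<And>f. smooth_near \<A> p f \<Longrightarrow> v f = frechet_derivative (f \<circ> inv_into U \<phi>) (at (\<phi> p)) w"
    and df: "\<And>f. smooth_near \<A> p f \<Longrightarrow> (f \<circ> inv_into U \<phi>) differentiable (at (\<phi> p))"
    using tangent_vector_chart by blast
  let ?f = "f \<circ> inv_into U \<phi>" and ?g = "g \<circ> inv_into U \<phi>"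
  have "((\<lambda>y. ?f y * ?g y) has_derivative
      (\<lambda>w. ?f (\<phi> p) * frechet_derivative ?g (at (\<phi> p)) w
         + frechet_derivative ?f (at (\<phi> p)) w * ?g (\<phi> p))) (at (\<phi> p))"
    by (rule has_derivative_mult[OF df[OF assms(1), unfolded frechet_derivative_works]
        df[OF assms(2), unfolded frechet_derivative_works]])
  from frechet_derivative_at[OF this, symmetric]
  have "frechet_derivative ((\<lambda>q. f q * g q) \<circ> inv_into U \<phi>) (at (\<phi> p)) w
      = f p * frechet_derivative ?g (at (\<phi> p)) w + frechet_derivative ?f (at (\<phi> p)) w * g p"
    using is_chartD(5)[OF atlas_is_chart[OF A c(1)] c(2)] by (simp add: comp_def)
  then show ?thesis
    by (simp add: vf assms smooth_near_mult[OF A])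
qed

lemma tangent_vector_const: "v (\<lambda>q. k) = 0"
proof -
  obtain U \<phi> w where "(U, \<phi>) \<in> \<A>" "p \<in> U"
    and "\<And>f. smooth_near \<A> p f \<Longrightarrow> v f = frechet_derivative (f \<circ> inv_into U \<phi>) (at (\<phi> p)) w"
    and "\<And>f. smooth_near \<A> p f \<Longrightarrow> (f \<circ> inv_into U \<phi>) differentiable (at (\<phi> p))"
    using tangent_vector_chart by blast
  then show ?thesis by (simp add: smooth_near_const[OF A] o_def)
qed

lemma tangent_vector_cmult: "smooth_near \<A> p f \<Longrightarrow> v (\<lambda>q. k * f q) = k * v f"
  using tangent_vector_mult[OF smooth_near_const[OF A]] by (simp add: tangent_vector_const)

lemma tangent_vector_diff:
  assumes "smooth_near \<A> p f" "smooth_near \<A> p g"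
  shows "v (\<lambda>q. f q - g q) = v f - v g"
  using tangent_vector_add[OF assms(1) smooth_near_cmult[OF A assms(2), of "-1"]]
    tangent_vector_cmult[OF assms(2), of "-1"] by simp

lemma tangent_vector_sum:
  assumes "\<And>i. i \<in> I \<Longrightarrow> smooth_near \<A> p (f i)"
  shows "v (\<lambda>q. \<Sum>i\<in>I. f i q) = (\<Sum>i\<in>I. v (f i))"
  using assms
proof (induction I rule: infinite_finite_induct)
  case (insert i I)
  then show ?case
    using tangent_vector_add[of "f i" "\<lambda>q. \<Sum>i\<in>I. f i q"] by (simp add: smooth_near_sum[OF A])
qed (simp_all add: tangent_vector_const)

end

section \<open>Smooth maps, differentials and products\<close>

text \<open>Smooth maps characterised by their action on functions. This form composes without reference
  to charts, and it determines the maps in charts because coordinates are smooth functions.\<close>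

definition smooth_pullback ::
  "('m::{t2_space,second_countable_topology}, 'e::euclidean_space) chart set
   \<Rightarrow> ('n::{t2_space,second_countable_topology}, 'f::euclidean_space) chart set
   \<Rightarrow> ('m \<Rightarrow> 'n) \<Rightarrow> bool" where
  "smooth_pullback \<A> \<B> F \<longleftrightarrow>
     (\<forall>p. isCont F p \<and> (\<forall>f. smooth_near \<B> (F p) f \<longrightarrow> smooth_near \<A> p (f \<circ> F)))"

lemma smooth_pullbackD:
  assumes "smooth_pullback \<A> \<B> F"
  shows "isCont F p" "smooth_near \<B> (F p) f \<Longrightarrow> smooth_near \<A> p (f \<circ> F)"
  using assms by (auto simp: smooth_pullback_def)

lemma smooth_pullback_eventually:
  assumes "smooth_pullback \<A> \<B> F" "\<forall>\<^sub>F q in nhds (F p). P q"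
  shows "\<forall>\<^sub>F q in nhds p. P (F q)"
proof -
  have "filterlim F (nhds (F p)) (nhds p)"
    using smooth_pullbackD(1)[OF assms(1)] by (simp add: isCont_def tendsto_at_iff_tendsto_nhds)
  then show ?thesis by (rule eventually_compose_filterlim[OF assms(2)])
qed

lemma smooth_map_imp_smooth_pullback:
  assumes A: "smooth_atlas \<A>" and B: "smooth_atlas \<B>" and F: "smooth_map \<A> \<B> F"
  shows "smooth_pullback \<A> \<B> F"
  unfolding smooth_pullback_def
proof (intro allI conjI impI)
  fix p
  have cont: "continuous_on UNIV F" using F by (simp add: smooth_map_def)
  then show isc: "isCont F p" by (simp add: continuous_on_eq_continuous_at)
  fix f assume f: "smooth_near \<B> (F p) f"
  obtain U \<phi> where c: "(U, \<phi>) \<in> \<A>" "p \<in> U" using chart_at[OF A] .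
  obtain V \<psi> where d: "(V, \<psi>) \<in> \<B>" "F p \<in> V" using chart_at[OF B] .
  have "open (F -` V)"
    using cont is_chartD(1)[OF atlas_is_chart[OF B d(1)]] by (simp add: open_vimage)
  then have "open (\<phi> ` (U \<inter> F -` V))" by (rule open_chart_image[OF atlas_is_chart[OF A c(1)]])
  moreover have "smooth_on (\<phi> ` (U \<inter> F -` V)) (\<psi> \<circ> F \<circ> inv_into U \<phi>)"
    using F c(1) d(1) unfolding smooth_map_def by blast
  ultimately have "smooth_at (\<phi> p) (\<psi> \<circ> F \<circ> inv_into U \<phi>)"
    using c(2) d(2) unfolding smooth_at_def by blast
  then show "smooth_near \<A> p (f \<circ> F)"
    by (rule coord_vector_compose(1)[OF A B c d isc _ f])
qed

lemma smooth_pullback_in_charts: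
  assumes A: "smooth_atlas \<A>" and B: "smooth_atlas \<B>" and F: "smooth_pullback \<A> \<B> F"
    and c: "(U, \<phi>) \<in> \<A>" "p \<in> U" and d: "(V, \<psi>) \<in> \<B>" "F p \<in> V"
  shows "smooth_at (\<phi> p) (\<psi> \<circ> F \<circ> inv_into U \<phi>)"
proof (rule smooth_at_componentwise)
  fix e
  have "smooth_near \<A> p ((\<lambda>q. \<psi> q \<bullet> e) \<circ> F)"
    by (rule smooth_pullbackD(2)[OF F smooth_near_coordinate[OF B d]])
  then show "smooth_at (\<phi> p) (\<lambda>y. (\<psi> \<circ> F \<circ> inv_into U \<phi>) y \<bullet> e)"
    by (simp add: smooth_near_iff_chart[OF A c] comp_def)
qed

lemma smooth_pullback_id: "smooth_pullback \<A> \<A> (\<lambda>q. q)"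
  by (simp add: smooth_pullback_def comp_def)

lemma smooth_pullback_const: "smooth_atlas \<A> \<Longrightarrow> smooth_pullback \<A> \<B> (\<lambda>q. a)"
  by (simp add: smooth_pullback_def comp_def smooth_near_const)

lemma smooth_pullback_compose:
  "smooth_pullback \<A> \<B> F \<Longrightarrow> smooth_pullback \<B> \<C> H \<Longrightarrow> smooth_pullback \<A> \<C> (\<lambda>q. H (F q))"
  by (fastforce simp: smooth_pullback_def comp_def isCont_o2)

lemma differential_in_tangent_space:
  assumes A: "smooth_atlas \<A>" and B: "smooth_atlas \<B>" and F: "smooth_pullback \<A> \<B> F"
    and v: "v \<in> tangent_space \<A> p"
  shows "differential \<B> F p v \<in> tangent_space \<B> (F p)"
proof -
  obtain U \<phi> where c: "(U, \<phi>) \<in> \<A>" "p \<in> U" using chart_at[OF A] .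
  obtain V \<psi> where d: "(V, \<psi>) \<in> \<B>" "F p \<in> V" using chart_at[OF B] .
  obtain w where w: "v = coord_vector \<A> (U, \<phi>) p w"
    using v unfolding tangent_space_eq_range[OF A c] by blast
  have "differential \<B> F p v = coord_vector \<B> (V, \<psi>) (F p)
      (frechet_derivative (\<psi> \<circ> F \<circ> inv_into U \<phi>) (at (\<phi> p)) w)"
  proof
    fix f
    show "differential \<B> F p v f = coord_vector \<B> (V, \<psi>) (F p)
      (frechet_derivative (\<psi> \<circ> F \<circ> inv_into U \<phi>) (at (\<phi> p)) w) f"
    proof (cases "smooth_near \<B> (F p) f")
      case True
      then show ?thesis
        using coord_vector_compose(2)[OF A B c d smooth_pullbackD(1)[OF F]
            smooth_pullback_in_charts[OF A B F c d]]
        by (simp add: differential_def w)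
    qed (simp add: differential_def coord_vector_def)
  qed
  then show ?thesis using tangent_space_eq_range[OF B d] by blast
qed

lemma linear_differential: "linear (differential \<B> F p)"
  by (rule linearI) (auto simp: differential_def plus_fun_def scaleR_fun_def)

lemma differential_compose:
  assumes "smooth_pullback \<B> \<C> H"
  shows "differential \<C> H (F p) (differential \<B> F p v) = differential \<C> (\<lambda>x. H (F x)) p v"
  using smooth_pullbackD(2)[OF assms] by (auto simp: differential_def comp_def)

lemma differential_id:
  assumes "smooth_atlas \<A>" "v \<in> tangent_space \<A> p"
  shows "differential \<A> (\<lambda>x. x) p v = v"
  using tangent_vector_not_smooth[OF assms] by (auto simp: differential_def comp_def)

lemma compatible_charts_iff:
  assumes "is_chart (U, \<phi>)" "is_chart (V, \<psi>)"
  shows "compatible_charts (U, \<phi>) (V, \<psi>) \<longleftrightarrow> (\<forall>p\<in>U \<inter> V.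
     smooth_at (\<phi> p) (\<psi> \<circ> inv_into U \<phi>) \<and> smooth_at (\<psi> p) (\<phi> \<circ> inv_into V \<psi>))"
proof -
  have "open (\<phi> ` (U \<inter> V))" "open (\<psi> ` (U \<inter> V))"
    using open_chart_image[OF assms(1) is_chartD(1)[OF assms(2)]]
      open_chart_image[OF assms(2) is_chartD(1)[OF assms(1)]]
    by (simp_all add: Int_commute)
  then show ?thesis by (auto simp: compatible_charts_def smooth_on_iff_smooth_at)
qed

lemma inv_into_map_prod:
  assumes "inj_on \<phi> U" "inj_on \<psi> V" "y \<in> map_prod \<phi> \<psi> ` (U \<times> V)"
  shows "inv_into (U \<times> V) (map_prod \<phi> \<psi>) y = (inv_into U \<phi> (fst y), inv_into V \<psi> (snd y))"
  using assms by (auto intro!: inv_into_f_eq map_prod_inj_on)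

lemma is_chart_product:
  assumes c: "is_chart (U, \<phi>)" and d: "is_chart (V, \<psi>)"
  shows "is_chart (U \<times> V, map_prod \<phi> \<psi>)"
proof -
  note inj = is_chartD(3)[OF c] is_chartD(3)[OF d]
  have im: "map_prod \<phi> \<psi> ` (U \<times> V) = \<phi> ` U \<times> \<psi> ` V" by auto
  have cont: "continuous_on (\<phi> ` U) (inv_into U \<phi>)" "continuous_on (\<psi> ` V) (inv_into V \<psi>)"
    using c d by (auto simp: is_chart_def homeomorphism_def)
  have "continuous_on (U \<times> V) (\<lambda>x. (\<phi> (fst x), \<psi> (snd x)))"
    by (intro continuous_intros continuous_on_compose2[OF is_chartD(4)[OF c]]
        continuous_on_compose2[OF is_chartD(4)[OF d]]) auto
  then have 1: "continuous_on (U \<times> V) (map_prod \<phi> \<psi>)"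
    by (simp add: map_prod_def case_prod_unfold)
  have "continuous_on (\<phi> ` U \<times> \<psi> ` V) (\<lambda>y. (inv_into U \<phi> (fst y), inv_into V \<psi> (snd y)))"
    by (intro continuous_intros continuous_on_compose2[OF cont(1)]
        continuous_on_compose2[OF cont(2)]) auto
  then have 2: "continuous_on (map_prod \<phi> \<psi> ` (U \<times> V)) (inv_into (U \<times> V) (map_prod \<phi> \<psi>))"
    unfolding im[symmetric]
    by (rule continuous_on_eq) (simp add: inv_into_map_prod[OF inj])
  have inj': "inj_on (map_prod \<phi> \<psi>) (U \<times> V)" by (intro map_prod_inj_on inj)
  have "homeomorphism (U \<times> V) (map_prod \<phi> \<psi> ` (U \<times> V)) (map_prod \<phi> \<psi>)
      (inv_into (U \<times> V) (map_prod \<phi> \<psi>))"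
    using 1 2 inj' by (simp add: homeomorphism_def inv_into_image_cancel f_inv_into_f)
  then show ?thesis
    using is_chartD(1,2)[OF c] is_chartD(1,2)[OF d] by (simp add: is_chart_def im open_Times)
qed

lemma smooth_atlas_product:
  fixes \<A> :: "('m::{t2_space,second_countable_topology}, 'e::euclidean_space) chart set"
    and \<B> :: "('n::{t2_space,second_countable_topology}, 'f::euclidean_space) chart set"
  assumes A: "smooth_atlas \<A>" and B: "smooth_atlas \<B>"
  shows "smooth_atlas (product_atlas \<A> \<B>)"
  unfolding smooth_atlas_def
proof (intro conjI ballI)
  fix c assume "c \<in> product_atlas \<A> \<B>"
  then show "is_chart c"
    by (auto simp: product_atlas_def
        intro: is_chart_product atlas_is_chart[OF A] atlas_is_chart[OF B])
next
  have "x \<in> (\<Union>c\<in>product_atlas \<A> \<B>. fst c)" for x :: "'m \<times> 'n"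
  proof -
    obtain U \<phi> where "(U, \<phi>) \<in> \<A>" "fst x \<in> U" using chart_at[OF A] .
    moreover obtain V \<psi> where "(V, \<psi>) \<in> \<B>" "snd x \<in> V" using chart_at[OF B] .
    ultimately have "(U \<times> V, map_prod \<phi> \<psi>) \<in> product_atlas \<A> \<B>" "x \<in> U \<times> V"
      by (auto simp: product_atlas_def mem_Times_iff)
    then show ?thesis by force
  qed
  then show "(\<Union>c\<in>product_atlas \<A> \<B>. fst c) = UNIV" by blast
next
  have transition: "smooth_at (map_prod \<phi> \<psi> x)
        (map_prod \<phi>' \<psi>' \<circ> inv_into (U \<times> V) (map_prod \<phi> \<psi>))"
    if c: "(U, \<phi>) \<in> \<A>" "(U', \<phi>') \<in> \<A>" and d: "(V, \<psi>) \<in> \<B>" "(V', \<psi>') \<in> \<B>"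
      and x: "x \<in> U \<times> V" "x \<in> U' \<times> V'" for U \<phi> U' \<phi>' V \<psi> V' \<psi>' x
  proof (rule smooth_at_cong)
    note ch = atlas_is_chart[OF A c(1)] and dh = atlas_is_chart[OF B d(1)]
    show "smooth_at (map_prod \<phi> \<psi> x)
        (\<lambda>y. ((\<phi>' \<circ> inv_into U \<phi>) (fst y), (\<psi>' \<circ> inv_into V \<psi>) (snd y)))"
      using x by (intro smooth_at_Pair smooth_at_compose[of fst _ "\<phi>' \<circ> inv_into U \<phi>"]
          smooth_at_compose[of snd _ "\<psi>' \<circ> inv_into V \<psi>"]
          smooth_at_bounded_linear[OF bounded_linear_fst]
          smooth_at_bounded_linear[OF bounded_linear_snd])
        (auto intro: smooth_transition[OF A c(1) _ c(2)] smooth_transition[OF B d(1) _ d(2)])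
    show "\<forall>\<^sub>F y in nhds (map_prod \<phi> \<psi> x).
        ((\<phi>' \<circ> inv_into U \<phi>) (fst y), (\<psi>' \<circ> inv_into V \<psi>) (snd y))
        = (map_prod \<phi>' \<psi>' \<circ> inv_into (U \<times> V) (map_prod \<phi> \<psi>)) y"
      by (rule eventually_nhds_chart[OF is_chart_product[OF ch dh] x(1)])
        (auto simp: inv_into_map_prod[OF is_chartD(3)[OF ch] is_chartD(3)[OF dh]])
  qed
  fix c d assume cd: "c \<in> product_atlas \<A> \<B>" "d \<in> product_atlas \<A> \<B>"
  then obtain U \<phi> V \<psi> U' \<phi>' V' \<psi>'
    where c: "(U, \<phi>) \<in> \<A>" "(V, \<psi>) \<in> \<B>" "c = (U \<times> V, map_prod \<phi> \<psi>)"
      and d: "(U', \<phi>') \<in> \<A>" "(V', \<psi>') \<in> \<B>" "d = (U' \<times> V', map_prod \<phi>' \<psi>')"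
    by (auto simp: product_atlas_def)
  have "is_chart c" "is_chart d"
    using c d is_chart_product atlas_is_chart[OF A] atlas_is_chart[OF B] by blast+
  then show "compatible_charts c d"
    unfolding c(3) d(3)
    using transition[OF c(1) d(1) c(2) d(2)] transition[OF d(1) c(1) d(2) c(2)]
    by (subst compatible_charts_iff) blast+
qed

lemma smooth_pullback_Pair:
  assumes A: "smooth_atlas \<A>" and B: "smooth_atlas \<B>" and C: "smooth_atlas \<C>"
    and F: "smooth_pullback \<A> \<B> F" and H: "smooth_pullback \<A> \<C> H"
  shows "smooth_pullback \<A> (product_atlas \<B> \<C>) (\<lambda>q. (F q, H q))"
  unfolding smooth_pullback_def
proof (intro allI conjI impI)
  fix p
  show isc: "isCont (\<lambda>q. (F q, H q)) p"
    using smooth_pullbackD(1)[OF F] smooth_pullbackD(1)[OF H] by (intro continuous_Pair)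
  fix f assume f: "smooth_near (product_atlas \<B> \<C>) (F p, H p) f"
  obtain U \<phi> where c: "(U, \<phi>) \<in> \<A>" "p \<in> U" using chart_at[OF A] .
  obtain V \<psi> where d: "(V, \<psi>) \<in> \<B>" "F p \<in> V" using chart_at[OF B] .
  obtain W \<eta> where e: "(W, \<eta>) \<in> \<C>" "H p \<in> W" using chart_at[OF C] .
  have de: "(V \<times> W, map_prod \<psi> \<eta>) \<in> product_atlas \<B> \<C>" "(F p, H p) \<in> V \<times> W"
    using d e by (auto simp: product_atlas_def)
  have "smooth_at (\<phi> p) (\<lambda>y. ((\<psi> \<circ> F \<circ> inv_into U \<phi>) y, (\<eta> \<circ> H \<circ> inv_into U \<phi>) y))"
    using smooth_pullback_in_charts[OF A B F c d] smooth_pullback_in_charts[OF A C H c e]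
    by (rule smooth_at_Pair)
  then have "smooth_at (\<phi> p) (map_prod \<psi> \<eta> \<circ> (\<lambda>q. (F q, H q)) \<circ> inv_into U \<phi>)"
    by (simp add: comp_def)
  then show "smooth_near \<A> p (f \<circ> (\<lambda>q. (F q, H q)))"
    by (rule coord_vector_compose(1)[OF A smooth_atlas_product[OF B C] c de isc _ f])
qed

text \<open>Differentiation under a parameter: a smooth function of two variables, differentiated in the
  second one at \<open>k p\<close> along a vector \<open>X p\<close> depending smoothly on \<open>p\<close>, with the first variable
  set to \<open>h p\<close>. This yields both the smoothness of left-invariant fields (\<open>h\<close> the identity, \<open>k\<close>
  and \<open>X\<close> constant) and the smoothness of the left-invariant components of a smooth field (\<open>h\<close> the
  inversion, \<open>k\<close> the identity).\<close>

lemma smooth_near_parametrised: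
  assumes A: "smooth_atlas \<A>" and B: "smooth_atlas \<B>" and C: "smooth_atlas \<C>"
    and h: "smooth_pullback \<A> \<B> h" and k: "smooth_pullback \<A> \<C> k"
    and X: "\<forall>\<^sub>F p in nhds p0. X p \<in> tangent_space \<C> (k p)"
      "\<And>f. smooth_near \<C> (k p0) f \<Longrightarrow> smooth_near \<A> p0 (\<lambda>p. X p f)"
    and \<Phi>: "smooth_near (product_atlas \<B> \<C>) (h p0, k p0) \<Phi>"
  shows "smooth_near \<A> p0 (\<lambda>p. X p (\<lambda>q. \<Phi> (h p, q)))"
proof -
  obtain U \<phi> where c: "(U, \<phi>) \<in> \<A>" "p0 \<in> U" using chart_at[OF A] .
  obtain V \<psi> where d: "(V, \<psi>) \<in> \<B>" "h p0 \<in> V" using chart_at[OF B] .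
  obtain W \<eta> where e: "(W, \<eta>) \<in> \<C>" "k p0 \<in> W" using chart_at[OF C] .
  note BC = smooth_atlas_product[OF B C]
  note ch = atlas_is_chart[OF A c(1)] and dh = atlas_is_chart[OF B d(1)]
    and eh = atlas_is_chart[OF C e(1)]
  have de: "(V \<times> W, map_prod \<psi> \<eta>) \<in> product_atlas \<B> \<C>"
    using d e by (auto simp: product_atlas_def)
  \<comment> \<open>\<open>F\<close> is \<open>\<Phi>\<close> in coordinates and \<open>\<xi> p\<close> the coordinates of \<open>X p\<close>: differentiating \<open>\<Phi>\<close> in its
    second variable along \<open>X p\<close> is differentiating \<open>F\<close> in the direction \<open>(0, \<xi> p)\<close>.\<close>
  define F where "F = \<Phi> \<circ> inv_into (V \<times> W) (map_prod \<psi> \<eta>)"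
  define \<xi> where "\<xi> p = (\<Sum>i\<in>Basis. X p (\<lambda>q. \<eta> q \<bullet> i) *\<^sub>R i)" for p
  have F_eq: "F (\<psi> a, \<eta> b) = \<Phi> (a, b)" if "a \<in> V" "b \<in> W" for a b
    using that is_chartD(5)[OF is_chart_product[OF dh eh], of "(a, b)"] by (simp add: F_def)
  have X_apply: "X p (\<lambda>q. \<Phi> (h p, q))
      = frechet_derivative F (at (\<psi> (h p), \<eta> (k p))) (0, \<xi> p)"
    if p: "X p \<in> tangent_space \<C> (k p)" "h p \<in> V" "k p \<in> W"
      "smooth_near (product_atlas \<B> \<C>) (h p, k p) \<Phi>" for p
  proof -
    have "smooth_pullback \<C> (product_atlas \<B> \<C>) (\<lambda>q. (h p, q))"
      by (intro smooth_pullback_Pair smooth_pullback_const smooth_pullback_id B C)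
    then have sm: "smooth_near \<C> (k p) (\<lambda>q. \<Phi> (h p, q))"
      using smooth_pullbackD(2)[of \<C> _ "\<lambda>q. (h p, q)" "k p" \<Phi>] p(4) by (simp add: comp_def)
    have F: "smooth_at (\<psi> (h p), \<eta> (k p)) F"
      using p(2-4) smooth_near_iff_chart[OF BC de] unfolding F_def by force
    have "((\<lambda>y. (\<psi> (h p), y)) has_derivative (\<lambda>w. (0, w))) (at (\<eta> (k p)))"
      by (auto intro!: derivative_eq_intros)
    then have D: "((\<lambda>y. F (\<psi> (h p), y)) has_derivative
        (\<lambda>w. frechet_derivative F (at (\<psi> (h p), \<eta> (k p))) (0, w))) (at (\<eta> (k p)))"
      by (rule has_derivative_compose) (rule smooth_at_has_derivative[OF F])
    have "\<forall>\<^sub>F y in nhds (\<eta> (k p)). F (\<psi> (h p), y) = ((\<lambda>q. \<Phi> (h p, q)) \<circ> inv_into W \<eta>) y"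
      by (rule eventually_nhds_chart[OF eh p(3)]) (simp add: F_eq p(2) is_chartD(5)[OF eh])
    from frechet_derivative_cong[OF differentiableI[OF D] this]
    have "frechet_derivative ((\<lambda>q. \<Phi> (h p, q)) \<circ> inv_into W \<eta>) (at (\<eta> (k p)))
        = (\<lambda>w. frechet_derivative F (at (\<psi> (h p), \<eta> (k p))) (0, w))"
      unfolding frechet_derivative_at[OF D, symmetric] .
    moreover have "X p = coord_vector \<C> (W, \<eta>) (k p) (\<xi> p)"
      unfolding \<xi>_def by (rule tangent_vector_coordinates[OF C e(1) p(3,1)])
    ultimately show ?thesis by (simp add: coord_vector_apply[OF sm])
  qed
  have "smooth_near \<A> p0 (\<lambda>p. frechet_derivative F (at (\<psi> (h p), \<eta> (k p))) (0, \<xi> p))"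
  proof -
    let ?h = "\<psi> \<circ> h \<circ> inv_into U \<phi>" and ?k = "\<eta> \<circ> k \<circ> inv_into U \<phi>"
    have p0: "inv_into U \<phi> (\<phi> p0) = p0" by (rule is_chartD(5)[OF ch c(2)])
    have "smooth_at (\<phi> p0) (\<lambda>y. X (inv_into U \<phi> y) (\<lambda>q. \<eta> q \<bullet> i))" for i
      using X(2)[OF smooth_near_coordinate[OF C e]]
      by (simp add: smooth_near_iff_chart[OF A c] comp_def)
    then have "smooth_at (\<phi> p0) (\<lambda>y. \<xi> (inv_into U \<phi> y))"
      unfolding \<xi>_def
      by (intro smooth_at_sum smooth_at_bounded_bilinear[OF bounded_bilinear_scaleR]
          smooth_at_const)
    moreover have "smooth_at (?h (\<phi> p0), ?k (\<phi> p0)) F"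
      using \<Phi> smooth_near_iff_chart[OF BC de] d(2) e(2) p0 unfolding F_def by force
    ultimately have "smooth_at (\<phi> p0)
        (\<lambda>y. frechet_derivative F (at (?h y, ?k y)) (0, \<xi> (inv_into U \<phi> y)))"
      by (intro smooth_at_derivative_along[of "\<lambda>y. (?h y, ?k y)"] smooth_at_Pair smooth_at_const
          smooth_pullback_in_charts[OF A B h c d] smooth_pullback_in_charts[OF A C k c e])
    then show ?thesis by (simp add: smooth_near_iff_chart[OF A c] comp_def)
  qed
  moreover have "\<forall>\<^sub>F p in nhds p0. frechet_derivative F (at (\<psi> (h p), \<eta> (k p))) (0, \<xi> p)
      = X p (\<lambda>q. \<Phi> (h p, q))"
    using X(1) smooth_pullback_eventually[OF h eventually_in_chart[OF dh d(2)]]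
      smooth_pullback_eventually[OF k eventually_in_chart[OF eh e(2)]]
      smooth_pullback_eventually[OF smooth_pullback_Pair[OF A B C h k] smooth_near_eventually[OF \<Phi>]]
    by eventually_elim (simp add: X_apply)
  ultimately show ?thesis by (rule smooth_near_cong[OF A])
qed


section \<open>Smooth vector fields\<close>

text \<open>The test functions of a smooth field may be taken as germs, so that applying several fields in
  succession needs no bookkeeping of domains.\<close>

lemma smooth_vector_field_on_iff:
  assumes A: "smooth_atlas \<A>" and W: "open W"
  shows "smooth_vector_field_on \<A> W X \<longleftrightarrow> (\<forall>p\<in>W. X p \<in> tangent_space \<A> p \<and>
     (\<forall>f. smooth_near \<A> p f \<longrightarrow> smooth_near \<A> p (\<lambda>q. X q f)))" (is "_ \<longleftrightarrow> ?R")
proof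
  assume X: "smooth_vector_field_on \<A> W X"
  show ?R
  proof (intro ballI conjI allI impI)
    fix p f assume p: "p \<in> W"
    then show "X p \<in> tangent_space \<A> p" using X by (simp add: smooth_vector_field_on_def)
    assume "smooth_near \<A> p f"
    then obtain W' where W': "open W'" "p \<in> W'" "smooth_fun_on \<A> W' f"
      by (auto simp: smooth_near_def)
    then have "smooth_fun_on \<A> (W' \<inter> W) f"
      using W by (simp add: smooth_fun_on_iff_smooth_near[OF A] open_Int)
    then have "smooth_fun_on \<A> (W' \<inter> W) (\<lambda>q. X q f)"
      using X W W'(1) open_Int unfolding smooth_vector_field_on_def by blast
    then show "smooth_near \<A> p (\<lambda>q. X q f)"
      using p W W' unfolding smooth_near_def by blast
  qed
next
  assume ?R
  then show "smooth_vector_field_on \<A> W X"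
    unfolding smooth_vector_field_on_def by (auto simp: smooth_fun_on_iff_smooth_near[OF A])
qed

lemma smooth_vector_fieldD:
  assumes "smooth_atlas \<A>" "open W" "smooth_vector_field_on \<A> W X" "p \<in> W"
  shows "X p \<in> tangent_space \<A> p" "smooth_near \<A> p f \<Longrightarrow> smooth_near \<A> p (\<lambda>q. X q f)"
  using assms smooth_vector_field_on_iff by blast+

lemma scaleR_fun_apply: "(c *\<^sub>R F) x = c *\<^sub>R F x"
  by (simp add: scaleR_fun_def)

lemma sum_fun_apply: "(\<Sum>i\<in>I. F i) x = (\<Sum>i\<in>I. F i x)"
  by (induction I rule: infinite_finite_induct) auto

lemma smooth_vector_field_on_combination:
  assumes A: "smooth_atlas \<A>" and W: "open W"
    and a: "\<And>i p. i \<in> I \<Longrightarrow> p \<in> W \<Longrightarrow> smooth_near \<A> p (a i)"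
    and Z: "\<And>i. i \<in> I \<Longrightarrow> smooth_vector_field_on \<A> W (Z i)"
    and X: "\<And>p. p \<in> W \<Longrightarrow> X p = (\<Sum>i\<in>I. a i p *\<^sub>R Z i p)"
  shows "smooth_vector_field_on \<A> W X"
  unfolding smooth_vector_field_on_iff[OF A W]
proof (intro ballI conjI allI impI)
  fix p f assume p: "p \<in> W"
  show "X p \<in> tangent_space \<A> p"
    unfolding X[OF p]
    by (intro subspace_sum subspace_scale subspace_tangent_space[OF A]
        smooth_vector_fieldD(1)[OF A W Z p])
  assume f: "smooth_near \<A> p f"
  have "smooth_near \<A> p (\<lambda>q. \<Sum>i\<in>I. a i q * Z i q f)"
    by (intro smooth_near_sum[OF A] smooth_near_mult[OF A] a smooth_vector_fieldD(2)[OF A W Z] p f)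
  moreover have "\<forall>\<^sub>F q in nhds p. (\<Sum>i\<in>I. a i q * Z i q f) = X q f"
    using eventually_nhds_in_open[OF W p]
    by eventually_elim (simp add: X sum_fun_apply scaleR_fun_apply)
  ultimately show "smooth_near \<A> p (\<lambda>q. X q f)" by (rule smooth_near_cong[OF A])
qed

section \<open>Left-invariant vector fields on a Lie group\<close>

locale lie_grp =
  fixes G :: "('g::{t2_space,second_countable_topology}, 'r) monoid_scheme"
    and \<A> :: "('g, 'e::euclidean_space) chart set"
  assumes lie_group: "lie_group G \<A>"
begin

abbreviation mul (infixl "\<cdot>" 70) where "x \<cdot> y \<equiv> x \<otimes>\<^bsub>G\<^esub> y"
abbreviation ident ("\<epsilon>") where "\<epsilon> \<equiv> \<one>\<^bsub>G\<^esub>"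
abbreviation left_inv_field ("\<E>") where "\<E> \<equiv> left_invariant_field G \<A>"
abbreviation lie_alg ("\<gg>") where "\<gg> \<equiv> lie_algebra G \<A>"
abbreviation alg_bracket ("\<lbrakk>_, _\<rbrakk>") where "\<lbrakk>u, v\<rbrakk> \<equiv> lie_algebra_bracket G \<A> u v"

text \<open>The Maurer-Cartan form: at each point it inverts the evaluation of left-invariant fields
  there (\<open>to_identity_left_inv_field\<close> and \<open>left_inv_field_to_identity\<close> below).\<close>

definition to_identity :: "'g \<Rightarrow> 'g tangent_vector \<Rightarrow> 'g tangent_vector" where
  "to_identity p = differential \<A> (\<lambda>x. inv\<^bsub>G\<^esub> p \<cdot> x) p"

lemma atlas: "smooth_atlas \<A>"
  using lie_group by (simp add: lie_group_def)

lemma group_laws [simp]: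
  "x \<cdot> y \<cdot> z = x \<cdot> (y \<cdot> z)" "x \<cdot> \<epsilon> = x" "\<epsilon> \<cdot> x = x" "inv\<^bsub>G\<^esub> x \<cdot> x = \<epsilon>" "x \<cdot> inv\<^bsub>G\<^esub> x = \<epsilon>"
  "inv\<^bsub>G\<^esub> x \<cdot> (x \<cdot> y) = y" "x \<cdot> (inv\<^bsub>G\<^esub> x \<cdot> y) = y"
proof -
  interpret group G using lie_group by (simp add: lie_group_def)
  have [simp]: "x \<in> carrier G" for x using lie_group by (simp add: lie_group_def)
  show "x \<cdot> y \<cdot> z = x \<cdot> (y \<cdot> z)" "x \<cdot> \<epsilon> = x" "\<epsilon> \<cdot> x = x" "inv\<^bsub>G\<^esub> x \<cdot> x = \<epsilon>"
    "x \<cdot> inv\<^bsub>G\<^esub> x = \<epsilon>"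
    by (simp_all add: m_assoc)
  show "inv\<^bsub>G\<^esub> x \<cdot> (x \<cdot> y) = y" "x \<cdot> (inv\<^bsub>G\<^esub> x \<cdot> y) = y"
    by (simp_all add: m_assoc[symmetric])
qed

lemma mul_ident [simp]: "(\<cdot>) \<epsilon> = (\<lambda>x. x)"
  by (simp add: fun_eq_iff)

lemma mul_pullback: "smooth_pullback (product_atlas \<A> \<A>) \<A> (\<lambda>(x, y). x \<cdot> y)"
  using lie_group
  by (intro smooth_map_imp_smooth_pullback smooth_atlas_product) (simp_all add: lie_group_def)

lemma inv_pullback: "smooth_pullback \<A> \<A> (\<lambda>x. inv\<^bsub>G\<^esub> x)"
  using lie_group by (intro smooth_map_imp_smooth_pullback) (simp_all add: lie_group_def)

lemma translation_pullback: "smooth_pullback \<A> \<A> (\<lambda>x. p \<cdot> x)"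
  using smooth_pullback_compose[OF smooth_pullback_Pair[OF atlas atlas atlas
        smooth_pullback_const[OF atlas] smooth_pullback_id] mul_pullback, of p]
  by simp

lemma smooth_near_translate: "smooth_near \<A> q (\<lambda>x. f (p \<cdot> x)) \<longleftrightarrow> smooth_near \<A> (p \<cdot> q) f"
proof
  assume "smooth_near \<A> q (\<lambda>x. f (p \<cdot> x))"
  then show "smooth_near \<A> (p \<cdot> q) f"
    using smooth_pullbackD(2)[OF translation_pullback, of "inv\<^bsub>G\<^esub> p" "p \<cdot> q" "\<lambda>x. f (p \<cdot> x)"]
    by (simp add: comp_def)
next
  assume "smooth_near \<A> (p \<cdot> q) f"
  then show "smooth_near \<A> q (\<lambda>x. f (p \<cdot> x))"
    using smooth_pullbackD(2)[OF translation_pullback] by (simp add: comp_def)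
qed

lemma left_inv_field_apply:
  "\<E> v p f = (if smooth_near \<A> p f then v (\<lambda>x. f (p \<cdot> x)) else 0)"
  by (simp add: left_invariant_field_def differential_def comp_def)

lemma left_inv_field_translate: "\<E> v (p \<cdot> q) f = \<E> v q (\<lambda>x. f (p \<cdot> x))"
  by (simp add: left_inv_field_apply smooth_near_translate)

lemma linear_left_inv_field: "linear (\<lambda>v. \<E> v p)"
  unfolding left_invariant_field_def by (rule linear_differential)

lemma left_inv_field_tangent: "v \<in> \<gg> \<Longrightarrow> \<E> v p \<in> tangent_space \<A> p"
  using differential_in_tangent_space[OF atlas atlas translation_pullback, of v \<epsilon> p]
  by (simp add: left_invariant_field_def lie_algebra_def)

lemma left_inv_field_ident: "v \<in> \<gg> \<Longrightarrow> \<E> v \<epsilon> = v"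
  using differential_id[OF atlas, of v \<epsilon>]
  by (simp add: left_invariant_field_def lie_algebra_def cong: if_cong)

lemma linear_to_identity: "linear (to_identity p)"
  unfolding to_identity_def by (rule linear_differential)

lemma to_identity_in_lie_alg: "u \<in> tangent_space \<A> p \<Longrightarrow> to_identity p u \<in> \<gg>"
  using differential_in_tangent_space[OF atlas atlas translation_pullback, of u p "inv\<^bsub>G\<^esub> p"]
  by (simp add: to_identity_def lie_algebra_def)

lemma to_identity_left_inv_field: "v \<in> \<gg> \<Longrightarrow> to_identity p (\<E> v p) = v"
  using differential_compose[OF translation_pullback[of "inv\<^bsub>G\<^esub> p"], of "\<lambda>x. p \<cdot> x" \<epsilon> v]
    differential_id[OF atlas]
  by (simp add: to_identity_def left_invariant_field_def lie_algebra_def)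

lemma left_inv_field_to_identity: "u \<in> tangent_space \<A> p \<Longrightarrow> \<E> (to_identity p u) p = u"
  using differential_compose[OF translation_pullback[of p], of "\<lambda>x. inv\<^bsub>G\<^esub> p \<cdot> x" p u]
    differential_id[OF atlas]
  by (simp add: to_identity_def left_invariant_field_def)

lemma left_inv_field_smooth:
  assumes v: "v \<in> \<gg>" and W: "open W"
  shows "smooth_vector_field_on \<A> W (\<E> v)"
  unfolding smooth_vector_field_on_iff[OF atlas W]
proof (intro ballI conjI allI impI)
  fix p f
  show "\<E> v p \<in> tangent_space \<A> p" by (rule left_inv_field_tangent[OF v])
  assume f: "smooth_near \<A> p f"
  have fm: "smooth_near (product_atlas \<A> \<A>) (p, \<epsilon>) (f \<circ> (\<lambda>(x, y). x \<cdot> y))"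
    by (rule smooth_pullbackD(2)[OF mul_pullback]) (simp add: f)
  have "smooth_near \<A> p (\<lambda>q. v (\<lambda>x. (f \<circ> (\<lambda>(x, y). x \<cdot> y)) (q, x)))"
    by (rule smooth_near_parametrised[where h = "\<lambda>q. q" and k = "\<lambda>q. \<epsilon>" and X = "\<lambda>q. v",
          OF atlas atlas atlas smooth_pullback_id smooth_pullback_const[OF atlas] _
            smooth_near_const[OF atlas] fm])
      (use v in \<open>simp add: lie_algebra_def\<close>)
  then have "smooth_near \<A> p (\<lambda>q. v (\<lambda>x. f (q \<cdot> x)))" by simp
  moreover have "\<forall>\<^sub>F q in nhds p. v (\<lambda>x. f (q \<cdot> x)) = \<E> v q f"
    using smooth_near_eventually[OF f] by eventually_elim (simp add: left_inv_field_apply)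
  ultimately show "smooth_near \<A> p (\<lambda>q. \<E> v q f)" by (rule smooth_near_cong[OF atlas])
qed

text \<open>Left translations preserve the fields, hence their brackets.\<close>

lemma lie_bracket_left_inv_field: "lie_bracket \<A> (\<E> u) (\<E> v) p = \<E> \<lbrakk>u, v\<rbrakk> p"
proof
  fix f
  have "\<E> w p (\<lambda>q. \<E> w' q f) = \<E> w \<epsilon> (\<lambda>q. \<E> w' q (\<lambda>x. f (p \<cdot> x)))" for w w'
    using left_inv_field_translate[of w p \<epsilon> "\<lambda>q. \<E> w' q f"]
    by (simp add: left_inv_field_translate)
  then show "lie_bracket \<A> (\<E> u) (\<E> v) p f = \<E> \<lbrakk>u, v\<rbrakk> p f"
    unfolding left_inv_field_apply[of "\<lbrakk>u, v\<rbrakk>"]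
    by (simp add: lie_bracket_def lie_algebra_bracket_def smooth_near_translate)
qed

lemma left_inv_field_bracket_apply:
  "smooth_near \<A> p f \<Longrightarrow>
     \<E> \<lbrakk>u, v\<rbrakk> p f = \<E> u p (\<lambda>q. \<E> v q f) - \<E> v p (\<lambda>q. \<E> u q f)"
  by (simp add: lie_bracket_left_inv_field[symmetric] lie_bracket_def)

lemma bracket_apply:
  assumes "u \<in> \<gg>" "v \<in> \<gg>"
  shows "\<lbrakk>u, v\<rbrakk> f = (if smooth_near \<A> \<epsilon> f then u (\<lambda>q. \<E> v q f) - v (\<lambda>q. \<E> u q f) else 0)"
  using assms by (simp add: lie_algebra_bracket_def lie_bracket_def left_inv_field_ident)

lemma subspace_lie_alg: "subspace \<gg>"
  unfolding lie_algebra_def by (rule subspace_tangent_space[OF atlas])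

lemma smooth_near_left_inv_field:
  "v \<in> \<gg> \<Longrightarrow> smooth_near \<A> p f \<Longrightarrow> smooth_near \<A> p (\<lambda>q. \<E> v q f)"
  using smooth_vector_fieldD(2)[OF atlas open_UNIV left_inv_field_smooth[OF _ open_UNIV]] by blast

lemma bracket_antisym: "u \<in> \<gg> \<Longrightarrow> v \<in> \<gg> \<Longrightarrow> \<lbrakk>u, v\<rbrakk> = - \<lbrakk>v, u\<rbrakk>"
  by (auto simp: bracket_apply)

lemma bracket_add_left:
  assumes "u \<in> \<gg>" "v \<in> \<gg>" "w \<in> \<gg>" shows "\<lbrakk>u + v, w\<rbrakk> = \<lbrakk>u, w\<rbrakk> + \<lbrakk>v, w\<rbrakk>"
proof
  fix f
  have uv: "u + v \<in> \<gg>" using subspace_add[OF subspace_lie_alg] assms by blast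
  show "\<lbrakk>u + v, w\<rbrakk> f = (\<lbrakk>u, w\<rbrakk> + \<lbrakk>v, w\<rbrakk>) f"
    using assms tangent_vector_add[OF atlas, of w \<epsilon> "\<lambda>q. \<E> u q f" "\<lambda>q. \<E> v q f"]
      linear_add[OF linear_left_inv_field]
    by (simp add: bracket_apply uv smooth_near_left_inv_field lie_algebra_def[symmetric])
qed

lemma bracket_scale_left:
  assumes "u \<in> \<gg>" "w \<in> \<gg>" shows "\<lbrakk>c *\<^sub>R u, w\<rbrakk> = c *\<^sub>R \<lbrakk>u, w\<rbrakk>"
proof
  fix f
  have cu: "c *\<^sub>R u \<in> \<gg>" using subspace_scale[OF subspace_lie_alg] assms by blast
  show "\<lbrakk>c *\<^sub>R u, w\<rbrakk> f = (c *\<^sub>R \<lbrakk>u, w\<rbrakk>) f"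
    using assms tangent_vector_cmult[OF atlas, of w \<epsilon> "\<lambda>q. \<E> u q f" c]
      linear_scale[OF linear_left_inv_field]
    by (simp add: bracket_apply cu smooth_near_left_inv_field lie_algebra_def[symmetric]
        scaleR_fun_apply algebra_simps)
qed

lemma bracket_zero [simp]:
  assumes "u \<in> \<gg>" shows "\<lbrakk>0, u\<rbrakk> = 0" "\<lbrakk>u, 0\<rbrakk> = 0"
proof -
  show "\<lbrakk>0, u\<rbrakk> = 0" using bracket_scale_left[OF assms assms, of 0] by simp
  then show "\<lbrakk>u, 0\<rbrakk> = 0"
    using bracket_antisym[OF assms subspace_0[OF subspace_lie_alg]] by simp
qed

text \<open>The Jacobi identity: both sides are the same combination of threefold derivatives. That the
  inner brackets belong to the Lie algebra is a hypothesis here; the grading of a stratified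
  algebra will supply it.\<close>

lemma bracket_jacobi:
  assumes u: "u \<in> \<gg>" and v: "v \<in> \<gg>" and w: "w \<in> \<gg>"
    and uv: "\<lbrakk>u, v\<rbrakk> \<in> \<gg>" and uw: "\<lbrakk>u, w\<rbrakk> \<in> \<gg>" and vw: "\<lbrakk>v, w\<rbrakk> \<in> \<gg>"
  shows "\<lbrakk>\<lbrakk>u, v\<rbrakk>, w\<rbrakk> = \<lbrakk>u, \<lbrakk>v, w\<rbrakk>\<rbrakk> - \<lbrakk>v, \<lbrakk>u, w\<rbrakk>\<rbrakk>"
proof
  fix f
  show "\<lbrakk>\<lbrakk>u, v\<rbrakk>, w\<rbrakk> f = (\<lbrakk>u, \<lbrakk>v, w\<rbrakk>\<rbrakk> - \<lbrakk>v, \<lbrakk>u, w\<rbrakk>\<rbrakk>) f"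
  proof (cases "smooth_near \<A> \<epsilon> f")
    case True
    \<comment> \<open>Expanding the inner bracket leaves only iterated derivatives of \<open>f\<close>.\<close>
    have step: "x (\<lambda>q. \<E> \<lbrakk>y, z\<rbrakk> q f)
        = x (\<lambda>q. \<E> y q (\<lambda>r. \<E> z r f)) - x (\<lambda>q. \<E> z q (\<lambda>r. \<E> y r f))"
      if "x \<in> \<gg>" "y \<in> \<gg>" "z \<in> \<gg>" for x y z
    proof -
      have "\<forall>\<^sub>F q in nhds \<epsilon>. \<E> \<lbrakk>y, z\<rbrakk> q f
          = \<E> y q (\<lambda>r. \<E> z r f) - \<E> z q (\<lambda>r. \<E> y r f)"
        using smooth_near_eventually[OF True]
        by eventually_elim (rule left_inv_field_bracket_apply)
      then have "x (\<lambda>q. \<E> \<lbrakk>y, z\<rbrakk> q f)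
          = x (\<lambda>q. \<E> y q (\<lambda>r. \<E> z r f) - \<E> z q (\<lambda>r. \<E> y r f))"
        by (rule tangent_vector_cong[OF atlas that(1)[unfolded lie_algebra_def]])
      also have "\<dots> = x (\<lambda>q. \<E> y q (\<lambda>r. \<E> z r f)) - x (\<lambda>q. \<E> z q (\<lambda>r. \<E> y r f))"
        using that unfolding lie_algebra_def
        by (intro tangent_vector_diff[OF atlas])
          (auto intro!: smooth_near_left_inv_field True simp: lie_algebra_def)
      finally show ?thesis .
    qed
    show ?thesis
      using True assms
      by (simp add: bracket_apply[of "\<lbrakk>_, _\<rbrakk>"] bracket_apply[of _ "\<lbrakk>_, _\<rbrakk>"] step
          bracket_apply[of u v] bracket_apply[of u w] bracket_apply[of v w]
          smooth_near_left_inv_field)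
  qed (use assms in \<open>simp add: bracket_apply\<close>)
qed

end


section \<open>Orthonormal left-invariant frames\<close>

lemma inner_product_onD:
  assumes "inner_product_on S b"
  shows "u \<in> S \<Longrightarrow> v \<in> S \<Longrightarrow> w \<in> S \<Longrightarrow> b (u + v) w = b u w + b v w"
    and "u \<in> S \<Longrightarrow> v \<in> S \<Longrightarrow> b (c *\<^sub>R u) v = c * b u v"
    and "u \<in> S \<Longrightarrow> v \<in> S \<Longrightarrow> b u v = b v u"
    and "u \<in> S \<Longrightarrow> u \<noteq> 0 \<Longrightarrow> b u u > 0"
  using assms[unfolded inner_product_on_def, THEN conjunct1]
    assms[unfolded inner_product_on_def, THEN conjunct2, THEN conjunct1]
    assms[unfolded inner_product_on_def, THEN conjunct2, THEN conjunct2, THEN conjunct1]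
    assms[unfolded inner_product_on_def, THEN conjunct2, THEN conjunct2, THEN conjunct2]
  by blast+

lemma inner_product_on_sum:
  assumes b: "inner_product_on S b" and S: "subspace S"
    and u: "\<And>i. i \<in> I \<Longrightarrow> u i \<in> S" and v: "v \<in> S"
  shows "b (\<Sum>i\<in>I. c i *\<^sub>R u i) v = (\<Sum>i\<in>I. c i * b (u i) v)"
  using u
proof (induction I rule: infinite_finite_induct)
  case (insert i I)
  have "c i *\<^sub>R u i \<in> S" "(\<Sum>i\<in>I. c i *\<^sub>R u i) \<in> S"
    using insert.prems by (auto intro!: subspace_scale subspace_sum S)
  then show ?case
    using insert by (simp add: inner_product_onD(1,2)[OF b] v)
qed (use inner_product_onD(2)[OF b subspace_0[OF S] v, of 0] in simp_all)

definition orthonormal_on :: "('v \<Rightarrow> 'v \<Rightarrow> real) \<Rightarrow> 'v set \<Rightarrow> bool" where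
  "orthonormal_on b B \<longleftrightarrow> (\<forall>e\<in>B. \<forall>f\<in>B. b e f = (if e = f then 1 else 0))"

lemma orthonormal_expansion:
  assumes b: "inner_product_on S b" and S: "subspace S"
    and B: "finite B" "B \<subseteq> S" "orthonormal_on b B" and u: "u \<in> span B"
  shows "u = (\<Sum>e\<in>B. b u e *\<^sub>R e)"
proof -
  obtain c where c: "u = (\<Sum>e\<in>B. c e *\<^sub>R e)" using u span_finite[OF B(1)] by auto
  have "b u e = c e" if e: "e \<in> B" for e
  proof -
    have "b u e = (\<Sum>f\<in>B. c f * b f e)"
      unfolding c using B(2) e by (intro inner_product_on_sum[OF b S]) auto
    also have "\<dots> = (\<Sum>f\<in>B. if f = e then c f else 0)"
      using B(3) e by (intro sum.cong) (simp_all add: orthonormal_on_def)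
    also have "\<dots> = c e" using B(1) e by simp
    finally show ?thesis .
  qed
  then show ?thesis using c by simp
qed

text \<open>The frame is given by a basis of the Lie algebra. Closure under brackets, assumed on the basis,
  makes brackets of arbitrary smooth fields smooth fields again (\<open>lie_bracket_smooth\<close>).\<close>

locale left_invariant_frame = lie_grp G \<A>
  for G :: "('g::{t2_space,second_countable_topology}, 'r) monoid_scheme"
    and \<A> :: "('g, 'e::euclidean_space) chart set" +
  fixes b :: "'g tangent_vector \<Rightarrow> 'g tangent_vector \<Rightarrow> real"
    and B :: "'g tangent_vector set"
  assumes inner: "inner_product_on \<gg> b"
    and finite_B: "finite B" and span_B: "span B = \<gg>" and orthonormal_B: "orthonormal_on b B"
    and bracket_closed: "\<And>e f. e \<in> B \<Longrightarrow> f \<in> B \<Longrightarrow> \<lbrakk>e, f\<rbrakk> \<in> \<gg>"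
begin

abbreviation metric ("\<g>") where "\<g> \<equiv> left_invariant_metric G \<A> b"

definition component :: "'g tangent_vector \<Rightarrow> 'g vector_field \<Rightarrow> 'g \<Rightarrow> real" ("\<theta>") where
  "\<theta> e X p = \<g> p (X p) (\<E> e p)"

lemma B_in: "e \<in> B \<Longrightarrow> e \<in> \<gg>"
  using span_base[of e B] by (simp add: span_B)

lemma metric_eq: "\<g> p u v = b (to_identity p u) (to_identity p v)"
  by (simp add: left_invariant_metric_def to_identity_def)

lemma metric_inner_product: "inner_product_on (tangent_space \<A> p) (\<g> p)"
  unfolding inner_product_on_def
proof (intro conjI ballI allI impI)
  fix u v w assume [simp]: "u \<in> tangent_space \<A> p" "v \<in> tangent_space \<A> p" "w \<in> tangent_space \<A> p"
  show "\<g> p (u + v) w = \<g> p u w + \<g> p v w"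
    by (simp add: metric_eq linear_add[OF linear_to_identity] inner_product_onD[OF inner]
        to_identity_in_lie_alg)
next
  fix c u v assume [simp]: "u \<in> tangent_space \<A> p" "v \<in> tangent_space \<A> p"
  show "\<g> p (c *\<^sub>R u) v = c * \<g> p u v"
    by (simp add: metric_eq linear_scale[OF linear_to_identity] inner_product_onD[OF inner]
        to_identity_in_lie_alg)
  show "\<g> p u v = \<g> p v u"
    unfolding metric_eq by (rule inner_product_onD(3)[OF inner]) (simp_all add: to_identity_in_lie_alg)
next
  fix u assume u: "u \<in> tangent_space \<A> p" "u \<noteq> 0"
  have "to_identity p u \<noteq> 0"
    using left_inv_field_to_identity[OF u(1)] u(2) linear_0[OF linear_left_inv_field] by metis
  then show "\<g> p u u > 0"
    unfolding metric_eq using inner_product_onD(4)[OF inner] to_identity_in_lie_alg[OF u(1)] by blast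
qed

lemma metric_left_inv_field: "u \<in> \<gg> \<Longrightarrow> v \<in> \<gg> \<Longrightarrow> \<g> p (\<E> u p) (\<E> v p) = b u v"
  by (simp add: metric_eq to_identity_left_inv_field)

lemma metric_frame:
  "e \<in> B \<Longrightarrow> f \<in> B \<Longrightarrow> \<g> p (\<E> e p) (\<E> f p) = (if e = f then 1 else 0)"
  using orthonormal_B by (simp add: metric_left_inv_field B_in orthonormal_on_def)

lemma component_frame: "e \<in> B \<Longrightarrow> f \<in> B \<Longrightarrow> \<theta> e (\<E> f) p = (if e = f then 1 else 0)"
  by (auto simp: component_def metric_frame)

lemma to_identity_expansion:
  assumes u: "u \<in> tangent_space \<A> p"
  shows "to_identity p u = (\<Sum>e\<in>B. \<g> p u (\<E> e p) *\<^sub>R e)"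
proof -
  have "to_identity p u = (\<Sum>e\<in>B. b (to_identity p u) e *\<^sub>R e)"
    using to_identity_in_lie_alg[OF u] B_in
    by (intro orthonormal_expansion[OF inner subspace_lie_alg finite_B _ orthonormal_B])
      (auto simp: span_B)
  also have "\<dots> = (\<Sum>e\<in>B. \<g> p u (\<E> e p) *\<^sub>R e)"
    by (intro sum.cong) (simp_all add: metric_eq to_identity_left_inv_field B_in)
  finally show ?thesis .
qed

lemma frame_expansion:
  assumes u: "u \<in> tangent_space \<A> p"
  shows "u = (\<Sum>e\<in>B. \<g> p u (\<E> e p) *\<^sub>R \<E> e p)"
proof -
  have "u = \<E> (to_identity p u) p" by (simp add: left_inv_field_to_identity[OF u])
  also have "\<dots> = (\<Sum>e\<in>B. \<g> p u (\<E> e p) *\<^sub>R \<E> e p)"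
    unfolding to_identity_expansion[OF u]
    by (simp add: linear_sum[OF linear_left_inv_field] linear_scale[OF linear_left_inv_field])
  finally show ?thesis .
qed

lemma metric_sum:
  assumes "\<And>i. i \<in> I \<Longrightarrow> u i \<in> tangent_space \<A> p" "w \<in> tangent_space \<A> p"
  shows "\<g> p (\<Sum>i\<in>I. c i *\<^sub>R u i) w = (\<Sum>i\<in>I. c i * \<g> p (u i) w)"
  using inner_product_on_sum[OF metric_inner_product subspace_tangent_space[OF atlas]] assms by blast

lemma metric_expansion:
  assumes u: "u \<in> tangent_space \<A> p" and w: "w \<in> tangent_space \<A> p"
  shows "\<g> p u w = (\<Sum>e\<in>B. \<g> p u (\<E> e p) * \<g> p w (\<E> e p))"
proof -
  have "\<g> p u w = \<g> p (\<Sum>e\<in>B. \<g> p u (\<E> e p) *\<^sub>R \<E> e p) w"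
    using frame_expansion[OF u] by simp
  also have "\<dots> = (\<Sum>e\<in>B. \<g> p u (\<E> e p) * \<g> p (\<E> e p) w)"
    by (rule metric_sum) (simp_all add: left_inv_field_tangent B_in w)
  also have "\<dots> = (\<Sum>e\<in>B. \<g> p u (\<E> e p) * \<g> p w (\<E> e p))"
    using inner_product_onD(3)[OF metric_inner_product w] by (simp add: left_inv_field_tangent B_in)
  finally show ?thesis .
qed

text \<open>Solving for the components in a chart would need the inverse of a matrix of functions; the
  smoothness of the group inversion serves instead. The coordinates at the identity of the
  translated vector \<open>X p\<close> are the values of \<open>X p\<close> on the functions \<open>q \<mapsto> \<phi> (p\<^sup>-\<^sup>1 q)\<close>, which
  depend smoothly on \<open>p\<close> and \<open>q\<close>.\<close>

lemma component_smooth: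
  assumes e: "e \<in> \<gg>" and W: "open W" and X: "smooth_vector_field_on \<A> W X" and p: "p \<in> W"
  shows "smooth_near \<A> p (\<theta> e X)"
proof -
  obtain U \<phi> where c: "(U, \<phi>) \<in> \<A>" "\<epsilon> \<in> U" using chart_at[OF atlas] .
  let ?D = "coord_vector \<A> (U, \<phi>) \<epsilon>"
  have D_in: "?D w \<in> \<gg>" for w
    unfolding lie_algebra_def tangent_space_eq_range[OF atlas c] by blast
  have sm: "smooth_near \<A> \<epsilon> (\<lambda>x. \<phi> x \<bullet> i)" for i
    by (rule smooth_near_coordinate[OF atlas c])
  have "smooth_near \<A> p (\<lambda>q. X q (\<lambda>x. \<phi> (inv\<^bsub>G\<^esub> q \<cdot> x) \<bullet> i))" for i
  proof -
    have \<phi>m: "smooth_near (product_atlas \<A> \<A>) (inv\<^bsub>G\<^esub> p, p) ((\<lambda>x. \<phi> x \<bullet> i) \<circ> (\<lambda>(x, y). x \<cdot> y))"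
      by (rule smooth_pullbackD(2)[OF mul_pullback]) (simp add: sm)
    have tX: "\<forall>\<^sub>F q in nhds p. X q \<in> tangent_space \<A> q"
      using eventually_nhds_in_open[OF W p]
      by eventually_elim (rule smooth_vector_fieldD(1)[OF atlas W X])
    have "smooth_near \<A> p
        (\<lambda>q. X q (\<lambda>x. ((\<lambda>x. \<phi> x \<bullet> i) \<circ> (\<lambda>(x, y). x \<cdot> y)) (inv\<^bsub>G\<^esub> q, x)))"
      by (rule smooth_near_parametrised[where h = "\<lambda>q. inv\<^bsub>G\<^esub> q" and k = "\<lambda>q. q" and X = X,
            OF atlas atlas atlas inv_pullback smooth_pullback_id tX
              smooth_vector_fieldD(2)[OF atlas W X p] \<phi>m])
    then show ?thesis by simp
  qed
  then have "smooth_near \<A> p (\<lambda>q. \<Sum>i\<in>Basis. X q (\<lambda>x. \<phi> (inv\<^bsub>G\<^esub> q \<cdot> x) \<bullet> i) * b (?D i) e)"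
    by (intro smooth_near_sum[OF atlas] smooth_near_mult[OF atlas] smooth_near_const[OF atlas])
  moreover have "\<forall>\<^sub>F q in nhds p.
      (\<Sum>i\<in>Basis. X q (\<lambda>x. \<phi> (inv\<^bsub>G\<^esub> q \<cdot> x) \<bullet> i) * b (?D i) e) = \<theta> e X q"
    using eventually_nhds_in_open[OF W p]
  proof eventually_elim
    fix q assume q: "q \<in> W"
    let ?u = "to_identity q (X q)"
    have u: "?u \<in> \<gg>"
      by (rule to_identity_in_lie_alg[OF smooth_vector_fieldD(1)[OF atlas W X q]])
    have "?u = ?D (\<Sum>i\<in>Basis. ?u (\<lambda>x. \<phi> x \<bullet> i) *\<^sub>R i)"
      using u unfolding lie_algebra_def by (rule tangent_vector_coordinates[OF atlas c])
    also have "\<dots> = (\<Sum>i\<in>Basis. ?u (\<lambda>x. \<phi> x \<bullet> i) *\<^sub>R ?D i)"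
      by (simp add: linear_sum[OF linear_coord_vector[OF atlas c]]
          linear_scale[OF linear_coord_vector[OF atlas c]])
    finally have "b ?u e = b (\<Sum>i\<in>Basis. ?u (\<lambda>x. \<phi> x \<bullet> i) *\<^sub>R ?D i) e" by simp
    also have "\<dots> = (\<Sum>i\<in>Basis. ?u (\<lambda>x. \<phi> x \<bullet> i) * b (?D i) e)"
      by (rule inner_product_on_sum[OF inner subspace_lie_alg D_in e])
    also have "\<dots> = (\<Sum>i\<in>Basis. X q (\<lambda>x. \<phi> (inv\<^bsub>G\<^esub> q \<cdot> x) \<bullet> i) * b (?D i) e)"
      by (simp add: to_identity_def differential_def sm o_def)
    finally show "(\<Sum>i\<in>Basis. X q (\<lambda>x. \<phi> (inv\<^bsub>G\<^esub> q \<cdot> x) \<bullet> i) * b (?D i) e) = \<theta> e X q"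
      by (simp add: component_def metric_eq to_identity_left_inv_field[OF e])
  qed
  ultimately show ?thesis by (rule smooth_near_cong[OF atlas])
qed

lemma metric_smooth:
  assumes W: "open W" and X: "smooth_vector_field_on \<A> W X" and Y: "smooth_vector_field_on \<A> W Y"
    and p: "p \<in> W"
  shows "smooth_near \<A> p (\<lambda>q. \<g> q (X q) (Y q))"
proof (rule smooth_near_cong[OF atlas])
  show "smooth_near \<A> p (\<lambda>q. \<Sum>e\<in>B. \<theta> e X q * \<theta> e Y q)"
    using W X Y p
    by (intro smooth_near_sum[OF atlas] smooth_near_mult[OF atlas] component_smooth B_in)
  show "\<forall>\<^sub>F q in nhds p. (\<Sum>e\<in>B. \<theta> e X q * \<theta> e Y q) = \<g> q (X q) (Y q)"
    using eventually_nhds_in_open[OF W p]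
  proof eventually_elim
    fix q assume "q \<in> W"
    then show "(\<Sum>e\<in>B. \<theta> e X q * \<theta> e Y q) = \<g> q (X q) (Y q)"
      using metric_expansion[of "X q" q "Y q"] smooth_vector_fieldD(1)[OF atlas W X]
        smooth_vector_fieldD(1)[OF atlas W Y]
      by (simp add: component_def)
  qed
qed

lemma riemannian_metric: "riemannian_metric \<A> \<g>"
  unfolding riemannian_metric_def
  by (auto simp: metric_inner_product smooth_fun_on_iff_smooth_near[OF atlas] metric_smooth)

text \<open>The Leibniz rule expresses the bracket of any two smooth fields by derivatives of their
  components and the brackets of the frame.\<close>

lemma lie_bracket_expansion:
  assumes W: "open W" and X: "smooth_vector_field_on \<A> W X" and Y: "smooth_vector_field_on \<A> W Y"
    and p: "p \<in> W"
  shows "lie_bracket \<A> X Y p = (\<Sum>d\<in>B. (X p (\<theta> d Y) - Y p (\<theta> d X)) *\<^sub>R \<E> d p)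
     + (\<Sum>e\<in>B. \<Sum>f\<in>B. (\<theta> e X p * \<theta> f Y p) *\<^sub>R \<E> \<lbrakk>e, f\<rbrakk> p)"
proof
  fix h
  show "lie_bracket \<A> X Y p h = ((\<Sum>d\<in>B. (X p (\<theta> d Y) - Y p (\<theta> d X)) *\<^sub>R \<E> d p)
     + (\<Sum>e\<in>B. \<Sum>f\<in>B. (\<theta> e X p * \<theta> f Y p) *\<^sub>R \<E> \<lbrakk>e, f\<rbrakk> p)) h"
  proof (cases "smooth_near \<A> p h")
    case True
    have expand: "Z q k = (\<Sum>e\<in>B. \<theta> e Z q * \<E> e q k)"
      if "smooth_vector_field_on \<A> W Z" "q \<in> W" for Z q k
      using arg_cong[OF frame_expansion[OF smooth_vector_fieldD(1)[OF atlas W that]],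
          of "\<lambda>v. v k"]
      by (simp add: sum_fun_apply scaleR_fun_apply component_def)
    have second: "Z p (\<lambda>q. Z' q h) = (\<Sum>d\<in>B. Z p (\<theta> d Z') * \<E> d p h)
        + (\<Sum>e\<in>B. \<Sum>f\<in>B. \<theta> e Z p * \<theta> f Z' p * \<E> e p (\<lambda>q. \<E> f q h))"
      if Z: "smooth_vector_field_on \<A> W Z" "smooth_vector_field_on \<A> W Z'" for Z Z'
    proof -
      note tZ = smooth_vector_fieldD(1)[OF atlas W Z(1) p]
      have \<theta>: "smooth_near \<A> p (\<theta> d Z')" if "d \<in> B" for d
        by (rule component_smooth[OF B_in[OF that] W Z(2) p])
      have Eh: "smooth_near \<A> p (\<lambda>q. \<E> d q h)" if "d \<in> B" for d
        by (rule smooth_near_left_inv_field[OF B_in[OF that] True])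
      have "\<forall>\<^sub>F q in nhds p. Z' q h = (\<Sum>d\<in>B. \<theta> d Z' q * \<E> d q h)"
        using eventually_nhds_in_open[OF W p] by eventually_elim (rule expand[OF Z(2)])
      then have "Z p (\<lambda>q. Z' q h) = Z p (\<lambda>q. \<Sum>d\<in>B. \<theta> d Z' q * \<E> d q h)"
        by (rule tangent_vector_cong[OF atlas tZ])
      also have "\<dots> = (\<Sum>d\<in>B. Z p (\<lambda>q. \<theta> d Z' q * \<E> d q h))"
        by (intro tangent_vector_sum[OF atlas tZ] smooth_near_mult[OF atlas] \<theta> Eh)
      also have "\<dots> = (\<Sum>d\<in>B. \<theta> d Z' p * Z p (\<lambda>q. \<E> d q h) + Z p (\<theta> d Z') * \<E> d p h)"
        by (intro sum.cong refl tangent_vector_mult[OF atlas tZ] \<theta> Eh)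
      also have "\<dots> = (\<Sum>d\<in>B. Z p (\<theta> d Z') * \<E> d p h)
          + (\<Sum>f\<in>B. \<theta> f Z' p * (\<Sum>e\<in>B. \<theta> e Z p * \<E> e p (\<lambda>q. \<E> f q h)))"
        by (simp add: sum.distrib expand[OF Z(1) p])
      also have "(\<Sum>f\<in>B. \<theta> f Z' p * (\<Sum>e\<in>B. \<theta> e Z p * \<E> e p (\<lambda>q. \<E> f q h)))
          = (\<Sum>e\<in>B. \<Sum>f\<in>B. \<theta> e Z p * \<theta> f Z' p * \<E> e p (\<lambda>q. \<E> f q h))"
        unfolding sum_distrib_left by (subst sum.swap) (simp add: mult_ac)
      finally show ?thesis .
    qed
    have "(\<Sum>e\<in>B. \<Sum>f\<in>B. \<theta> e Y p * \<theta> f X p * \<E> e p (\<lambda>q. \<E> f q h))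
        = (\<Sum>e\<in>B. \<Sum>f\<in>B. \<theta> e X p * \<theta> f Y p * \<E> f p (\<lambda>q. \<E> e q h))"
      by (subst sum.swap) (simp add: mult_ac)
    then have "lie_bracket \<A> X Y p h = (\<Sum>d\<in>B. (X p (\<theta> d Y) - Y p (\<theta> d X)) * \<E> d p h)
        + (\<Sum>e\<in>B. \<Sum>f\<in>B. \<theta> e X p * \<theta> f Y p * \<E> \<lbrakk>e, f\<rbrakk> p h)"
      using True
      by (simp add: lie_bracket_def second[OF X Y] second[OF Y X] left_inv_field_bracket_apply
          sum_subtractf algebra_simps)
    then show ?thesis by (simp add: sum_fun_apply scaleR_fun_apply)
  next
    case False
    then show ?thesis
      by (simp add: lie_bracket_def sum_fun_apply scaleR_fun_apply left_inv_field_apply)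
  qed
qed

lemma lie_bracket_tangent:
  assumes W: "open W" and X: "smooth_vector_field_on \<A> W X" and Y: "smooth_vector_field_on \<A> W Y"
    and p: "p \<in> W"
  shows "lie_bracket \<A> X Y p \<in> tangent_space \<A> p"
  unfolding lie_bracket_expansion[OF assms]
  by (intro subspace_add subspace_sum subspace_scale subspace_tangent_space[OF atlas]
      left_inv_field_tangent B_in bracket_closed)

lemma component_lie_bracket:
  assumes W: "open W" and X: "smooth_vector_field_on \<A> W X" and Y: "smooth_vector_field_on \<A> W Y"
    and p: "p \<in> W" and d: "d \<in> B"
  shows "\<theta> d (lie_bracket \<A> X Y) p = X p (\<theta> d Y) - Y p (\<theta> d X)
     + (\<Sum>e\<in>B. \<Sum>f\<in>B. \<theta> e X p * \<theta> f Y p * b \<lbrakk>e, f\<rbrakk> d)"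
proof -
  note sub = subspace_tangent_space[OF atlas] and tE = left_inv_field_tangent
  let ?u = "\<Sum>c\<in>B. (X p (\<theta> c Y) - Y p (\<theta> c X)) *\<^sub>R \<E> c p"
  let ?w = "\<lambda>e. \<Sum>f\<in>B. (\<theta> e X p * \<theta> f Y p) *\<^sub>R \<E> \<lbrakk>e, f\<rbrakk> p"
  have w: "?w e \<in> tangent_space \<A> p" if "e \<in> B" for e
    by (intro subspace_sum sub subspace_scale tE bracket_closed that)
  have "\<theta> d (lie_bracket \<A> X Y) p = \<g> p (?u + (\<Sum>e\<in>B. ?w e)) (\<E> d p)"
    by (simp add: component_def lie_bracket_expansion[OF W X Y p])
  also have "\<dots> = \<g> p ?u (\<E> d p) + \<g> p (\<Sum>e\<in>B. ?w e) (\<E> d p)"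
    by (rule inner_product_onD(1)[OF metric_inner_product])
      (intro subspace_sum sub subspace_scale tE B_in d bracket_closed; assumption)+
  also have "\<g> p ?u (\<E> d p) = (\<Sum>c\<in>B. (X p (\<theta> c Y) - Y p (\<theta> c X)) * \<g> p (\<E> c p) (\<E> d p))"
    by (rule metric_sum) (simp_all add: tE B_in d)
  also have "\<dots> = (\<Sum>c\<in>B. if c = d then X p (\<theta> c Y) - Y p (\<theta> c X) else 0)"
    by (intro sum.cong) (simp_all add: metric_frame d)
  also have "\<dots> = X p (\<theta> d Y) - Y p (\<theta> d X)" using finite_B d by simp
  also have "\<g> p (\<Sum>e\<in>B. ?w e) (\<E> d p) = (\<Sum>e\<in>B. \<g> p (?w e) (\<E> d p))"
    using metric_sum[of B ?w p "\<E> d p" "\<lambda>_. 1"] w by (simp add: tE B_in d)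
  also have "\<dots> = (\<Sum>e\<in>B. \<Sum>f\<in>B. \<theta> e X p * \<theta> f Y p * b \<lbrakk>e, f\<rbrakk> d)"
  proof (intro sum.cong refl)
    fix e assume e: "e \<in> B"
    have "\<g> p (?w e) (\<E> d p) = (\<Sum>f\<in>B. \<theta> e X p * \<theta> f Y p * \<g> p (\<E> \<lbrakk>e, f\<rbrakk> p) (\<E> d p))"
      by (rule metric_sum) (simp_all add: tE B_in d bracket_closed e)
    then show "\<g> p (?w e) (\<E> d p) = (\<Sum>f\<in>B. \<theta> e X p * \<theta> f Y p * b \<lbrakk>e, f\<rbrakk> d)"
      by (simp add: metric_left_inv_field bracket_closed e B_in d)
  qed
  finally show ?thesis .
qed

lemma lie_bracket_smooth:
  assumes W: "open W" and X: "smooth_vector_field_on \<A> W X" and Y: "smooth_vector_field_on \<A> W Y"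
  shows "smooth_vector_field_on \<A> W (lie_bracket \<A> X Y)"
proof (rule smooth_vector_field_on_combination[OF atlas W])
  fix p assume p: "p \<in> W"
  show "lie_bracket \<A> X Y p = (\<Sum>d\<in>B. \<theta> d (lie_bracket \<A> X Y) p *\<^sub>R \<E> d p)"
    unfolding component_def by (rule frame_expansion[OF lie_bracket_tangent[OF W X Y p]])
next
  fix d assume d: "d \<in> B"
  show "smooth_vector_field_on \<A> W (\<E> d)" by (rule left_inv_field_smooth[OF B_in[OF d] W])
  fix p assume p: "p \<in> W"
  have "smooth_near \<A> p (\<lambda>q. X q (\<theta> d Y) - Y q (\<theta> d X)
     + (\<Sum>e\<in>B. \<Sum>f\<in>B. \<theta> e X q * \<theta> f Y q * b \<lbrakk>e, f\<rbrakk> d))"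
    using d p W X Y
    by (intro smooth_near_add[OF atlas] smooth_near_diff[OF atlas] smooth_near_sum[OF atlas]
        smooth_near_mult[OF atlas] smooth_near_const[OF atlas] component_smooth
        smooth_vector_fieldD(2)[OF atlas W X] smooth_vector_fieldD(2)[OF atlas W Y] B_in)
  then show "smooth_near \<A> p (\<theta> d (lie_bracket \<A> X Y))"
    by (rule smooth_near_cong[OF atlas])
      (use eventually_nhds_in_open[OF W p] component_lie_bracket[OF W X Y _ d] in
        \<open>auto elim: eventually_mono\<close>)
qed

end

section \<open>Left-invariant bundles spanned by part of a frame\<close>

lemma orthonormal_independent:
  assumes b: "inner_product_on S b" and S: "subspace S"
    and B: "finite B" "B \<subseteq> S" "orthonormal_on b B"
  shows "independent B"
  unfolding independent_explicit_finite_subsets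
proof (intro allI impI ballI)
  fix A u e assume A: "A \<subseteq> B" "finite A" and sum: "(\<Sum>f\<in>A. u f *\<^sub>R f) = 0" and e: "e \<in> A"
  have "(\<Sum>f\<in>A. u f * b f e) = b (\<Sum>f\<in>A. u f *\<^sub>R f) e"
    using A(1) B(2) e by (intro inner_product_on_sum[OF b S, symmetric]) auto
  also have "\<dots> = 0"
    using inner_product_on_sum[OF b S, of "{}" _ e "\<lambda>_. 0"] A(1) B(2) e sum by auto
  finally have "(\<Sum>f\<in>A. u f * b f e) = 0" .
  moreover have "b f e = (if f = e then 1 else 0)" if "f \<in> A" for f
    using B(3) A(1) e that unfolding orthonormal_on_def by blast
  then have "(\<Sum>f\<in>A. u f * b f e) = (\<Sum>f\<in>A. if f = e then u f else 0)"
    by (intro sum.cong) simp_all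
  ultimately show "u e = 0" using A(2) e by simp
qed

context left_invariant_frame
begin

text \<open>Membership in the bundle spanned by part of the frame means the vanishing of the other
  components; in this form sections of the bundle enter the formula for the bracket.\<close>

lemma left_invariant_bundle_iff:
  assumes B: "B = C \<union> D" "C \<inter> D = {}"
  shows "u \<in> left_invariant_bundle G \<A> (span D) p \<longleftrightarrow>
    u \<in> tangent_space \<A> p \<and> (\<forall>c\<in>C. \<g> p u (\<E> c p) = 0)"
proof (intro iffI conjI ballI)
  assume "u \<in> left_invariant_bundle G \<A> (span D) p"
  then obtain v where v: "v \<in> span D" "u = \<E> v p" by (auto simp: left_invariant_bundle_def)
  have D: "D \<subseteq> \<gg>" "finite D" using B(1) B_in finite_B by auto
  have vg: "v \<in> \<gg>" using v(1) span_minimal[OF D(1) subspace_lie_alg] by blast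
  then show "u \<in> tangent_space \<A> p" by (simp add: v(2) left_inv_field_tangent)
  fix c assume c: "c \<in> C"
  have "b v c = b (\<Sum>e\<in>D. b v e *\<^sub>R e) c"
    using orthonormal_expansion[OF inner subspace_lie_alg D(2,1) _ v(1)] orthonormal_B B(1)
    by (simp add: orthonormal_on_def)
  also have "\<dots> = (\<Sum>e\<in>D. b v e * b e c)"
    using D(1) c B(1) B_in by (intro inner_product_on_sum[OF inner subspace_lie_alg]) auto
  also have "\<dots> = 0"
  proof (intro sum.neutral ballI)
    fix e assume "e \<in> D"
    then have "e \<noteq> c" "e \<in> B" "c \<in> B" using c B by auto
    then show "b v e * b e c = 0" using orthonormal_B by (simp add: orthonormal_on_def)
  qed
  finally show "\<g> p u (\<E> c p) = 0"
    using c B(1) by (simp add: v(2) metric_left_inv_field vg B_in)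
next
  assume u: "u \<in> tangent_space \<A> p \<and> (\<forall>c\<in>C. \<g> p u (\<E> c p) = 0)"
  have "to_identity p u = (\<Sum>e\<in>B. \<g> p u (\<E> e p) *\<^sub>R e)"
    using u by (intro to_identity_expansion) blast
  also have "\<dots> = (\<Sum>e\<in>D. \<g> p u (\<E> e p) *\<^sub>R e)"
    using u B finite_B by (intro sum.mono_neutral_right) auto
  also have "\<dots> \<in> span D" by (intro span_sum span_scale span_base)
  finally have "to_identity p u \<in> span D" .
  then show "u \<in> left_invariant_bundle G \<A> (span D) p"
    using left_inv_field_to_identity[of u p] u unfolding left_invariant_bundle_def by force
qed

lemma orth_complement_left_invariant_bundle:
  assumes B: "B = C \<union> D" "C \<inter> D = {}"
  shows "orth_complement \<A> \<g> (left_invariant_bundle G \<A> (span D))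
    = left_invariant_bundle G \<A> (span C)"
proof -
  have B': "B = D \<union> C" "D \<inter> C = {}" using B by auto
  have "u \<in> orth_complement \<A> \<g> (left_invariant_bundle G \<A> (span D)) p
      \<longleftrightarrow> u \<in> left_invariant_bundle G \<A> (span C) p" for p u
  proof
    assume u: "u \<in> orth_complement \<A> \<g> (left_invariant_bundle G \<A> (span D)) p"
    have "\<E> d p \<in> left_invariant_bundle G \<A> (span D) p" if "d \<in> D" for d
      using that by (auto simp: left_invariant_bundle_def intro: span_base)
    then show "u \<in> left_invariant_bundle G \<A> (span C) p"
      using u unfolding left_invariant_bundle_iff[OF B'] orth_complement_def by blast
  next
    assume "u \<in> left_invariant_bundle G \<A> (span C) p"
    then have u: "u \<in> tangent_space \<A> p" "\<And>d. d \<in> D \<Longrightarrow> \<g> p u (\<E> d p) = 0"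
      unfolding left_invariant_bundle_iff[OF B'] by blast+
    have "\<g> p u w = 0" if "w \<in> left_invariant_bundle G \<A> (span D) p" for w
    proof -
      have w: "w \<in> tangent_space \<A> p" "\<And>c. c \<in> C \<Longrightarrow> \<g> p w (\<E> c p) = 0"
        using that unfolding left_invariant_bundle_iff[OF B] by blast+
      show ?thesis
        unfolding metric_expansion[OF u(1) w(1)]
        by (rule sum.neutral) (use u(2) w(2) B(1) in auto)
    qed
    then show "u \<in> orth_complement \<A> \<g> (left_invariant_bundle G \<A> (span D)) p"
      using u(1) by (simp add: orth_complement_def)
  qed
  then show ?thesis by blast
qed

lemma smooth_subbundle_left_invariant:
  assumes D: "D \<subseteq> B"
  shows "smooth_subbundle \<A> (left_invariant_bundle G \<A> (span D))"
proof -
  have fin: "finite D" using D finite_B finite_subset by blast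
  obtain h where h: "bij_betw h {..<card D} D"
    using ex_bij_betw_nat_finite[OF fin] by (auto simp: atLeast0LessThan)
  have hD: "h i \<in> D" if "i < card D" for i using h that by (auto simp: bij_betw_def)
  have 1: "\<forall>i<card D. smooth_section \<A> (left_invariant_bundle G \<A> (span D)) UNIV (\<E> (h i))"
    unfolding smooth_section_def
    using hD D B_in left_inv_field_smooth[OF _ open_UNIV]
    by (auto simp: left_invariant_bundle_def intro: span_base)
  have 2: "\<forall>q\<in>UNIV. inj_on (\<lambda>i. \<E> (h i) q) {..<card D} \<and>
      independent ((\<lambda>i. \<E> (h i) q) ` {..<card D}) \<and>
      span ((\<lambda>i. \<E> (h i) q) ` {..<card D}) = left_invariant_bundle G \<A> (span D) q"
  proof (intro ballI conjI)
    fix q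
    have im: "(\<lambda>i. \<E> (h i) q) ` {..<card D} = (\<lambda>e. \<E> e q) ` D"
      using h by (simp add: bij_betw_def flip: image_image[of "\<lambda>e. \<E> e q" h])
    show "inj_on (\<lambda>i. \<E> (h i) q) {..<card D}"
    proof (rule inj_onI)
      fix i j assume ij: "i \<in> {..<card D}" "j \<in> {..<card D}" "\<E> (h i) q = \<E> (h j) q"
      then have "h i = h j"
        using to_identity_left_inv_field[of "h i" q] to_identity_left_inv_field[of "h j" q]
          hD D B_in by (metis lessThan_iff subsetD)
      then show "i = j" using h ij by (auto simp: bij_betw_def inj_on_def)
    qed
    show "independent ((\<lambda>i. \<E> (h i) q) ` {..<card D})"
      unfolding im
    proof (rule orthonormal_independent[OF metric_inner_product subspace_tangent_space[OF atlas]])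
      show "(\<lambda>e. \<E> e q) ` D \<subseteq> tangent_space \<A> q"
        using D B_in left_inv_field_tangent by blast
      show "orthonormal_on (\<g> q) ((\<lambda>e. \<E> e q) ` D)"
        unfolding orthonormal_on_def
      proof clarify
        fix e f assume "e \<in> D" "f \<in> D"
        then have ef: "e \<in> B" "f \<in> B" using D by auto
        have "\<E> e q = \<E> f q \<longleftrightarrow> e = f"
          using to_identity_left_inv_field[of e q] to_identity_left_inv_field[of f q] ef B_in
          by metis
        then show "\<g> q (\<E> e q) (\<E> f q) = (if \<E> e q = \<E> f q then 1 else 0)"
          using ef by (simp add: metric_frame)
      qed
    qed (use fin in simp)
    show "span ((\<lambda>i. \<E> (h i) q) ` {..<card D}) = left_invariant_bundle G \<A> (span D) q"
      unfolding im left_invariant_bundle_def by (rule linear_span_image[OF linear_left_inv_field])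
  qed
  show ?thesis
    unfolding smooth_subbundle_def
    by (intro exI[of _ "card D"] allI exI[of _ UNIV] exI[of _ "\<lambda>i. \<E> (h i)"] conjI open_UNIV
        UNIV_I 1 2)
qed

end


section \<open>Horizontal and vertical frame vectors\<close>

text \<open>The two conditions on structure constants behind the theorem. In a Carnot group the first
  expresses that brackets have degree at least two, the second that the bracket with a vector of the
  first layer raises the degree and so has zero diagonal in a basis adapted to the layers.\<close>

locale split_frame = left_invariant_frame G \<A> b B
  for G :: "('g::{t2_space,second_countable_topology}, 'r) monoid_scheme"
    and \<A> :: "('g, 'e::euclidean_space) chart set" and b B +
  fixes BH BV :: "'g tangent_vector set"
  assumes B_eq: "B = BH \<union> BV" and disjoint: "BH \<inter> BV = {}"
    and bracket_vertical: "\<And>e f d. e \<in> B \<Longrightarrow> f \<in> B \<Longrightarrow> d \<in> BH \<Longrightarrow> b \<lbrakk>e, f\<rbrakk> d = 0"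
    and ad_diagonal: "\<And>h d. h \<in> BH \<Longrightarrow> d \<in> BV \<Longrightarrow> b \<lbrakk>d, h\<rbrakk> d = 0"
begin

abbreviation vertical ("\<V>") where "\<V> \<equiv> left_invariant_bundle G \<A> (span BV)"

lemma BH_in: "d \<in> BH \<Longrightarrow> d \<in> B" and BV_in: "d \<in> BV \<Longrightarrow> d \<in> B"
  using B_eq by auto

lemma vertical_iff:
  "u \<in> \<V> p \<longleftrightarrow> u \<in> tangent_space \<A> p \<and> (\<forall>d\<in>BH. \<g> p u (\<E> d p) = 0)"
  by (rule left_invariant_bundle_iff[OF B_eq disjoint])

lemma orth_complement_vertical: "orth_complement \<A> \<g> \<V> = left_invariant_bundle G \<A> (span BH)"
  by (rule orth_complement_left_invariant_bundle[OF B_eq disjoint])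

lemma component_vertical:
  assumes "smooth_section \<A> \<V> W X" "q \<in> W" "d \<in> BH"
  shows "\<theta> d X q = 0"
  using assms vertical_iff by (simp add: smooth_section_def component_def)

lemma component_horizontal:
  assumes "smooth_section \<A> (orth_complement \<A> \<g> \<V>) W X" "q \<in> W" "d \<in> BV"
  shows "\<theta> d X q = 0"
proof -
  have "B = BV \<union> BH" "BV \<inter> BH = {}" using B_eq disjoint by auto
  from left_invariant_bundle_iff[OF this] assms show ?thesis
    unfolding orth_complement_vertical by (simp add: smooth_section_def component_def)
qed

lemma derivative_zero_on_open:
  assumes v: "v \<in> tangent_space \<A> p" and W: "open W" "p \<in> W" and f: "\<And>q. q \<in> W \<Longrightarrow> f q = k"
  shows "v f = 0"
proof -
  have "\<forall>\<^sub>F q in nhds p. f q = k" using eventually_nhds_in_open[OF W] by eventually_elim (rule f)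
  from tangent_vector_cong[OF atlas v this] show ?thesis
    by (simp add: tangent_vector_const[OF atlas v])
qed

lemma involutive_vertical: "involutive \<A> \<V>"
  unfolding involutive_def
proof (intro allI impI)
  fix W X Y
  assume "open W \<and> smooth_section \<A> \<V> W X \<and> smooth_section \<A> \<V> W Y"
  then have W: "open W" and X: "smooth_section \<A> \<V> W X" and Y: "smooth_section \<A> \<V> W Y" by auto
  have X': "smooth_vector_field_on \<A> W X" and Y': "smooth_vector_field_on \<A> W Y"
    using X Y by (auto simp: smooth_section_def)
  have "lie_bracket \<A> X Y p \<in> \<V> p" if p: "p \<in> W" for p
    unfolding vertical_iff
  proof (intro conjI ballI)
    show "lie_bracket \<A> X Y p \<in> tangent_space \<A> p" by (rule lie_bracket_tangent[OF W X' Y' p])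
    fix d assume d: "d \<in> BH"
    have "X p (\<theta> d Y) = 0" "Y p (\<theta> d X) = 0"
      using smooth_vector_fieldD(1)[OF atlas W X' p] smooth_vector_fieldD(1)[OF atlas W Y' p]
        component_vertical[OF X _ d] component_vertical[OF Y _ d] W p derivative_zero_on_open
      by blast+
    then have "\<theta> d (lie_bracket \<A> X Y) p = 0"
      by (simp add: component_lie_bracket[OF W X' Y' p BH_in[OF d]] bracket_vertical d)
    then show "\<g> p (lie_bracket \<A> X Y p) (\<E> d p) = 0" by (simp add: component_def)
  qed
  then show "smooth_section \<A> \<V> W (lie_bracket \<A> X Y)"
    using lie_bracket_smooth[OF W X' Y'] by (simp add: smooth_section_def)
qed

lemma derivative_square_length:
  assumes W: "open W" and X: "smooth_vector_field_on \<A> W X" and p: "p \<in> W"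
    and v: "v \<in> tangent_space \<A> p"
  shows "v (\<lambda>q. \<g> q (X q) (X q)) = 2 * (\<Sum>d\<in>B. \<theta> d X p * v (\<theta> d X))"
proof -
  have \<theta>: "smooth_near \<A> p (\<theta> d X)" if "d \<in> B" for d
    by (rule component_smooth[OF B_in[OF that] W X p])
  have "\<forall>\<^sub>F q in nhds p. \<g> q (X q) (X q) = (\<Sum>d\<in>B. \<theta> d X q * \<theta> d X q)"
    using eventually_nhds_in_open[OF W p]
  proof eventually_elim
    fix q assume "q \<in> W"
    then show "\<g> q (X q) (X q) = (\<Sum>d\<in>B. \<theta> d X q * \<theta> d X q)"
      using metric_expansion smooth_vector_fieldD(1)[OF atlas W X] unfolding component_def by blast
  qed
  then have "v (\<lambda>q. \<g> q (X q) (X q)) = v (\<lambda>q. \<Sum>d\<in>B. \<theta> d X q * \<theta> d X q)"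
    by (rule tangent_vector_cong[OF atlas v])
  also have "\<dots> = (\<Sum>d\<in>B. v (\<lambda>q. \<theta> d X q * \<theta> d X q))"
    by (intro tangent_vector_sum[OF atlas v] smooth_near_mult[OF atlas] \<theta>)
  also have "\<dots> = (\<Sum>d\<in>B. 2 * (\<theta> d X p * v (\<theta> d X)))"
    by (intro sum.cong refl) (simp add: tangent_vector_mult[OF atlas v \<theta> \<theta>])
  finally show ?thesis by (simp add: sum_distrib_left)
qed

text \<open>For \<open>X\<close> horizontal, \<open>U\<close> vertical and \<open>d\<close> a horizontal frame vector,
  \<open>\<theta> d [U, X] = U (\<theta> d X)\<close>: the derivative of \<open>\<theta> d U = 0\<close> drops out and brackets of the frame
  have no horizontal part. Hence \<open>g([U, X], X)\<close> is half the derivative of \<open>g(X, X)\<close> along \<open>U\<close>.\<close>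

lemma bundle_like_vertical: "bundle_like_metric \<A> \<g> \<V>"
  unfolding bundle_like_metric_def
proof (intro conjI riemannian_metric allI impI ballI)
  fix W X U p
  assume "open W \<and> smooth_section \<A> (orth_complement \<A> \<g> \<V>) W X \<and> smooth_section \<A> \<V> W U"
    and p: "p \<in> W"
  then have W: "open W" and X: "smooth_section \<A> (orth_complement \<A> \<g> \<V>) W X"
    and U: "smooth_section \<A> \<V> W U" by auto
  have X': "smooth_vector_field_on \<A> W X" and U': "smooth_vector_field_on \<A> W U"
    using X U by (auto simp: smooth_section_def)
  let ?UX = "lie_bracket \<A> U X"
  note tX = smooth_vector_fieldD(1)[OF atlas W X' p] and tU = smooth_vector_fieldD(1)[OF atlas W U' p]
    and tUX = lie_bracket_tangent[OF W U' X' p]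
  have "\<theta> d ?UX p * \<theta> d X p = \<theta> d X p * U p (\<theta> d X)" if d: "d \<in> B" for d
  proof (cases "d \<in> BH")
    case True
    have "X p (\<theta> d U) = 0"
      by (rule derivative_zero_on_open[OF tX W p component_vertical[OF U _ True]])
    then show ?thesis
      by (simp add: component_lie_bracket[OF W U' X' p d] bracket_vertical True)
  next
    case False
    then have "d \<in> BV" using d B_eq by blast
    then show ?thesis by (simp add: component_horizontal[OF X p])
  qed
  then have "\<g> p (?UX p) (X p) = (\<Sum>d\<in>B. \<theta> d X p * U p (\<theta> d X))"
    unfolding metric_expansion[OF tUX tX] component_def[symmetric] by (rule sum.cong[OF refl])
  moreover have "\<g> p (X p) (?UX p) = \<g> p (?UX p) (X p)"
    by (rule inner_product_onD(3)[OF metric_inner_product tX tUX])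
  ultimately show "lie_derivative_metric \<A> \<g> U X X p = 0"
    by (simp add: lie_derivative_metric_def derivative_square_length[OF W X' p tU])
qed

text \<open>Koszul's formula for \<open>g(D\<^sub>Z Z, \<E> h)\<close> reduces to \<open>- g(Z, [Z, \<E> h])\<close>, because \<open>g(Z, \<E> h) = 0\<close>
  and \<open>g(Z, Z) = 1\<close> are constant. In components, the products of \<open>\<theta> d Z\<close> with its derivative
  along \<open>\<E> h\<close> add up to half the derivative of \<open>g(Z, Z)\<close> and drop out as well.\<close>

lemma levi_civita_horizontal_component:
  assumes D: "levi_civita_connection \<A> \<g> D" and W: "open W" and Z: "smooth_section \<A> \<V> W Z"
    and unit: "\<And>q. q \<in> W \<Longrightarrow> \<g> q (Z q) (Z q) = 1" and p: "p \<in> W" and h: "h \<in> BH"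
  shows "\<g> p (D Z Z p) (\<E> h p) = - (\<Sum>d\<in>B. \<Sum>e\<in>B. \<theta> d Z p * \<theta> e Z p * b \<lbrakk>e, h\<rbrakk> d)"
proof -
  let ?E = "\<E> h" and ?ZE = "lie_bracket \<A> Z (\<E> h)"
  have Z': "smooth_vector_field_on \<A> W Z" using Z by (simp add: smooth_section_def)
  have E': "smooth_vector_field_on \<A> W ?E" by (rule left_inv_field_smooth[OF B_in[OF BH_in[OF h]] W])
  have f: "smooth_fun_on \<A> W (\<lambda>_. 0)"
    by (simp add: smooth_fun_on_iff_smooth_near[OF atlas W] smooth_near_const[OF atlas])
  \<comment> \<open>The axioms of the connection over \<open>W\<close> come in one statement about three fields and a function;
    the function occurs in the rules for multiples of a field only and is set to zero.\<close>
  note ax = D[unfolded levi_civita_connection_def, rule_format, OF conjI, OF W conjI, OF _ conjI,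
      OF _ _ conjI, OF _ _ _ f]
  note tZ = smooth_vector_fieldD(1)[OF atlas W Z' p] and tE = smooth_vector_fieldD(1)[OF atlas W E' p]
    and tZE = lie_bracket_tangent[OF W Z' E' p]
  have smDEZ: "smooth_vector_field_on \<A> W (D ?E Z)" and smDZE: "smooth_vector_field_on \<A> W (D Z ?E)"
    using ax[OF E' Z' Z'] ax[OF Z' E' Z'] by blast+
  note tDEZ = smooth_vector_fieldD(1)[OF atlas W smDEZ p]
    and tDZE = smooth_vector_fieldD(1)[OF atlas W smDZE p]
  note add = inner_product_onD(1)[OF metric_inner_product]
    and sym = inner_product_onD(3)[OF metric_inner_product]
  have "Z p (\<lambda>q. \<g> q (Z q) (?E q)) = \<g> p (D Z Z p) (?E p) + \<g> p (Z p) (D Z ?E p)"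
    using ax[OF Z' Z' E'] p by blast
  moreover have "Z p (\<lambda>q. \<g> q (Z q) (?E q)) = 0"
    using component_vertical[OF Z _ h]
    by (intro derivative_zero_on_open[OF tZ W p]) (simp add: component_def)
  ultimately have 1: "\<g> p (D Z Z p) (?E p) = - \<g> p (Z p) (D Z ?E p)" by simp
  have unit': "?E p (\<lambda>q. \<g> q (Z q) (Z q)) = 0"
    by (rule derivative_zero_on_open[OF tE W p unit])
  moreover have "?E p (\<lambda>q. \<g> q (Z q) (Z q)) = \<g> p (D ?E Z p) (Z p) + \<g> p (Z p) (D ?E Z p)"
    using ax[OF E' Z' Z'] p by blast
  ultimately have 2: "\<g> p (D ?E Z p) (Z p) = 0" using sym[OF tZ tDEZ] by simp
  have "D Z ?E p - D ?E Z p = ?ZE p" using ax[OF Z' E' Z'] p by blast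
  then have "D Z ?E p = D ?E Z p + ?ZE p" by (simp add: algebra_simps)
  then have "\<g> p (Z p) (D Z ?E p) = \<g> p (?ZE p) (Z p)"
    using sym[OF tZ tDZE] add[OF tDEZ tZE tZ] 2 by simp
  also have "\<dots> = (\<Sum>d\<in>B. \<theta> d ?ZE p * \<theta> d Z p)"
    unfolding metric_expansion[OF tZE tZ] component_def ..
  also have "\<dots> = (\<Sum>d\<in>B. (\<Sum>e\<in>B. \<theta> d Z p * \<theta> e Z p * b \<lbrakk>e, h\<rbrakk> d) - \<theta> d Z p * ?E p (\<theta> d Z))"
  proof (intro sum.cong refl)
    fix d assume d: "d \<in> B"
    have "Z p (\<theta> d ?E) = 0"
      by (rule derivative_zero_on_open[OF tZ W p component_frame[OF d BH_in[OF h]]])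
    moreover have "(\<Sum>f\<in>B. \<theta> e Z p * \<theta> f ?E p * b \<lbrakk>e, f\<rbrakk> d) = \<theta> e Z p * b \<lbrakk>e, h\<rbrakk> d" for e
    proof -
      have "(\<Sum>f\<in>B. \<theta> e Z p * \<theta> f ?E p * b \<lbrakk>e, f\<rbrakk> d)
          = (\<Sum>f\<in>B. if f = h then \<theta> e Z p * b \<lbrakk>e, f\<rbrakk> d else 0)"
        by (intro sum.cong) (simp_all add: component_frame BH_in[OF h])
      then show ?thesis using finite_B BH_in[OF h] by simp
    qed
    ultimately have \<theta>ZE: "\<theta> d ?ZE p = (\<Sum>e\<in>B. \<theta> e Z p * b \<lbrakk>e, h\<rbrakk> d) - ?E p (\<theta> d Z)"
      by (simp add: component_lie_bracket[OF W Z' E' p d])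
    show "\<theta> d ?ZE p * \<theta> d Z p
        = (\<Sum>e\<in>B. \<theta> d Z p * \<theta> e Z p * b \<lbrakk>e, h\<rbrakk> d) - \<theta> d Z p * ?E p (\<theta> d Z)"
      unfolding \<theta>ZE by (simp add: left_diff_distrib right_diff_distrib sum_distrib_left
          sum_distrib_right mult_ac)
  qed
  also have "\<dots> = (\<Sum>d\<in>B. \<Sum>e\<in>B. \<theta> d Z p * \<theta> e Z p * b \<lbrakk>e, h\<rbrakk> d)"
    using unit' derivative_square_length[OF W Z' p tE] by (simp add: sum_subtractf)
  finally show ?thesis using 1 by simp
qed

text \<open>Row orthogonality of the matrix relating two orthonormal frames of the vertical bundle. It
  comes from expanding \<open>\<E> d\<close> in the frame \<open>Z\<close>.\<close>

lemma orthonormal_frame_components: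
  assumes Z: "local_orthonormal_frame \<A> \<g> \<V> W m Z" and p: "p \<in> W" and d: "d \<in> BV" and e: "e \<in> BV"
  shows "(\<Sum>i<m. \<theta> d (Z i) p * \<theta> e (Z i) p) = (if d = e then 1 else 0)"
proof -
  let ?Z = "(\<lambda>i. Z i p) ` {..<m}"
  have on: "\<And>i j. i < m \<Longrightarrow> j < m \<Longrightarrow> \<g> p (Z i p) (Z j p) = (if i = j then 1 else 0)"
    and span: "span ?Z = \<V> p"
    using Z p unfolding local_orthonormal_frame_def by blast+
  have inj: "inj_on (\<lambda>i. Z i p) {..<m}"
  proof (rule inj_onI)
    fix i j assume "i \<in> {..<m}" "j \<in> {..<m}" "Z i p = Z j p"
    then show "i = j" using on[of i j] on[of i i] by (auto split: if_splits)
  qed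
  have sub: "?Z \<subseteq> tangent_space \<A> p" using span_superset[of ?Z] span vertical_iff by blast
  have ortho: "orthonormal_on (\<g> p) ?Z"
    using on inj by (auto simp: orthonormal_on_def inj_on_def)
  have in_span: "\<E> d p \<in> span ?Z"
    unfolding span left_invariant_bundle_def using d by (auto intro: span_base)
  note tE = left_inv_field_tangent[OF B_in[OF BV_in]]
  have sym: "\<g> p (\<E> c p) (Z i p) = \<theta> c (Z i) p" if "c \<in> BV" "i < m" for c i
    unfolding component_def
    using inner_product_onD(3)[OF metric_inner_product tE] sub that by blast
  have "\<E> d p = (\<Sum>z\<in>?Z. \<g> p (\<E> d p) z *\<^sub>R z)"
    by (rule orthonormal_expansion[OF metric_inner_product subspace_tangent_space[OF atlas]
          _ sub ortho in_span]) simp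
  also have "\<dots> = (\<Sum>i<m. \<theta> d (Z i) p *\<^sub>R Z i p)"
    by (simp add: sum.reindex[OF inj] sym d)
  finally have "\<g> p (\<E> d p) (\<E> e p) = \<g> p (\<Sum>i<m. \<theta> d (Z i) p *\<^sub>R Z i p) (\<E> e p)" by simp
  also have "\<dots> = (\<Sum>i<m. \<theta> d (Z i) p * \<theta> e (Z i) p)"
    unfolding component_def[of e] using sub by (intro metric_sum tE e) auto
  finally show ?thesis using metric_frame[OF BV_in[OF d] BV_in[OF e]] by simp
qed

text \<open>In the sum over the frame, row orthogonality leaves only the entries \<open>b [d, h] d\<close> with
  \<open>d \<in> BV\<close>, the diagonal of the bracket with \<open>h\<close>, and these are zero.\<close>

lemma mean_curvature_vertical:
  assumes D: "levi_civita_connection \<A> \<g> D" and W: "open W"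
    and Z: "local_orthonormal_frame \<A> \<g> \<V> W m Z"
  shows "smooth_section \<A> \<V> W (\<lambda>p. \<Sum>i<m. D (Z i) (Z i) p)"
proof -
  have sec: "smooth_section \<A> \<V> W (Z i)" if "i < m" for i
    using Z that by (simp add: local_orthonormal_frame_def)
  have f: "smooth_fun_on \<A> W (\<lambda>_. 0)"
    by (simp add: smooth_fun_on_iff_smooth_near[OF atlas W] smooth_near_const[OF atlas])
  have smD: "smooth_vector_field_on \<A> W (D (Z i) (Z i))" if "i < m" for i
  proof -
    have "smooth_vector_field_on \<A> W (Z i)" using sec[OF that] by (simp add: smooth_section_def)
    then show ?thesis using D W f unfolding levi_civita_connection_def by blast
  qed
  let ?S = "\<lambda>p. \<Sum>i<m. D (Z i) (Z i) p"
  have smS: "smooth_vector_field_on \<A> W ?S"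
    by (rule smooth_vector_field_on_combination[OF atlas W, where I = "{..<m}" and a = "\<lambda>i p. 1"
          and Z = "\<lambda>i. D (Z i) (Z i)"])
      (use smD smooth_near_const[OF atlas] in auto)
  have mem: "?S p \<in> \<V> p" if p: "p \<in> W" for p
    unfolding vertical_iff
  proof (intro conjI ballI)
    show "?S p \<in> tangent_space \<A> p" by (rule smooth_vector_fieldD(1)[OF atlas W smS p])
    fix h assume h: "h \<in> BH"
    have "\<g> p (?S p) (\<E> h p) = (\<Sum>i<m. \<g> p (D (Z i) (Z i) p) (\<E> h p))"
      using metric_sum[of "{..<m}" "\<lambda>i. D (Z i) (Z i) p" p "\<E> h p" "\<lambda>i. 1"]
        smooth_vector_fieldD(1)[OF atlas W smD p] left_inv_field_tangent[OF B_in[OF BH_in[OF h]]]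
      by simp
    also have "\<dots> = (\<Sum>i<m. - (\<Sum>d\<in>B. \<Sum>e\<in>B. \<theta> d (Z i) p * \<theta> e (Z i) p * b \<lbrakk>e, h\<rbrakk> d))"
    proof (intro sum.cong refl)
      fix i assume "i \<in> {..<m}"
      then have i: "i < m" by simp
      have "\<g> q (Z i q) (Z i q) = 1" if "q \<in> W" for q
        using Z that i unfolding local_orthonormal_frame_def by auto
      then show "\<g> p (D (Z i) (Z i) p) (\<E> h p)
          = - (\<Sum>d\<in>B. \<Sum>e\<in>B. \<theta> d (Z i) p * \<theta> e (Z i) p * b \<lbrakk>e, h\<rbrakk> d)"
        by (rule levi_civita_horizontal_component[OF D W sec[OF i] _ p h])
    qed
    also have "\<dots> = - (\<Sum>d\<in>B. \<Sum>e\<in>B. (\<Sum>i<m. \<theta> d (Z i) p * \<theta> e (Z i) p) * b \<lbrakk>e, h\<rbrakk> d)"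
      unfolding sum_negf sum_distrib_right
      by (subst sum.swap) (simp add: sum.swap[of _ B "{..<m}"])
    also have "(\<Sum>d\<in>B. \<Sum>e\<in>B. (\<Sum>i<m. \<theta> d (Z i) p * \<theta> e (Z i) p) * b \<lbrakk>e, h\<rbrakk> d) = 0"
    proof (intro sum.neutral ballI)
      fix d e assume de: "d \<in> B" "e \<in> B"
      show "(\<Sum>i<m. \<theta> d (Z i) p * \<theta> e (Z i) p) * b \<lbrakk>e, h\<rbrakk> d = 0"
      proof (cases "d \<in> BH \<or> e \<in> BH")
        case True
        then have "(\<Sum>i<m. \<theta> d (Z i) p * \<theta> e (Z i) p) = 0"
          using component_vertical[OF sec p] by (intro sum.neutral) auto
        then show ?thesis by simp
      next
        case False
        then have "d \<in> BV" "e \<in> BV" using de B_eq by auto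
        then show ?thesis
          using orthonormal_frame_components[OF Z p] ad_diagonal[OF h] by simp
      qed
    qed
    finally show "\<g> p (?S p) (\<E> h p) = 0" by simp
  qed
  show "smooth_section \<A> \<V> W ?S"
    unfolding smooth_section_def by (intro conjI ballI smS mem)
qed

lemma minimal_leaves_vertical: "minimal_leaves \<A> \<g> \<V>"
  unfolding minimal_leaves_def
  \<comment> \<open>Matching the premises first fixes \<open>D\<close> and \<open>Z\<close>; unification with the conclusion would face the
    highly ambiguous term \<open>D (Z i) (Z i) p\<close>.\<close>
  by (intro allI impI, elim conjE, drule (2) mean_curvature_vertical)

end


section \<open>Stratified Lie algebras\<close>

text \<open>Gram-Schmidt orthogonalisation, relative to a subspace because \<open>b\<close> is an inner product on the
  Lie algebra only and not on the whole type of functionals.\<close>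

lemma ex_orthonormal_basis_of_span:
  assumes b: "inner_product_on S b" and S: "subspace S" and C: "finite C" "C \<subseteq> S"
  shows "\<exists>B. finite B \<and> B \<subseteq> S \<and> orthonormal_on b B \<and> span B = span C"
  using C
proof (induction C rule: finite_induct)
  case empty
  show ?case by (intro exI[of _ "{}"]) (simp add: orthonormal_on_def)
next
  case (insert x C)
  then obtain B where B: "finite B" "B \<subseteq> S" "orthonormal_on b B" "span B = span C" by auto
  have x: "x \<in> S" using insert.prems by simp
  have span_xC: "span (insert x C) = span (insert x B)" by (simp add: span_insert B(4))
  define y where "y = x - (\<Sum>e\<in>B. b x e *\<^sub>R e)"
  have sumB: "(\<Sum>e\<in>B. b x e *\<^sub>R e) \<in> span B"
    by (intro span_sum span_scale span_base)
  then have sumS: "(\<Sum>e\<in>B. b x e *\<^sub>R e) \<in> S"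
    using span_minimal[OF B(2) S] by blast
  have y: "y \<in> S" unfolding y_def by (rule subspace_diff[OF S x sumS])
  show ?case
  proof (cases "y = 0")
    case True
    then have "x \<in> span B" using sumB by (simp add: y_def)
    then have "span (insert x B) = span B" by (rule span_redundant)
    then show ?thesis using B span_xC by auto
  next
    case False
    have y_orth: "b y e = 0" if e: "e \<in> B" for e
    proof -
      have "b x e = b (y + (\<Sum>f\<in>B. b x f *\<^sub>R f)) e" by (simp add: y_def)
      also have "\<dots> = b y e + b (\<Sum>f\<in>B. b x f *\<^sub>R f) e"
        using B(2) e by (intro inner_product_onD(1)[OF b y sumS]) auto
      also have "b (\<Sum>f\<in>B. b x f *\<^sub>R f) e = (\<Sum>f\<in>B. b x f * b f e)"
        using B(2) e by (intro inner_product_on_sum[OF b S]) auto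
      also have "\<dots> = (\<Sum>f\<in>B. if f = e then b x f else 0)"
        using B(3) e by (intro sum.cong) (auto simp: orthonormal_on_def)
      also have "\<dots> = b x e" using B(1) e by simp
      finally show ?thesis by simp
    qed
    have pos: "b y y > 0" by (rule inner_product_onD(4)[OF b y False])
    define z where "z = (1 / sqrt (b y y)) *\<^sub>R y"
    have z: "z \<in> S" unfolding z_def by (rule subspace_scale[OF S y])
    have bz: "b z w = b y w / sqrt (b y y)" if "w \<in> S" for w
      unfolding z_def using inner_product_onD(2)[OF b y that] by simp
    have z_orth: "b z e = 0" "b e z = 0" if "e \<in> B" for e
      using bz[of e] y_orth[OF that] inner_product_onD(3)[OF b z, of e] B(2) that by auto
    have "b z z = b z y / sqrt (b y y)"
      using bz[OF z] inner_product_onD(3)[OF b y z] by simp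
    then have z_unit: "b z z = 1" using bz[OF y] pos by simp
    have "z \<notin> B"
      using z_orth[of z] z_unit by auto
    then have "orthonormal_on b (insert z B)"
      using B(3) z_orth z_unit by (auto simp: orthonormal_on_def)
    moreover have "span (insert z B) = span (insert x B)"
    proof -
      have sub: "span B \<subseteq> span (insert u B)" for u by (rule span_mono) auto
      have "y \<in> span (insert x B)"
        unfolding y_def using sumB sub by (blast intro: span_diff span_base)
      then have "z \<in> span (insert x B)" unfolding z_def by (rule span_scale)
      moreover have "x \<in> span (insert z B)"
      proof -
        have "sqrt (b y y) *\<^sub>R z + (\<Sum>e\<in>B. b x e *\<^sub>R e) \<in> span (insert z B)"
          using sumB sub by (blast intro: span_add span_scale span_base)
        moreover have "sqrt (b y y) *\<^sub>R z = y" using pos by (simp add: z_def)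
        ultimately show ?thesis by (simp add: y_def)
      qed
      ultimately show ?thesis unfolding span_eq by (auto intro: span_base)
    qed
    ultimately show ?thesis using B(1,2) z span_xC by (intro exI[of _ "insert z B"]) auto
  qed
qed

context lie_grp
begin

lemma lie_alg_finitely_spanned: "\<exists>F. finite F \<and> span F = \<gg>"
proof -
  obtain U \<phi> where c: "(U, \<phi>) \<in> \<A>" "\<epsilon> \<in> U" using chart_at[OF atlas] .
  have "span (coord_vector \<A> (U, \<phi>) \<epsilon> ` Basis) = \<gg>"
    unfolding lie_algebra_def tangent_space_eq_range[OF atlas c]
      linear_span_image[OF linear_coord_vector[OF atlas c]] by simp
  then show ?thesis using finite_Basis by blast
qed

lemma ex_orthonormal_basis_subspace:
  assumes b: "inner_product_on \<gg> b" and S: "subspace S" "S \<subseteq> \<gg>"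
  shows "\<exists>B. finite B \<and> orthonormal_on b B \<and> span B = S"
proof -
  obtain F where F: "finite F" "span F = \<gg>" using lie_alg_finitely_spanned by blast
  obtain C where C: "C \<subseteq> S" "independent C" "S \<subseteq> span C" by (rule basis_exists[of S])
  have "finite C" using independent_span_bound[OF F(1) C(2)] C(1) S(2) F(2) by blast
  moreover have "span C = S" using C S(1) span_minimal by blast
  ultimately show ?thesis
    using ex_orthonormal_basis_of_span[OF b subspace_lie_alg, of C] C(1) S(2) by auto
qed

end

text \<open>The layers of a stratification, continued by zero above the step, so that the grading
  \<open>[V i, V j] \<subseteq> V (i + j)\<close> needs no case distinction.\<close>

definition layer :: "nat \<Rightarrow> (nat \<Rightarrow> 'v set) \<Rightarrow> nat \<Rightarrow> 'v::zero set" where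
  "layer s V k = (if k \<le> s then V k else {0})"

context lie_grp
begin

context
  fixes s :: nat and V :: "nat \<Rightarrow> 'g tangent_vector set"
  assumes s: "s \<ge> 1" and strat: "stratification G \<A> s V"
begin

lemma stratum_subspace: "i \<in> {1..s} \<Longrightarrow> subspace (V i)"
  using strat by (simp add: stratification_def)

lemma strata_span: "span (\<Union>i\<in>{1..s}. V i) = \<gg>"
  using strat by (simp add: stratification_def)

lemma layer_subspace: "i \<ge> 1 \<Longrightarrow> subspace (layer s V i)"
  using stratum_subspace by (simp add: layer_def subspace_single_0)

lemma layer_in:
  assumes "i \<ge> 1" shows "layer s V i \<subseteq> \<gg>"
proof (cases "i \<le> s")
  case True
  then have "V i \<subseteq> (\<Union>i\<in>{1..s}. V i)" using assms by (intro UN_upper) simp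
  also have "\<dots> \<subseteq> \<gg>" unfolding strata_span[symmetric] by (rule span_superset)
  finally show ?thesis using True by (simp add: layer_def)
qed (simp add: layer_def subspace_0[OF subspace_lie_alg])

lemma bracket_first_layer:
  assumes u: "u \<in> layer s V 1" and v: "v \<in> layer s V j" and j: "j \<ge> 1"
  shows "\<lbrakk>u, v\<rbrakk> \<in> layer s V (Suc j)"
proof -
  have u1: "u \<in> V 1" using u s by (simp add: layer_def)
  consider "j < s" | "j = s" | "j > s" by linarith
  then show ?thesis
  proof cases
    case 1
    then have "span {\<lbrakk>u, v\<rbrakk> | u v. u \<in> V 1 \<and> v \<in> V j} = V (Suc j)"
      using strat j by (simp add: stratification_def)
    moreover have "\<lbrakk>u, v\<rbrakk> \<in> span {\<lbrakk>u, v\<rbrakk> | u v. u \<in> V 1 \<and> v \<in> V j}"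
      using u1 v 1 unfolding layer_def by (intro span_base) auto
    ultimately show ?thesis using 1 by (simp add: layer_def)
  next
    case 2
    then have "span {\<lbrakk>u, v\<rbrakk> | u v. u \<in> V 1 \<and> v \<in> V s} = {0}"
      using strat by (simp add: stratification_def)
    moreover have "\<lbrakk>u, v\<rbrakk> \<in> span {\<lbrakk>u, v\<rbrakk> | u v. u \<in> V 1 \<and> v \<in> V s}"
      using u1 v 2 unfolding layer_def by (intro span_base) auto
    ultimately show ?thesis using 2 by (simp add: layer_def)
  next
    case 3
    then show ?thesis using v u layer_in[of 1] by (auto simp: layer_def)
  qed
qed

text \<open>The grading, by induction on \<open>i\<close>: an element of \<open>V (i + 1)\<close> is a linear combination of brackets \<open>[a, c]\<close>
  with \<open>a \<in> V 1\<close> and \<open>c \<in> V i\<close>, and the Jacobi identity reduces \<open>[[a, c], v]\<close> to brackets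
  with \<open>a\<close> and with \<open>c\<close>.\<close>

lemma bracket_layer:
  assumes "i \<ge> 1" "j \<ge> 1" "u \<in> layer s V i" "v \<in> layer s V j"
  shows "\<lbrakk>u, v\<rbrakk> \<in> layer s V (i + j)"
  using assms
proof (induction i arbitrary: j u v rule: nat_induct_at_least)
  case base
  then show ?case using bracket_first_layer by simp
next
  case (Suc i)
  have v: "v \<in> \<gg>" using layer_in Suc.prems by blast
  show ?case
  proof (cases "Suc i \<le> s")
    case False
    then have "u = 0" using Suc.prems by (simp add: layer_def)
    show ?thesis
      unfolding \<open>u = 0\<close> bracket_zero(1)[OF v] by (rule subspace_0[OF layer_subspace]) simp
  next
    case True
    let ?br = "{\<lbrakk>a, c\<rbrakk> | a c. a \<in> V 1 \<and> c \<in> V i}"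
    have "span ?br = V (Suc i)"
      using strat True Suc.hyps by (simp add: stratification_def)
    then have u: "u \<in> span ?br" using Suc.prems True by (simp add: layer_def)
    have "u \<in> {u \<in> \<gg>. \<lbrakk>u, v\<rbrakk> \<in> layer s V (Suc i + j)}"
    proof (rule subsetD[OF span_minimal u])
      show "subspace {u \<in> \<gg>. \<lbrakk>u, v\<rbrakk> \<in> layer s V (Suc i + j)}"
        using subspace_lie_alg layer_subspace[of "Suc i + j"]
        by (auto simp: subspace_def bracket_add_left bracket_scale_left v)
      show "?br \<subseteq> {u \<in> \<gg>. \<lbrakk>u, v\<rbrakk> \<in> layer s V (Suc i + j)}"
      proof clarify
        fix a c assume "a \<in> V 1" "c \<in> V i"
        then have a: "a \<in> layer s V 1" and c: "c \<in> layer s V i" using s True by (auto simp: layer_def)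
        have ac: "\<lbrakk>a, c\<rbrakk> \<in> layer s V (Suc i)" by (rule bracket_first_layer[OF a c Suc.hyps])
        have av: "\<lbrakk>a, v\<rbrakk> \<in> layer s V (Suc j)" using bracket_first_layer[OF a Suc.prems(3)] Suc.prems by simp
        have cv: "\<lbrakk>c, v\<rbrakk> \<in> layer s V (i + j)" using Suc.IH[OF _ c Suc.prems(3)] Suc.prems by simp
        have "\<lbrakk>a, \<lbrakk>c, v\<rbrakk>\<rbrakk> \<in> layer s V (Suc i + j)"
          using bracket_first_layer[OF a cv] Suc.prems by simp
        moreover have "\<lbrakk>c, \<lbrakk>a, v\<rbrakk>\<rbrakk> \<in> layer s V (Suc i + j)"
          using Suc.IH[OF _ c av] by simp
        ultimately have "\<lbrakk>a, \<lbrakk>c, v\<rbrakk>\<rbrakk> - \<lbrakk>c, \<lbrakk>a, v\<rbrakk>\<rbrakk> \<in> layer s V (Suc i + j)"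
          using subspace_diff[OF layer_subspace[of "Suc i + j"]] by simp
        moreover have "\<lbrakk>\<lbrakk>a, c\<rbrakk>, v\<rbrakk> = \<lbrakk>a, \<lbrakk>c, v\<rbrakk>\<rbrakk> - \<lbrakk>c, \<lbrakk>a, v\<rbrakk>\<rbrakk>"
          using a c ac av cv v layer_in[of 1] layer_in[of i] layer_in[of "Suc i"] layer_in[of "Suc j"]
            layer_in[of "i + j"] Suc.hyps
          by (intro bracket_jacobi) auto
        ultimately show "\<lbrakk>a, c\<rbrakk> \<in> \<gg> \<and> \<lbrakk>\<lbrakk>a, c\<rbrakk>, v\<rbrakk> \<in> layer s V (Suc i + j)"
          using ac layer_in[of "Suc i"] by auto
      qed
    qed
    then show ?thesis by blast
  qed
qed

text \<open>The frame is the union of orthonormal bases of the layers; both conditions on the structure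
  constants say that a bracket lies in a layer different from that of the vector it is paired
  with.\<close>

lemma ex_split_frame:
  assumes inner: "inner_product_on \<gg> b"
    and orth: "\<And>i j u v. \<lbrakk>i \<in> {1..s}; j \<in> {1..s}; i \<noteq> j; u \<in> V i; v \<in> V j\<rbrakk> \<Longrightarrow> b u v = 0"
  shows "\<exists>BH BV. split_frame G \<A> b (BH \<union> BV) BH BV \<and> span BH = V 1
    \<and> span BV = span (\<Union>i\<in>{2..s}. V i)"
proof -
  have Vg: "V i \<subseteq> \<gg>" if "i \<in> {1..s}" for i
    using layer_in[of i] that by (simp add: layer_def)
  have "\<forall>i\<in>{1..s}. \<exists>B. finite B \<and> orthonormal_on b B \<and> span B = V i"
    using ex_orthonormal_basis_subspace[OF inner stratum_subspace Vg] by blast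
  then obtain C where C: "\<And>i. i \<in> {1..s} \<Longrightarrow> finite (C i)"
      "\<And>i. i \<in> {1..s} \<Longrightarrow> orthonormal_on b (C i)" "\<And>i. i \<in> {1..s} \<Longrightarrow> span (C i) = V i"
    by metis
  have CV: "e \<in> V i" if "i \<in> {1..s}" "e \<in> C i" for i e
    using C(3)[OF that(1)] span_base[OF that(2)] by simp
  have C_unit: "b e e = 1" if "i \<in> {1..s}" "e \<in> C i" for i e
    using C(2) that by (simp add: orthonormal_on_def)
  have same: "i = j" if "i \<in> {1..s}" "j \<in> {1..s}" "e \<in> C i" "e \<in> C j" for i j e
    using orth[OF that(1,2) _ CV[OF that(1,3)] CV[OF that(2,4)]] C_unit[OF that(1,3)] by force
  define BH where "BH = C 1"
  define BV where "BV = (\<Union>i\<in>{2..s}. C i)"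
  have "{1..s} = insert 1 {2..s}" using s by auto
  then have union: "BH \<union> BV = (\<Union>i\<in>{1..s}. C i)" by (simp add: BH_def BV_def)
  have span_Union: "span (\<Union>i\<in>I. C i) = span (\<Union>i\<in>I. V i)" if I: "I \<subseteq> {1..s}" for I
  proof (rule span_eq[THEN iffD2], intro conjI subsetI)
    fix x assume "x \<in> (\<Union>i\<in>I. C i)"
    then show "x \<in> span (\<Union>i\<in>I. V i)" using CV I by (blast intro: span_base)
  next
    fix x assume "x \<in> (\<Union>i\<in>I. V i)"
    then obtain i where i: "i \<in> I" "x \<in> span (C i)" using C(3) I by blast
    then show "x \<in> span (\<Union>i\<in>I. C i)" using span_mono[of "C i" "\<Union>i\<in>I. C i"] by blast
  qed
  have bracket: "\<lbrakk>e, f\<rbrakk> \<in> layer s V (i + j)"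
    if "i \<in> {1..s}" "j \<in> {1..s}" "e \<in> C i" "f \<in> C j" for i j e f
    using that CV by (intro bracket_layer) (auto simp: layer_def)
  have layer_orth: "b u v = 0"
    if "k \<ge> 1" "i \<in> {1..s}" "k \<noteq> i" "u \<in> layer s V k" "v \<in> V i" for k i u v
  proof (cases "k \<le> s")
    case True
    then show ?thesis using that by (intro orth[of k i]) (auto simp: layer_def)
  next
    case False
    then have "u = 0" using that(4) by (simp add: layer_def)
    then show ?thesis
      using inner_product_onD(2)[OF inner, of v v 0] Vg that(2,5) by auto
  qed
  have "split_frame G \<A> b (BH \<union> BV) BH BV"
  proof unfold_locales
    show "inner_product_on \<gg> b" by (rule inner)
    show "finite (BH \<union> BV)" using C(1) by (simp add: union)
    show "span (BH \<union> BV) = \<gg>" using span_Union[of "{1..s}"] strata_span by (simp add: union)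
    show "orthonormal_on b (BH \<union> BV)"
      unfolding orthonormal_on_def union
    proof clarify
      fix e f i j assume ij: "i \<in> {1..s}" "e \<in> C i" "j \<in> {1..s}" "f \<in> C j"
      show "b e f = (if e = f then 1 else 0)"
      proof (cases "i = j")
        case True
        then show ?thesis using C(2) ij by (simp add: orthonormal_on_def)
      next
        case False
        then have "e \<noteq> f" using same ij by blast
        then show ?thesis using orth[OF ij(1,3) False] CV ij by simp
      qed
    qed
    show "\<lbrakk>e, f\<rbrakk> \<in> \<gg>" if ef: "e \<in> BH \<union> BV" "f \<in> BH \<union> BV" for e f
    proof -
      obtain i j where ij: "i \<in> {1..s}" "j \<in> {1..s}" "e \<in> C i" "f \<in> C j"
        using ef unfolding union UN_iff by blast
      then show ?thesis using bracket[OF ij] layer_in[of "i + j"] by auto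
    qed
    show "BH \<union> BV = BH \<union> BV" ..
    show "BH \<inter> BV = {}"
    proof (rule equals0I)
      fix e assume "e \<in> BH \<inter> BV"
      then obtain i where "e \<in> C 1" "i \<in> {2..s}" "e \<in> C i" by (auto simp: BH_def BV_def)
      then show False using same[of 1 i e] s by simp
    qed
    show "b \<lbrakk>e, f\<rbrakk> d = 0" if ef: "e \<in> BH \<union> BV" "f \<in> BH \<union> BV" and d: "d \<in> BH" for e f d
    proof -
      obtain i j where ij: "i \<in> {1..s}" "j \<in> {1..s}" "e \<in> C i" "f \<in> C j"
        using ef unfolding union UN_iff by blast
      have "d \<in> V 1" using CV[of 1 d] d s by (simp add: BH_def)
      then show ?thesis using ij s by (intro layer_orth[OF _ _ _ bracket[OF ij]]) auto
    qed
    show "b \<lbrakk>d, h\<rbrakk> d = 0" if hd: "h \<in> BH" "d \<in> BV" for h d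
    proof -
      obtain i where "i \<in> {2..s}" and di: "d \<in> C i" using hd(2) by (auto simp: BV_def)
      then have i: "i \<in> {1..s}" by simp
      have h: "1 \<in> {1..s}" "h \<in> C 1" using hd(1) s by (auto simp: BH_def)
      show ?thesis
        using i h di by (intro layer_orth[OF _ i _ bracket[OF i h(1) di h(2)]] CV) auto
    qed
  qed
  moreover have "span BH = V 1" using C(3)[of 1] s by (simp add: BH_def)
  moreover have "span BV = span (\<Union>i\<in>{2..s}. V i)"
    unfolding BV_def by (rule span_Union) auto
  ultimately show ?thesis by blast
qed

end

end

theorem proposition2p1:
  fixes G :: "('g::{t2_space,second_countable_topology}, 'r) monoid_scheme"
    and \<A> :: "('g, 'e::euclidean_space) chart set"
    and s :: nat
    and V :: "nat \<Rightarrow> 'g tangent_vector set"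
    and b :: "'g tangent_vector \<Rightarrow> 'g tangent_vector \<Rightarrow> real"
    and g :: "'g metric_tensor"
    and \<H> \<V> :: "'g subbundle"
  assumes carnot: "carnot_group G \<A> s V"
    and inner: "inner_product_on (lie_algebra G \<A>) b"
    and orth: "\<And>i j u v. \<lbrakk>i \<in> {1..s}; j \<in> {1..s}; i \<noteq> j; u \<in> V i; v \<in> V j\<rbrakk> \<Longrightarrow> b u v = 0"
    and g_eq: "g = left_invariant_metric G \<A> b"
    and H_eq: "\<H> = left_invariant_bundle G \<A> (V 1)"
    and V_eq: "\<V> = left_invariant_bundle G \<A> (span (\<Union>i\<in>{2..s}. V i))"
  shows "\<H> = orth_complement \<A> g \<V> \<and>
     smooth_subbundle \<A> \<V> \<and> involutive \<A> \<V> \<and>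
     bundle_like_metric \<A> g \<V> \<and> minimal_leaves \<A> g \<V> \<and>
     (\<forall>\<F>. foliation \<A> \<F> \<and> foliation_tangent \<A> \<F> = \<V> \<longrightarrow>
        riemannian_foliation \<A> g \<F> \<and> minimal_leaves \<A> g (foliation_tangent \<A> \<F>))"
proof -
  have G: "lie_grp G \<A>" and s: "s \<ge> 1" and strat: "stratification G \<A> s V"
    using carnot by (auto simp: carnot_group_def lie_grp_def)
  have "\<exists>BH BV. split_frame G \<A> b (BH \<union> BV) BH BV \<and> span BH = V 1
    \<and> span BV = span (\<Union>i\<in>{2..s}. V i)"
    by (rule lie_grp.ex_split_frame[OF G s strat inner]) (rule orth)
  then obtain BH BV where "split_frame G \<A> b (BH \<union> BV) BH BV" and BH: "span BH = V 1"
    and BV: "span BV = span (\<Union>i\<in>{2..s}. V i)"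
    by blast
  then interpret split_frame G \<A> b "BH \<union> BV" BH BV by blast
  have V: "\<V> = left_invariant_bundle G \<A> (span BV)" by (simp add: V_eq BV)
  have "\<H> = orth_complement \<A> g \<V>"
    by (simp add: H_eq V g_eq orth_complement_vertical BH)
  moreover have "smooth_subbundle \<A> \<V>"
    unfolding V by (rule smooth_subbundle_left_invariant) auto
  moreover have "involutive \<A> \<V>" unfolding V by (rule involutive_vertical)
  moreover have "bundle_like_metric \<A> g \<V>" unfolding V g_eq by (rule bundle_like_vertical)
  moreover have "minimal_leaves \<A> g \<V>" unfolding V g_eq by (rule minimal_leaves_vertical)
  ultimately show ?thesis by (auto simp: riemannian_foliation_def)
qed

end
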